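(* Let $\mathbb{G}_\pm = (\mathbb{R}^2_\pm, d, \mathcal{L})$ be the Grushin half-planes, equipped with the Lebesgue measure $\mathcal{L}$. Let $K\in\mathbb{R}$ and $N\ge 1$ be such that $N>1$, or $N=1$ and $K\leq 0$. Then $\mathbb{G}_+$ (respectively $\mathbb{G}_-$) satisfies $\mathrm{MCP}(K,N)$ if and only if $K \leq 0$ and $N \geq 4$.
   Context: **Grushin plane and half-planes.** On $\mathbb{R}^2$ with coordinates $(x,y)$ consider the vector fields $X_1=\partial_x$, $X_2=x\,\partial_y$. A Lipschitz curve $\gamma:[0,1]\to\mathbb{R}^2$ is admissible if there exists $u=(u_1,u_2)\in L^\infty([0,1],\mathbb{R}^2)$ such that $\dot\gamma(t)=u_1(t)X_1(\gamma(t))+u_2(t)X_2(\gamma(t))$ for a.e. $t\in[0,1]$; its length is $\ell(\gamma)=\int_0^1\sqrt{u_1^2(t)+u_2^2(t)}\,dt$. The Grushin distance $d(p,q)$ is the infimum of the lengths of admissible curves joining $p$ to $q$; it is a complete metric on $\mathbb{R}^2$, continuous with respect to the Euclidean topology. The Grushin plane is $\mathbb{G}=(\mathbb{R}^2,d)$. The Grushin half-planes are $\mathbb{G}_\pm=(\mathbb{R}^2_\pm,d)$, where $\mathbb{R}^2_\pm=\{(x,y)\in\mathbb{R}^2\mid \pm x\geq 0\}$ and $d$ is the restriction of the Grushin distance. **Geodesics.** For a metric space $(X,d)$, $\mathrm{Geo}(X) = \{\gamma \in C([0,1],X) \mid d(\gamma_t,\gamma_s) = |t-s|\,d(\gamma_0,\gamma_1)\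 \forall s,t\in[0,1]\}$, and $e_t:\mathrm{Geo}(X)\to X$, $e_t(\gamma)=\gamma_t$, is the evaluation map for $t\in[0,1]$. **Measure contraction property, $K=0$.** A metric measure space $(X,d,\mathsf{m})$ satisfies $\mathrm{MCP}(0,N)$, $N\geq1$, if for all $x \in X$ there exists a measurable map $\phi : X \to \mathrm{Geo}(X)$ such that, letting $\phi_t = e_t \circ \phi$, one has $\phi_0 = x$ (constant map), $\phi_1 = \mathrm{id}_X$, and for every measurable set $A \subseteq X$ with $0<\mathsf{m}(A) < +\infty$ one has $\mathsf{m}(\phi_t(A)) \geq t^N \mathsf{m}(A)$ for all $t \in [0,1]$. **Measure contraction property, $K\neq 0$ (Ohta's definition).** Set $s_K(\theta)=\frac{\sin(\sqrt{K}\theta)}{\sqrt{K}}$ if $K>0$ and $s_K(\theta)=\frac{\sinh(\sqrt{-K}\theta)}{\sqrt{-K}}$ if $K<0$. $(X,d,\mathsf{m})$ satisfies $\mathrm{MCP}(K,N)$ (with $N>1$, or $N=1$ and $K\le 0$) if for every $x\in X$ and every measurable set $A\subseteq X$ with $0<\mathsf{m}(A)<\infty$ (and $A\subset B(x,\pi\sqrt{(N-1)/K})$ if $K>0$) there exists a probability measure $\Pi$ on $\mathrm{Geo}(X)$ such that $(e_0)_*\Pi=\delta_x$, $(e_1)_*\Pi=\mathsf{m}|_A/\mathsf{m}(A)$ and, for all $t\in[0,1]$, as measures on $X$, $$\mathsf{m}\ \geq\ (e_t)_*\left( t\left\{\frac{s_K\big(t\,\ell(\gamma)/\sqrt{N-1}\big)}{s_K\big(\ell(\gamma)/\sqrt{N-1}\big)}\right\}^{N-1}\mathsf{m}(A)\,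 d\Pi(\gamma)\right),\qquad \ell(\gamma)=d(\gamma_0,\gamma_1),$$ with the conventions $0/0=1$ and $\{\cdot\}^{N-1}=1$ if $N=1$. *)

theory Defs
  imports "HOL-Probability.Probability"
begin

section \<open>The Grushin plane\<close>

definition grushin_X1 :: "real \<times> real \<Rightarrow> real \<times> real"
  where "grushin_X1 p = (1, 0)"

definition grushin_X2 :: "real \<times> real \<Rightarrow> real \<times> real"
  where "grushin_X2 p = (0, fst p)"

text \<open>
  \<open>grushin_control \<gamma> u\<close>: the curve \<open>\<gamma>\<close> is admissible, with control \<open>u\<close>. Only the restrictions of
  \<open>\<gamma>\<close> and \<open>u\<close> to \<open>[0,1]\<close> matter.
\<close>

definition grushin_control :: "(real \<Rightarrow> real \<times> real) \<Rightarrow> (real \<Rightarrow> real \<times> real) \<Rightarrow> bool"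
  where "grushin_control \<gamma> u \<longleftrightarrow>
    (\<exists>L. L-lipschitz_on {0..1} \<gamma>) \<and>
    u \<in> borel_measurable (lebesgue_on {0..1}) \<and>
    (\<exists>C. AE t in lebesgue_on {0..1}. norm (u t) \<le> C) \<and>
    (AE t in lebesgue_on {0..1}.
      (\<gamma> has_vector_derivative
        (fst (u t) *\<^sub>R grushin_X1 (\<gamma> t) + snd (u t) *\<^sub>R grushin_X2 (\<gamma> t))) (at t within {0..1}))"

definition control_length :: "(real \<Rightarrow> real \<times> real) \<Rightarrow> real"
  where "control_length u =
    integral\<^sup>L (lebesgue_on {0..1}) (\<lambda>t. sqrt ((fst (u t))\<^sup>2 + (snd (u t))\<^sup>2))"

text \<open>
  The second control component of a curve is not determined at times when the curve lies on
  \<open>x = 0\<close>; the infimum is therefore taken over pairs of a curve and one of its controls.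
\<close>

definition grushin_dist :: "real \<times> real \<Rightarrow> real \<times> real \<Rightarrow> real"
  where "grushin_dist p q =
    Inf {control_length u | \<gamma> u. grushin_control \<gamma> u \<and> \<gamma> 0 = p \<and> \<gamma> 1 = q}"

definition grushin_plane :: "(real \<times> real) metric"
  where "grushin_plane = metric (UNIV, grushin_dist)"

definition half_plane_pos :: "(real \<times> real) set"
  where "half_plane_pos = {(x, y). x \<ge> 0}"

definition half_plane_neg :: "(real \<times> real) set"
  where "half_plane_neg = {(x, y). - x \<ge> 0}"

definition grushin_half_pos :: "(real \<times> real) metric"
  where "grushin_half_pos = submetric grushin_plane half_plane_pos"

definition grushin_half_neg :: "(real \<times> real) metric"
  where "grushin_half_neg = submetric grushin_plane half_plane_neg"


section \<open>Geodesics\<close>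

text \<open>
  The space of geodesics carries the uniform distance. As elements of the library's \<^const>\<open>cfunspace\<close>,
  curves take the value \<^const>\<open>undefined\<close> outside \<open>[0,1]\<close>, so that each geodesic is represented once.
\<close>

definition Geo :: "'a metric \<Rightarrow> (real \<Rightarrow> 'a) metric"
  where "Geo X = submetric (cfunspace (top_of_set {0..1}) X)
    {\<gamma>. \<forall>s\<in>{0..1}. \<forall>t\<in>{0..1}. mdist X (\<gamma> t) (\<gamma> s) = \<bar>t - s\<bar> * mdist X (\<gamma> 0) (\<gamma> 1)}"

definition borel_of_metric :: "'a metric \<Rightarrow> 'a measure"
  where "borel_of_metric X = sigma (mspace X) {U. openin (mtopology_of X) U}"


section \<open>The measure contraction property\<close>

text \<open>
  A metric measure space is given by a metric \<open>X\<close> and a Borel measure \<open>m\<close> on it.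

  In the case \<open>K = 0\<close>, the set \<open>\<phi>\<^sub>t(A)\<close> is the image of a Borel set, hence it need not be Borel. On a Polish
  space it is analytic and so belongs to the completion of the Borel sets; its measure there is the
  outer measure used below.
\<close>

definition MCP0 :: "'a metric \<Rightarrow> 'a measure \<Rightarrow> real \<Rightarrow> bool"
  where "MCP0 X m N \<longleftrightarrow>
    (\<forall>x\<in>mspace X. \<exists>\<phi>\<in>m \<rightarrow>\<^sub>M borel_of_metric (Geo X).
      (\<forall>y\<in>mspace X. \<phi> y 0 = x \<and> \<phi> y 1 = y) \<and>
      (\<forall>A\<in>sets m. 0 < emeasure m A \<and> emeasure m A < \<infinity> \<longrightarrow>
        (\<forall>t\<in>{0..1}. outer_measure_of m ((\<lambda>y. \<phi> y t) ` A) \<ge> ennreal (t powr N) * emeasure m A)))"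

definition s_fun :: "real \<Rightarrow> real \<Rightarrow> real"
  where "s_fun K \<theta> =
    (if K > 0 then sin (sqrt K * \<theta>) / sqrt K else sinh (sqrt (- K) * \<theta>) / sqrt (- K))"

text \<open>
  The contraction factor for a geodesic of length \<open>l\<close>. The conditions reflect the conventions
  \<open>0/0 = 1\<close> and \<open>{\<cdot>}\<^sup>N\<^sup>-\<^sup>1 = 1\<close> for \<open>N = 1\<close>.
\<close>

definition mcp_factor :: "real \<Rightarrow> real \<Rightarrow> real \<Rightarrow> real \<Rightarrow> real"
  where "mcp_factor K N t l =
    (let a = s_fun K (t * l / sqrt (N - 1)); b = s_fun K (l / sqrt (N - 1))
     in t * (if N = 1 then 1 else (if a = 0 \<and> b = 0 then 1 else a / b) powr (N - 1)))"

definition MCP_Ohta :: "'a metric \<Rightarrow> 'a measure \<Rightarrow> real \<Rightarrow> real \<Rightarrow> bool"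
  where "MCP_Ohta X m K N \<longleftrightarrow>
    (\<forall>x\<in>mspace X. \<forall>A\<in>sets m.
      0 < emeasure m A \<and> emeasure m A < \<infinity> \<and>
      (K > 0 \<longrightarrow> A \<subseteq> mball_of X x (pi * sqrt ((N - 1) / K))) \<longrightarrow>
      (\<exists>P. prob_space P \<and> sets P = sets (borel_of_metric (Geo X)) \<and>
        distr P m (\<lambda>\<gamma>. \<gamma> 0) = return m x \<and>
        distr P m (\<lambda>\<gamma>. \<gamma> 1) = uniform_measure m A \<and>
        (\<forall>t\<in>{0..1}. \<forall>B\<in>sets m. emeasure m B \<ge>
          emeasure
            (distr
              (density P (\<lambda>\<gamma>. ennreal (mcp_factor K N t (mdist X (\<gamma> 0) (\<gamma> 1))) * emeasure m A))
              m (\<lambda>\<gamma>. \<gamma> t))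
            B)))"

definition MCP :: "'a metric \<Rightarrow> 'a measure \<Rightarrow> real \<Rightarrow> real \<Rightarrow> bool"
  where "MCP X m K N \<longleftrightarrow> (if K = 0 then MCP0 X m N else MCP_Ohta X m K N)"

end

theory Submission
  imports Defs "HOL-Real_Asymp.Real_Asymp"
begin

text \<open>
  Along a curve with control \<open>u\<close> run in time \<open>s\<close>, the function
  \<open>W(s, x, y) = \<omega> y + (\<omega> / 2) cot(\<omega> s + \<beta>) x\<^sup>2\<close> solves the Hamilton--Jacobi equation
  \<open>W\<^sub>s + (W\<^sub>x\<^sup>2 + x\<^sup>2 W\<^sub>y\<^sup>2) / 2 = 0\<close> as long as \<open>\<omega> s + \<beta>\<close> stays in \<open>(0, \<pi>)\<close>, which bounds the squared distance
  from below by the increment of \<open>2 W\<close>. Optimising over \<open>\<omega>\<close> and \<open>\<beta>\<close> shows that the arcs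
  \<open>x = A sin \<theta>\<close>, \<open>\<theta> \<in> [0, \<pi>]\<close>, are minimal and that they join any two points of a half-plane at
  different heights. In the coordinates \<open>(x, \<omega>)\<close> of the end point, contraction by \<open>t\<close> along arcs is affine in
  \<open>x\<close> and linear in \<open>\<omega>\<close>, and the volume inequality with exponent \<open>4\<close> becomes the monotonicity of
  \<open>(sin w - w cos a cos (a + w)) / w\<^sup>3\<close> for \<open>0 \<le> a \<le> a + w \<le> \<pi>\<close>.

  Conversely, equality in the lower bounds makes their derivatives in \<open>\<omega>\<close> and \<open>\<beta>\<close> vanish, so midpoints from the
  origin to points near the positive \<open>x\<close>-axis are unique, and taking midpoints there shrinks volume by a factor
  tending to \<open>1 / 16\<close>. For \<open>K \<le> 0\<close> this forces \<open>N \<ge> 4\<close>; for \<open>K > 0\<close> the required factor is at least \<open>1 / 2\<close> at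
  distances close to \<open>\<pi> \<surd>((N - 1) / K)\<close>.
\<close>

text \<open>Length is an integral of the speed of a merely measurable control, whereas the
  Hamilton--Jacobi inequality bounds an energy. Instead of reparametrising the curve, the time
  variable of \<open>W\<close> is driven by a normalised primitive of a positive continuous
  \<open>v\<close>. The bound becomes half the product of the integrals of \<open>v\<close> and of
  the squared speed over \<open>v\<close>; as \<open>v\<close> approaches the speed, this turns into
  half the squared length. The exponent 4 splits as 1 + 3. One factor \<open>t\<close> is the
  scaling of the frequency, \<open>t ^ 3\<close> comes from the cubic growth of the Jacobian in
  \<open>w\<close>, and the slope \<open>sin (t * w) / sin w\<close> of the contraction in
  \<open>x\<close> cancels against denominators of the two Jacobians. The value 1/16 is the same
  count at the axis. An arc of small frequency \<open>w\<close> from the origin reaches height about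
  \<open>x\<^sup>2 * w / 3\<close>; its midpoint has about half of \<open>x\<close> and exactly half
  of \<open>w\<close>, so widths are divided by 2 and heights by 8. Measurability of the choice of
  geodesics comes from continuity on finitely many Borel pieces, and the left half-plane is handled
  by reflection.\<close>

section \<open>Integrating a derivative bound that holds almost everywhere\<close>

text \<open>Difference quotients of step \<open>1 / Suc n\<close> are bounded by the Lipschitz
  constant and converge to the derivative off a negligible set, so dominated convergence applies to
  their integrals. These are differences of a primitive of \<open>g\<close> near the two ends and
  converge to \<open>g 1 - g 0\<close>.\<close>

lemma lipschitz_derivative_bound_integral:
  fixes g k :: "real \<Rightarrow> real"
  assumes lip: "L-lipschitz_on {0..1} g"
    and neg: "negligible N"
    and der: "\<And>t. t \<in> {0<..<1} - N \<Longrightarrow> \<exists>d. (g has_real_derivative d) (at t) \<and> d \<le> k t"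
    and k: "k integrable_on {0..1}"
  shows "g 1 - g 0 \<le> integral {0..1} k"
proof -
  \<comment> \<open>Constant extension beyond \<open>[0,1]\<close>: the shifted argument in the
    difference quotient stays in the domain, with the same Lipschitz constant.\<close>
  define G where "G t = g (max 0 (min 1 t))" for t
  have G_eq: "G t = g t" if "t \<in> {0..1}" for t
    using that by (simp add: G_def)
  have L0: "L \<ge> 0"
    using lip by (rule lipschitz_on_nonneg)
  have G_lip: "\<bar>G s - G t\<bar> \<le> L * \<bar>s - t\<bar>" for s t
  proof -
    have "\<bar>G s - G t\<bar> \<le> L * \<bar>max 0 (min 1 s) - max 0 (min 1 t)\<bar>"
      unfolding G_def using lipschitz_onD[OF lip, of "max 0 (min 1 s)" "max 0 (min 1 t)"]
      by (simp add: dist_real_def)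
    also have "\<dots> \<le> L * \<bar>s - t\<bar>"
      using L0 by (intro mult_left_mono) auto
    finally show ?thesis .
  qed
  have G_cont: "continuous_on S G" for S
  proof -
    have "L-lipschitz_on UNIV G"
      using G_lip L0 by (intro lipschitz_onI) (auto simp: dist_real_def)
    then show ?thesis
      using lipschitz_on_continuous_on continuous_on_subset by blast
  qed
  define F where "F t = integral {-1..t} G" for t
  have F_der: "(F has_real_derivative G t) (at t)" if "t \<in> {-1<..<3}" for t
  proof -
    have "(F has_real_derivative G t) (at t within {-1..3})"
      unfolding F_def has_real_derivative_iff_has_vector_derivative
      using that by (intro integral_has_vector_derivative G_cont) auto
    then show ?thesis
      using that by (simp add: at_within_Icc_at)
  qed
  define q where "q n t = real (Suc n) * (G (t + 1 / real (Suc n)) - G t)" for n t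
  have q_int: "(q n has_integral
      real (Suc n) * (F (1 + 1 / real (Suc n)) - F 1) - real (Suc n) * (F (0 + 1 / real (Suc n)) - F 0)) {0..1}" for n
  proof -
    have inv: "0 < 1 / real (Suc n)" "1 / real (Suc n) \<le> 1"
      by simp_all
    have "((\<lambda>t. real (Suc n) * (F (t + 1 / real (Suc n)) - F t)) has_vector_derivative q n t)
        (at t within {0..1})" if "t \<in> {0..1}" for t
    proof -
      have "(F has_real_derivative G (t + 1 / real (Suc n))) (at (t + 1 / real (Suc n)))"
        using that inv unfolding atLeastAtMost_iff
        by (intro F_der) (simp only: greaterThanLessThan_iff, linarith)
      then have "((\<lambda>t. F (t + 1 / real (Suc n))) has_real_derivative G (t + 1 / real (Suc n))) (at t)"
        by (simp add: DERIV_shift)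
      moreover have "(F has_real_derivative G t) (at t)"
        using that by (intro F_der) auto
      ultimately show ?thesis
        unfolding q_def has_real_derivative_iff_has_vector_derivative[symmetric]
        by (intro has_field_derivative_at_within[OF DERIV_cmult[OF DERIV_diff]])
    qed
    from fundamental_theorem_of_calculus[OF zero_le_one this]
    have "(q n has_integral
        real (Suc n) * (F (1 + 1 / real (Suc n)) - F 1) - real (Suc n) * (F (0 + 1 / real (Suc n)) - F 0)) {0..1}"
      by simp
    then show ?thesis .
  qed
  have lim_q: "(\<lambda>n. q n t) \<longlonglongrightarrow> d" if "(G has_real_derivative d) (at t)" for t d
  proof -
    have "((\<lambda>h. (G (t + h) - G t) / h) \<longlongrightarrow> d) (at 0)"
      using that by (simp add: DERIV_def)
    moreover have "filterlim (\<lambda>n. 1 / real (Suc n)) (at 0) sequentially"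
      using LIMSEQ_Suc[OF lim_1_over_n] by (auto simp: filterlim_at)
    ultimately have "(\<lambda>n. (G (t + 1 / real (Suc n)) - G t) / (1 / real (Suc n))) \<longlonglongrightarrow> d"
      by (rule filterlim_compose)
    then show ?thesis
      by (simp add: q_def mult.commute)
  qed
  have lim_F: "(\<lambda>n. real (Suc n) * (F (t + 1 / real (Suc n)) - F t)) \<longlonglongrightarrow> G t" if "t \<in> {0,1}" for t
  proof -
    have "(F has_real_derivative G t) (at t)"
      using that by (intro F_der) auto
    then have "((\<lambda>h. (F (t + h) - F t) / h) \<longlongrightarrow> G t) (at 0)"
      by (simp add: DERIV_def)
    moreover have "filterlim (\<lambda>n. 1 / real (Suc n)) (at 0) sequentially"
      using LIMSEQ_Suc[OF lim_1_over_n] by (auto simp: filterlim_at)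
    ultimately have "(\<lambda>n. (F (t + 1 / real (Suc n)) - F t) / (1 / real (Suc n))) \<longlonglongrightarrow> G t"
      by (rule filterlim_compose)
    then show ?thesis
      by (simp add: mult.commute)
  qed
  \<comment> \<open>The end points join the exceptional set because the constant extension may have
    a corner there.\<close>
  define M where "M = N \<union> {0, 1}"
  have M: "negligible M"
    using neg unfolding M_def by simp
  have G_der: "\<exists>d. (G has_real_derivative d) (at t) \<and> d \<le> k t" if "t \<in> {0..1} - M" for t
  proof -
    have t: "t \<in> {0<..<1} - N"
      using that by (auto simp: M_def less_le)
    obtain d where d: "(g has_real_derivative d) (at t)" "d \<le> k t"
      using der[OF t] by blast
    have "(G has_real_derivative d) (at t)"
      using t by (intro has_field_derivative_transform_within_open[OF d(1), of "{0<..<1}"])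
        (auto simp: G_eq)
    with d(2) show ?thesis by blast
  qed
  define g' where "g' t = (if t \<in> M then 0 else lim (\<lambda>n. q n t))" for t
  define q' where "q' n t = (if t \<in> M then 0 else q n t)" for n t
  have q'_int: "(q' n has_integral
      real (Suc n) * (F (1 + 1 / real (Suc n)) - F 1) - real (Suc n) * (F (0 + 1 / real (Suc n)) - F 0)) {0..1}" for n
    by (rule has_integral_spike[OF M _ q_int]) (simp add: q'_def)
  have "\<bar>q n t\<bar> \<le> L" for n t
  proof -
    have "\<bar>q n t\<bar> = real (Suc n) * \<bar>G (t + 1 / real (Suc n)) - G t\<bar>"
      by (simp add: q_def abs_mult)
    also have "\<dots> \<le> real (Suc n) * (L * \<bar>t + 1 / real (Suc n) - t\<bar>)"
      by (intro mult_left_mono G_lip) auto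
    also have "\<dots> = L" by simp
    finally show ?thesis .
  qed
  then have q'_bd: "norm (q' n t) \<le> L" for n t
    using L0 by (simp add: q'_def)
  have q'_lim: "(\<lambda>n. q' n t) \<longlonglongrightarrow> g' t" if t01: "t \<in> {0..1}" for t
  proof (cases "t \<in> M")
    case False
    then obtain d where "(G has_real_derivative d) (at t)"
      using G_der[of t] t01 by auto
    then have "(\<lambda>n. q n t) \<longlonglongrightarrow> d"
      by (rule lim_q)
    moreover from this have "lim (\<lambda>n. q n t) = d"
      by (rule limI)
    ultimately show ?thesis
      using False by (simp add: q'_def g'_def)
  qed (simp add: q'_def g'_def)
  have q'_on: "q' n integrable_on {0..1}" for n
    using q'_int by blast
  have dct: "g' integrable_on {0..1}" "(\<lambda>n. integral {0..1} (q' n)) \<longlonglongrightarrow> integral {0..1} g'"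
    using dominated_convergence[of q' "{0..1}" "\<lambda>_. L" g', OF q'_on integrable_const_ivl q'_bd q'_lim]
    by blast+
  have "(\<lambda>n. integral {0..1} (q' n)) \<longlonglongrightarrow> G 1 - G 0"
    unfolding integral_unique[OF q'_int] by (intro tendsto_diff lim_F) auto
  with dct(2) have "g 1 - g 0 = integral {0..1} g'"
    using LIMSEQ_unique by (fastforce simp: G_eq)
  also have "\<dots> \<le> integral {0..1} k"
  proof -
    define k' where "k' t = (if t \<in> M then 0 else k t)" for t
    have "(k' has_integral integral {0..1} k) {0..1}"
      by (rule has_integral_spike[OF M _ integrable_integral[OF k]]) (simp add: k'_def)
    moreover have "g' t \<le> k' t" if t01: "t \<in> {0..1}" for t
    proof (cases "t \<in> M")
      case False
      then obtain d where "(G has_real_derivative d) (at t)" "d \<le> k t"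
        using G_der[of t] t01 by auto
      then have "lim (\<lambda>n. q n t) \<le> k t"
        using limI[OF lim_q] by blast
      then show ?thesis
        using False by (simp add: k'_def g'_def)
    qed (simp add: k'_def g'_def)
    ultimately show ?thesis
      using has_integral_le integrable_integral[OF dct(1)] by blast
  qed
  finally show ?thesis .
qed

section \<open>Admissible curves\<close>

text \<open>The control is Borel and bounded everywhere, rather than Lebesgue measurable and
  essentially bounded, so that it can be composed with affine maps and concatenated without null-set
  arguments. Nothing is lost, by \<open>control_imp_adm_curve\<close>.\<close>

definition adm_curve :: "(real \<Rightarrow> real \<times> real) \<Rightarrow> (real \<Rightarrow> real \<times> real) \<Rightarrow> real \<Rightarrow> bool"
  where "adm_curve \<gamma> u l \<longleftrightarrow>
    (\<exists>L. L-lipschitz_on {0..1} \<gamma>) \<and>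
    u \<in> borel_measurable borel \<and>
    (\<exists>C. \<forall>t. norm (u t) \<le> C) \<and>
    (\<exists>N. negligible N \<and> (\<forall>t\<in>{0<..<1} - N.
      (\<gamma> has_vector_derivative (fst (u t), fst (\<gamma> t) * snd (u t))) (at t))) \<and>
    ((\<lambda>t. norm (u t)) has_integral l) {0..1}"

definition joins :: "real \<times> real \<Rightarrow> real \<times> real \<Rightarrow> real \<Rightarrow> bool"
  where "joins p q l \<longleftrightarrow> (\<exists>\<gamma> u. adm_curve \<gamma> u l \<and> \<gamma> 0 = p \<and> \<gamma> 1 = q)"

lemma borel_bounded_integrable:
  fixes f :: "real \<Rightarrow> real"
  assumes "f \<in> borel_measurable borel" "\<And>t. \<bar>f t\<bar> \<le> C"
  shows "f integrable_on {0..1}"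
proof (rule measurable_bounded_by_integrable_imp_integrable)
  show "f \<in> borel_measurable (lebesgue_on {0..1})"
    using assms(1) by (intro measurable_restrict_space1) (simp add: measurable_completion)
  show "(\<lambda>_. C) integrable_on {0..1::real}"
    by (rule integrable_const_ivl)
qed (use assms(2) in auto)

lemma AE_lebesgue_on_unit_interval:
  "(AE t in lebesgue_on {0..1::real}. P t) \<longleftrightarrow> (\<exists>N. negligible N \<and> (\<forall>t\<in>{0..1} - N. P t))"
proof
  assume "AE t in lebesgue_on {0..1}. P t"
  then have "AE t in lebesgue. t \<in> {0..1} \<longrightarrow> P t"
    by (subst (asm) AE_restrict_space_iff) auto
  then obtain N where "\<And>t. t \<in> space lebesgue - N \<Longrightarrow> t \<in> {0..1} \<longrightarrow> P t" "N \<in> null_sets lebesgue"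
    by (rule AE_E3) blast
  then show "\<exists>N. negligible N \<and> (\<forall>t\<in>{0..1} - N. P t)"
    by (intro exI[of _ N]) (auto simp: negligible_iff_null_sets)
next
  assume "\<exists>N. negligible N \<and> (\<forall>t\<in>{0..1} - N. P t)"
  then obtain N where N: "N \<in> null_sets lebesgue" "\<forall>t\<in>{0..1} - N. P t"
    by (auto simp: negligible_iff_null_sets)
  then have "AE t in lebesgue. t \<in> {0..1} \<longrightarrow> P t"
    by (intro AE_I'[of N]) auto
  then show "AE t in lebesgue_on {0..1}. P t"
    by (subst AE_restrict_space_iff) auto
qed

lemma adm_curve_imp_control:
  assumes "adm_curve \<gamma> u l"
  shows "grushin_control \<gamma> u" "control_length u = l"
proof -
  obtain N where N: "negligible N" "\<And>t. t \<in> {0<..<1} - N \<Longrightarrow>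
      (\<gamma> has_vector_derivative (fst (u t), fst (\<gamma> t) * snd (u t))) (at t)"
    using assms unfolding adm_curve_def by blast
  have "u \<in> borel_measurable (lebesgue_on {0..1})"
    using assms unfolding adm_curve_def
    by (intro measurable_restrict_space1) (simp add: measurable_completion)
  moreover have "AE t in lebesgue_on {0..1}.
      (\<gamma> has_vector_derivative
        (fst (u t) *\<^sub>R grushin_X1 (\<gamma> t) + snd (u t) *\<^sub>R grushin_X2 (\<gamma> t))) (at t within {0..1})"
    unfolding AE_lebesgue_on_unit_interval
  proof (intro exI[of _ "N \<union> {0, 1}"] conjI ballI)
    show "negligible (N \<union> {0, 1})"
      using N(1) by simp
    fix t :: real assume "t \<in> {0..1} - (N \<union> {0, 1})"
    then have "t \<in> {0<..<1} - N"
      by (auto simp: less_le)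
    from has_vector_derivative_at_within[OF N(2)[OF this]]
    show "(\<gamma> has_vector_derivative
        (fst (u t) *\<^sub>R grushin_X1 (\<gamma> t) + snd (u t) *\<^sub>R grushin_X2 (\<gamma> t))) (at t within {0..1})"
      by (simp add: grushin_X1_def grushin_X2_def mult.commute)
  qed
  ultimately show "grushin_control \<gamma> u"
    using assms unfolding grushin_control_def adm_curve_def by auto
  have bd: "\<exists>C. \<forall>t. norm (u t) \<le> C" and int: "((\<lambda>t. norm (u t)) has_integral l) {0..1}"
    and meas: "u \<in> borel_measurable borel"
    using assms unfolding adm_curve_def by auto
  have "(\<lambda>t. norm (u t)) absolutely_integrable_on {0..1}"
    using int by (intro nonnegative_absolutely_integrable_1) auto
  then have "integral\<^sup>L (lebesgue_on {0..1}) (\<lambda>t. norm (u t)) = integral {0..1} (\<lambda>t. norm (u t))"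
    by (intro lebesgue_integral_eq_integral) (auto simp: absolutely_integrable_imp_integrable)
  also have "\<dots> = l"
    using int by (rule integral_unique)
  finally show "control_length u = l"
    by (simp add: control_length_def norm_prod_def)
qed

text \<open>A Lebesgue measurable control agrees almost everywhere with a Borel one. Setting the
  latter to 0 where it exceeds the essential bound changes it only on a null set, so the curve and
  the length stay the same.\<close>

lemma control_imp_adm_curve:
  assumes "grushin_control \<gamma> u"
  shows "\<exists>v. adm_curve \<gamma> v (control_length u)"
proof -
  obtain L C where L: "L-lipschitz_on {0..1} \<gamma>"
    and um: "u \<in> borel_measurable (lebesgue_on {0..1})"
    and C: "AE t in lebesgue_on {0..1}. norm (u t) \<le> C"
    and der: "AE t in lebesgue_on {0..1}.
      (\<gamma> has_vector_derivative
        (fst (u t) *\<^sub>R grushin_X1 (\<gamma> t) + snd (u t) *\<^sub>R grushin_X2 (\<gamma> t))) (at t within {0..1})"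
    using assms unfolding grushin_control_def by blast
  define w where "w t = (if t \<in> {0..1} then u t else 0)" for t
  have wm: "w \<in> borel_measurable lebesgue"
    using um unfolding w_def by (rule borel_measurable_if_I) simp
  have "(\<lambda>t. fst (w t)) \<in> borel_measurable lebesgue" "(\<lambda>t. snd (w t)) \<in> borel_measurable lebesgue"
    using borel_measurable_continuous_on[OF continuous_on_fst[OF continuous_on_id] wm]
      borel_measurable_continuous_on[OF continuous_on_snd[OF continuous_on_id] wm] by auto
  from this[THEN completion_ex_borel_measurable_real]
  obtain f1 f2 where f: "f1 \<in> borel_measurable lborel" "AE t in lborel. fst (w t) = f1 t"
      "f2 \<in> borel_measurable lborel" "AE t in lborel. snd (w t) = f2 t"
    by blast
  define v where "v t = (if norm (f1 t, f2 t) \<le> C then (f1 t, f2 t) else 0)" for t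
  have "AE t in lebesgue_on {0..1}. t \<in> {0..1}"
    using AE_space[of "lebesgue_on {0..1}"] by simp
  moreover have "AE t in lebesgue_on {0..1}. fst (w t) = f1 t" "AE t in lebesgue_on {0..1}. snd (w t) = f2 t"
    using f(2,4)[THEN AE_completion] by (auto simp: AE_restrict_space_iff elim: eventually_mono)
  ultimately have ae: "AE t in lebesgue_on {0..1}. v t = u t"
    using C
  proof eventually_elim
    case (elim t)
    then have "(f1 t, f2 t) = u t"
      by (metis prod.collapse w_def)
    with elim show ?case by (simp add: v_def)
  qed
  have vm: "v \<in> borel_measurable borel"
    using f unfolding v_def by simp
  have vC: "norm (v t) \<le> \<bar>C\<bar>" for t
    by (auto simp: v_def)
  have "(\<lambda>t. norm (v t)) integrable_on {0..1}"
    by (rule borel_bounded_integrable[of _ "\<bar>C\<bar>"]) (use vm vC in auto)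
  then have vi: "(\<lambda>t. norm (v t)) absolutely_integrable_on {0..1}"
    by (intro nonnegative_absolutely_integrable_1) auto
  then have "integral {0..1} (\<lambda>t. norm (v t)) = integral\<^sup>L (lebesgue_on {0..1}) (\<lambda>t. norm (v t))"
    by (intro lebesgue_integral_eq_integral[symmetric]) (auto simp: absolutely_integrable_imp_integrable)
  also have "\<dots> = integral\<^sup>L (lebesgue_on {0..1}) (\<lambda>t. norm (u t))"
  proof (rule integral_cong_AE)
    show "(\<lambda>t. norm (v t)) \<in> borel_measurable (lebesgue_on {0..1})"
      using vm by (intro measurable_restrict_space1) (simp add: measurable_completion)
    show "(\<lambda>t. norm (u t)) \<in> borel_measurable (lebesgue_on {0..1})"
      using um by measurable
    show "AE t in lebesgue_on {0..1}. norm (v t) = norm (u t)"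
      using ae by eventually_elim simp
  qed
  also have "\<dots> = control_length u"
    by (simp add: control_length_def norm_prod_def)
  finally have "((\<lambda>t. norm (v t)) has_integral control_length u) {0..1}"
    using \<open>(\<lambda>t. norm (v t)) integrable_on {0..1}\<close> by (simp add: has_integral_iff)
  moreover have "AE t in lebesgue_on {0..1}. (\<gamma> has_vector_derivative
        (fst (v t), fst (\<gamma> t) * snd (v t))) (at t within {0..1})"
    using ae der
    by eventually_elim (simp add: grushin_X1_def grushin_X2_def mult.commute)
  then have "\<exists>N. negligible N \<and> (\<forall>t\<in>{0<..<1} - N.
      (\<gamma> has_vector_derivative (fst (v t), fst (\<gamma> t) * snd (v t))) (at t))"
    unfolding AE_lebesgue_on_unit_interval
    by (metis DiffD1 DiffD2 DiffI at_within_Icc_at atLeastAtMost_iff greaterThanLessThan_iff less_imp_le)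
  ultimately have "adm_curve \<gamma> v (control_length u)"
    unfolding adm_curve_def using L vm vC by blast
  then show ?thesis by blast
qed

lemma control_lengths_eq_joins:
  "{control_length u | \<gamma> u. grushin_control \<gamma> u \<and> \<gamma> 0 = p \<and> \<gamma> 1 = q} = {l. joins p q l}"
proof (intro equalityI subsetI)
  fix l assume "l \<in> {control_length u | \<gamma> u. grushin_control \<gamma> u \<and> \<gamma> 0 = p \<and> \<gamma> 1 = q}"
  then show "l \<in> {l. joins p q l}"
    unfolding joins_def using control_imp_adm_curve by blast
next
  fix l assume "l \<in> {l. joins p q l}"
  then show "l \<in> {control_length u | \<gamma> u. grushin_control \<gamma> u \<and> \<gamma> 0 = p \<and> \<gamma> 1 = q}"
    unfolding joins_def using adm_curve_imp_control by blast
qed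

lemma grushin_dist_eq: "grushin_dist p q = Inf {l. joins p q l}"
  by (simp add: grushin_dist_def control_lengths_eq_joins)

lemma joins_nonneg: "joins p q l \<Longrightarrow> 0 \<le> l"
  unfolding joins_def adm_curve_def by (blast intro: has_integral_nonneg norm_ge_zero)

text \<open>The explicit competitors all have constant speed \<open>l\<close>, so their length is
  read off without integration. Upper bounds on the distance enter through this lemma.\<close>

lemma joins_smooth:
  assumes "\<And>t. t \<in> {0..1} \<Longrightarrow> (\<gamma> has_vector_derivative (f t, fst (\<gamma> t) * g t)) (at t)"
    and "continuous_on UNIV f" "continuous_on UNIV g"
    and "\<And>t. t \<in> {0..1} \<Longrightarrow> norm (f t, g t) = l"
    and "\<gamma> 0 = p" "\<gamma> 1 = q"
  shows "joins p q l"
proof -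
  define u where "u t = (if t \<in> {0..1} then (f t, g t) else 0)" for t
  have "continuous_on {0..1} \<gamma>"
    by (rule continuous_at_imp_continuous_on, rule ballI, rule has_vector_derivative_continuous, rule assms(1))
  then have "continuous_on {0..1} (\<lambda>t. (f t, fst (\<gamma> t) * g t))"
    by (intro continuous_intros continuous_on_subset[OF assms(2)] continuous_on_subset[OF assms(3)]) auto
  then have "bounded ((\<lambda>t. (f t, fst (\<gamma> t) * g t)) ` {0..1})"
    by (intro compact_imp_bounded compact_continuous_image) auto
  then obtain B where B: "B > 0" "\<And>t. t \<in> {0..1} \<Longrightarrow> norm (f t, fst (\<gamma> t) * g t) \<le> B"
    unfolding bounded_pos by auto
  have "B-lipschitz_on {0..1} \<gamma>"
  proof (rule bounded_derivative_imp_lipschitz)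
    fix t :: real assume t: "t \<in> {0..1}"
    show "(\<gamma> has_derivative (\<lambda>h. h *\<^sub>R (f t, fst (\<gamma> t) * g t))) (at t within {0..1})"
      using assms(1)[OF t] by (auto simp: has_vector_derivative_def intro: has_derivative_at_withinI)
    have "onorm (\<lambda>h. h *\<^sub>R (f t, fst (\<gamma> t) * g t)) \<le> onorm (\<lambda>h::real. h) * norm (f t, fst (\<gamma> t) * g t)"
      by (rule onorm_scaleR_left_lemma) simp
    then show "onorm (\<lambda>h. h *\<^sub>R (f t, fst (\<gamma> t) * g t)) \<le> B"
      using B(2)[OF t] by (simp add: onorm_id)
  qed (use B in auto)
  moreover have "u \<in> borel_measurable borel"
    unfolding u_def using assms(2,3)[THEN borel_measurable_continuous_onI]
    by measurable
  moreover have "norm (u t) \<le> \<bar>l\<bar>" for t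
    using assms(4) by (auto simp: u_def)
  moreover have "((\<lambda>t. norm (u t)) has_integral l) {0..1}"
    by (rule has_integral_eq[where f = "\<lambda>_. l"])
      (use has_integral_const_real[of l 0 1] assms(4) in \<open>auto simp: u_def\<close>)
  moreover have "\<forall>t\<in>{0<..<1} - {}. (\<gamma> has_vector_derivative (fst (u t), fst (\<gamma> t) * snd (u t))) (at t)"
    using assms(1) by (auto simp: u_def)
  ultimately have "adm_curve \<gamma> u l"
    unfolding adm_curve_def using negligible_empty by blast
  then show ?thesis
    unfolding joins_def using assms(5,6) by blast
qed

text \<open>Reflections in both axes preserve length: since \<open>y' = x * u2\<close>, changing
  \<open>x\<close> by \<sigma> and \<open>y\<close> by \<tau> changes the second control component
  by the sign \<sigma> \<tau>.\<close>

lemma joins_reflect: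
  assumes "joins (x0, y0) (x1, y1) l" and s: "\<bar>\<sigma>\<bar> = 1" "\<bar>\<tau>\<bar> = 1"
  shows "joins (\<sigma> * x0, \<tau> * y0) (\<sigma> * x1, \<tau> * y1) l"
proof -
  obtain \<gamma> u where c: "adm_curve \<gamma> u l" and e: "\<gamma> 0 = (x0, y0)" "\<gamma> 1 = (x1, y1)"
    using assms unfolding joins_def by blast
  obtain N where N: "negligible N" "\<And>t. t \<in> {0<..<1} - N \<Longrightarrow>
      (\<gamma> has_vector_derivative (fst (u t), fst (\<gamma> t) * snd (u t))) (at t)"
    using c unfolding adm_curve_def by blast
  define T where "T r p = (\<sigma> * fst p, r * snd p)" for r and p :: "real \<times> real"
  have T: "norm (T r p) = norm p" "T r p - T r q = T r (p - q)" if "\<bar>r\<bar> = 1" for r p q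
    using s that by (simp_all add: T_def norm_prod_def abs_mult right_diff_distrib)
  have \<sigma>\<tau>: "\<bar>\<sigma> * \<tau>\<bar> = 1" "\<sigma> * \<sigma> = 1"
    using s abs_mult_self_eq[of \<sigma>] by (simp_all add: abs_mult)
  have bl: "bounded_linear (T r)" for r
    unfolding T_def
    by (intro bounded_linear_Pair bounded_linear_const_mult bounded_linear_fst bounded_linear_snd)
  have "adm_curve (\<lambda>t. T \<tau> (\<gamma> t)) (\<lambda>t. T (\<sigma> * \<tau>) (u t)) l"
  proof -
    have "\<exists>L. L-lipschitz_on {0..1} (\<lambda>t. T \<tau> (\<gamma> t))"
      using c unfolding adm_curve_def lipschitz_on_def by (auto simp: dist_norm T s)
    moreover have "(\<lambda>t. T (\<sigma> * \<tau>) (u t)) \<in> borel_measurable borel"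
      using c measurable_compose[OF _ borel_measurable_continuous_onI[OF linear_continuous_on[OF bl]]]
      unfolding adm_curve_def by blast
    moreover have "((\<lambda>t. T \<tau> (\<gamma> t)) has_vector_derivative
        (fst (T (\<sigma> * \<tau>) (u t)), fst (T \<tau> (\<gamma> t)) * snd (T (\<sigma> * \<tau>) (u t)))) (at t)"
      if "t \<in> {0<..<1} - N" for t
    proof -
      have "\<sigma> * fst (\<gamma> t) * (\<sigma> * \<tau> * snd (u t)) = (\<sigma> * \<sigma>) * (\<tau> * (fst (\<gamma> t) * snd (u t)))"
        by (simp only: mult_ac)
      also have "\<dots> = \<tau> * (fst (\<gamma> t) * snd (u t))"
        unfolding \<sigma>\<tau>(2) by simp
      finally have eq: "\<sigma> * fst (\<gamma> t) * (\<sigma> * \<tau> * snd (u t)) = \<tau> * (fst (\<gamma> t) * snd (u t))" .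
      show ?thesis
        using bounded_linear.has_vector_derivative[OF bl N(2)[OF that], of \<tau>] by (simp add: T_def eq)
    qed
    then have "\<exists>N. negligible N \<and> (\<forall>t\<in>{0<..<1} - N. ((\<lambda>t. T \<tau> (\<gamma> t)) has_vector_derivative
        (fst (T (\<sigma> * \<tau>) (u t)), fst (T \<tau> (\<gamma> t)) * snd (T (\<sigma> * \<tau>) (u t)))) (at t))"
      using N(1) by blast
    ultimately show ?thesis
      using c unfolding adm_curve_def T(1)[OF \<sigma>\<tau>(1)] by blast
  qed
  then show ?thesis
    unfolding joins_def using e
    by (intro exI[of _ "\<lambda>t. T \<tau> (\<gamma> t)"] exI[of _ "\<lambda>t. T (\<sigma> * \<tau>) (u t)"]) (simp add: T_def)
qed

lemma joins_reflect_y: "joins (x0, y0) (x1, y1) l \<Longrightarrow> joins (x0, - y0) (x1, - y1) l"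
  using joins_reflect[of x0 y0 x1 y1 l 1 "- 1"] by simp

lemma joins_reflect_x: "joins (x0, y0) (x1, y1) l \<Longrightarrow> joins (- x0, y0) (- x1, y1) l"
  using joins_reflect[of x0 y0 x1 y1 l "- 1" 1] by simp

lemma joins_refl: "joins p p 0"
  by (rule joins_smooth[where \<gamma> = "\<lambda>_. p" and f = "\<lambda>_. 0" and g = "\<lambda>_. 0"])
    (auto simp: zero_prod_def[symmetric])

lemma negligible_affine_preimage:
  fixes N :: "real set"
  assumes "negligible N" "a \<noteq> 0"
  shows "negligible {t. a * t + b \<in> N}"
proof -
  have "negligible ((\<lambda>x. (x - b) / a) ` N)"
    using assms by (intro negligible_differentiable_image_negligible) (auto simp: differentiable_on_def divide_inverse intro!: derivative_intros)
  also have "(\<lambda>x. (x - b) / a) ` N = {t. a * t + b \<in> N}"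
    using assms(2) by (force simp: image_iff field_simps)
  finally show ?thesis .
qed

lemma adm_curveE:
  assumes "adm_curve \<gamma> u l"
  obtains L C N where "L-lipschitz_on {0..1} \<gamma>" "u \<in> borel_measurable borel"
    "\<And>t. norm (u t) \<le> C" "negligible N"
    "\<And>t. t \<in> {0<..<1} - N \<Longrightarrow>
      (\<gamma> has_vector_derivative (fst (u t), fst (\<gamma> t) * snd (u t))) (at t)"
    "((\<lambda>t. norm (u t)) has_integral l) {0..1}"
  using assms unfolding adm_curve_def by blast

lemma adm_curveI:
  assumes "L-lipschitz_on {0..1} \<gamma>" "u \<in> borel_measurable borel"
    "\<And>t. norm (u t) \<le> C" "negligible N"
    "\<And>t. t \<in> {0<..<1} - N \<Longrightarrow>
      (\<gamma> has_vector_derivative (fst (u t), fst (\<gamma> t) * snd (u t))) (at t)"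
    "((\<lambda>t. norm (u t)) has_integral l) {0..1}"
  shows "adm_curve \<gamma> u l"
  using assms unfolding adm_curve_def by blast

lemma lipschitz_on_affine_compose:
  fixes f :: "real \<Rightarrow> 'a::metric_space"
  assumes "L-lipschitz_on S f" "(\<lambda>t. a * t + b) ` T \<subseteq> S"
  shows "(L * \<bar>a\<bar>)-lipschitz_on T (\<lambda>t. f (a * t + b))"
proof (rule lipschitz_onI)
  fix s t assume "s \<in> T" "t \<in> T"
  then have "dist (f (a * s + b)) (f (a * t + b)) \<le> L * dist (a * s + b) (a * t + b)"
    using assms by (intro lipschitz_onD) auto
  also have "dist (a * s + b) (a * t + b) = \<bar>a\<bar> * dist s t"
    by (simp add: dist_real_def flip: abs_mult right_diff_distrib)
  finally show "dist (f (a * s + b)) (f (a * t + b)) \<le> L * \<bar>a\<bar> * dist s t"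
    by (simp add: mult.assoc)
qed (use lipschitz_on_nonneg[OF assms(1)] in simp)

lemma has_vector_derivative_affine_compose:
  fixes f :: "real \<Rightarrow> 'a::real_normed_vector"
  assumes "(f has_vector_derivative d) (at (a * t + b))"
  shows "((\<lambda>t. f (a * t + b)) has_vector_derivative a *\<^sub>R d) (at t)"
proof -
  have "((\<lambda>t. a * t + b) has_vector_derivative a) (at t)"
    by (auto intro!: derivative_eq_intros simp flip: has_real_derivative_iff_has_vector_derivative)
  from vector_diff_chain_at[OF this assms] show ?thesis
    by (simp add: o_def)
qed

lemma joins_sym:
  assumes "joins p q l"
  shows "joins q p l"
proof -
  obtain \<gamma> u where c: "adm_curve \<gamma> u l" and e: "\<gamma> 0 = p" "\<gamma> 1 = q"
    using assms unfolding joins_def by blast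
  from c obtain L C N where h: "L-lipschitz_on {0..1} \<gamma>" "u \<in> borel_measurable borel"
    "\<And>t. norm (u t) \<le> C" "negligible N"
    "\<And>t. t \<in> {0<..<1} - N \<Longrightarrow>
      (\<gamma> has_vector_derivative (fst (u t), fst (\<gamma> t) * snd (u t))) (at t)"
    "((\<lambda>t. norm (u t)) has_integral l) {0..1}"
    by (rule adm_curveE) (rule that)
  have "adm_curve (\<lambda>t. \<gamma> (- 1 * t + 1)) (\<lambda>t. - u (- 1 * t + 1)) l"
  proof (rule adm_curveI[where N = "{t. - 1 * t + 1 \<in> N}"])
    show "(L * \<bar>- 1\<bar>)-lipschitz_on {0..1} (\<lambda>t. \<gamma> (- 1 * t + 1))"
      by (intro lipschitz_on_affine_compose[OF h(1)]) auto
    show "(\<lambda>t. - u (- 1 * t + 1)) \<in> borel_measurable borel"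
      using h(2) by measurable
    show "norm (- u (- 1 * t + 1)) \<le> C" for t
      using h(3) by simp
    show "negligible {t. - 1 * t + 1 \<in> N}"
      by (rule negligible_affine_preimage[OF h(4)]) simp
    show "((\<lambda>t. \<gamma> (- 1 * t + 1)) has_vector_derivative
        (fst (- u (- 1 * t + 1)), fst (\<gamma> (- 1 * t + 1)) * snd (- u (- 1 * t + 1)))) (at t)"
      if "t \<in> {0<..<1} - {t. - 1 * t + 1 \<in> N}" for t
      using has_vector_derivative_affine_compose[OF h(5)[of "- 1 * t + 1"]] that by simp
    have "((\<lambda>t. norm (u (1 *\<^sub>R t + 1))) has_integral l /\<^sub>R 1 ^ DIM(real)) (cbox ((0 - 1) /\<^sub>R 1) ((1 - 1) /\<^sub>R 1))"
      using h(6) by (intro has_integral_affinity'[where f = "\<lambda>t. norm (u t)"]) auto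
    then have "((\<lambda>t. norm (u (t + 1))) has_integral l) {-1..-0}"
      by simp
    then have "((\<lambda>t. norm (u (- t + 1))) has_integral l) {0..1}"
      using has_integral_reflect_real[where a = 0 and b = 1 and f = "\<lambda>t. norm (u (- t + 1))" and i = l] by simp
    then show "((\<lambda>t. norm (- u (- 1 * t + 1))) has_integral l) {0..1}"
      by simp
  qed
  moreover have "\<gamma> (- 1 * 0 + 1) = q" "\<gamma> (- 1 * 1 + 1) = p"
    using e by simp_all
  ultimately show ?thesis
    unfolding joins_def by blast
qed

lemma joins_trans:
  assumes "joins p q l" "joins q r m"
  shows "joins p r (l + m)"
proof -
  obtain \<gamma> u where c: "adm_curve \<gamma> u l" and e: "\<gamma> 0 = p" "\<gamma> 1 = q"
    using assms unfolding joins_def by blast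
  from c obtain L C N where h: "L-lipschitz_on {0..1} \<gamma>" "u \<in> borel_measurable borel"
    "\<And>t. norm (u t) \<le> C" "negligible N"
    "\<And>t. t \<in> {0<..<1} - N \<Longrightarrow>
      (\<gamma> has_vector_derivative (fst (u t), fst (\<gamma> t) * snd (u t))) (at t)"
    "((\<lambda>t. norm (u t)) has_integral l) {0..1}"
    by (rule adm_curveE) (rule that)
  obtain \<delta> v where c': "adm_curve \<delta> v m" and e': "\<delta> 0 = q" "\<delta> 1 = r"
    using assms unfolding joins_def by blast
  from c' obtain L' C' N' where h': "L'-lipschitz_on {0..1} \<delta>" "v \<in> borel_measurable borel"
    "\<And>t. norm (v t) \<le> C'" "negligible N'"
    "\<And>t. t \<in> {0<..<1} - N' \<Longrightarrow>
      (\<delta> has_vector_derivative (fst (v t), fst (\<delta> t) * snd (v t))) (at t)"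
    "((\<lambda>t. norm (v t)) has_integral m) {0..1}"
    by (rule adm_curveE) (rule that)
  define \<eta> where "\<eta> t = (if t \<le> 1 / 2 then \<gamma> (2 * t + 0) else \<delta> (2 * t + - 1))" for t
  define w where "w t = (if t \<le> 1 / 2 then 2 *\<^sub>R u (2 * t + 0) else 2 *\<^sub>R v (2 * t + - 1))" for t
  \<comment> \<open>The time \<open>1 / 2\<close> is excluded because the concatenation need not be
    differentiable at the junction.\<close>
  define M where "M = {1 / 2} \<union> ({t. 2 * t + 0 \<in> N} \<union> {t. 2 * t + - 1 \<in> N'})"
  have "adm_curve \<eta> w (l + m)"
  proof (rule adm_curveI[where N = M])
    show "(max (L * \<bar>2\<bar>) (L' * \<bar>2\<bar>))-lipschitz_on {0..1} \<eta>"
      unfolding \<eta>_def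
    proof (rule lipschitz_on_concat_max)
      show "(L * \<bar>2\<bar>)-lipschitz_on {0..1 / 2} (\<lambda>t. \<gamma> (2 * t + 0))"
        by (intro lipschitz_on_affine_compose[OF h(1)]) auto
      show "(L' * \<bar>2\<bar>)-lipschitz_on {1 / 2..1} (\<lambda>t. \<delta> (2 * t + - 1))"
        by (intro lipschitz_on_affine_compose[OF h'(1)]) auto
    qed (use e e' in auto)
    show "w \<in> borel_measurable borel"
      unfolding w_def using h(2) h'(2) by measurable
    show "norm (w t) \<le> max (2 * C) (2 * C')" for t
      using h(3)[of "2 * t + 0"] h'(3)[of "2 * t + - 1"] by (auto simp: w_def)
    show "negligible M"
      unfolding M_def using h(4) h'(4)
      by (intro negligible_Un negligible_affine_preimage) auto
    show "(\<eta> has_vector_derivative (fst (w t), fst (\<eta> t) * snd (w t))) (at t)"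
      if t: "t \<in> {0<..<1} - M" for t
    proof (cases "t < 1 / 2")
      case True
      have "((\<lambda>t. \<gamma> (2 * t + 0)) has_vector_derivative (fst (w t), fst (\<eta> t) * snd (w t))) (at t)"
        using has_vector_derivative_affine_compose[OF h(5)[of "2 * t + 0"]] t True
        by (simp add: M_def w_def \<eta>_def mult.left_commute)
      then show ?thesis
        by (rule has_vector_derivative_transform_within_open[of _ _ _ "{..<1 / 2}"])
          (use True in \<open>auto simp: \<eta>_def\<close>)
    next
      case False
      then have t2: "1 / 2 < t"
        using t by (auto simp: M_def less_le)
      have "((\<lambda>t. \<delta> (2 * t + - 1)) has_vector_derivative (fst (w t), fst (\<eta> t) * snd (w t))) (at t)"
        using has_vector_derivative_affine_compose[OF h'(5)[of "2 * t + - 1"]] t t2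
        by (simp add: M_def w_def \<eta>_def mult.left_commute)
      then show ?thesis
        by (rule has_vector_derivative_transform_within_open[of _ _ _ "{1 / 2<..}"])
          (use t2 in \<open>auto simp: \<eta>_def\<close>)
    qed
    have "((\<lambda>t. norm (u (2 *\<^sub>R t + 0))) has_integral l /\<^sub>R 2 ^ DIM(real)) (cbox ((0 - 0) /\<^sub>R 2) ((1 - 0) /\<^sub>R 2))"
      using h(6) by (intro has_integral_affinity'[where f = "\<lambda>t. norm (u t)"]) auto
    from has_integral_mult_right[OF this, of 2]
    have "((\<lambda>t. 2 * norm (u (2 * t + 0))) has_integral l) {0..1 / 2}"
      by simp
    then have 1: "((\<lambda>t. norm (w t)) has_integral l) {0..1 / 2}"
      by (rule has_integral_eq[rotated]) (simp add: w_def)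
    have "((\<lambda>t. norm (v (2 *\<^sub>R t + - 1))) has_integral m /\<^sub>R 2 ^ DIM(real)) (cbox ((0 - - 1) /\<^sub>R 2) ((1 - - 1) /\<^sub>R 2))"
      using h'(6) by (intro has_integral_affinity'[where f = "\<lambda>t. norm (v t)"]) auto
    from has_integral_mult_right[OF this, of 2]
    have "((\<lambda>t. 2 * norm (v (2 * t + - 1))) has_integral m) {1 / 2..1}"
      by simp
    then have 2: "((\<lambda>t. norm (w t)) has_integral m) {1 / 2..1}"
      by (rule has_integral_spike[of "{1 / 2}", rotated 2]) (auto simp: w_def)
    show "((\<lambda>t. norm (w t)) has_integral l + m) {0..1}"
      by (rule has_integral_combine[OF _ _ 1 2]) auto
  qed
  moreover have "\<eta> 0 = p" "\<eta> 1 = r"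
    using e e' by (simp_all add: \<eta>_def)
  ultimately show ?thesis
    unfolding joins_def by blast
qed

section \<open>A calibration for the length\<close>

lemma lipschitz_on_mult_unit_interval:
  fixes f g :: "real \<Rightarrow> real"
  assumes "K-lipschitz_on {0..1} f" "M-lipschitz_on {0..1} g"
  shows "\<exists>L. L-lipschitz_on {0..1} (\<lambda>t. f t * g t)"
proof -
  have K: "K \<ge> 0" and M: "M \<ge> 0"
    using assms lipschitz_on_nonneg by blast+
  have fl: "\<bar>f s - f t\<bar> \<le> K * \<bar>s - t\<bar>" and gl: "\<bar>g s - g t\<bar> \<le> M * \<bar>s - t\<bar>"
    if "s \<in> {0..1}" "t \<in> {0..1}" for s t
    using that lipschitz_onD[OF assms(1)] lipschitz_onD[OF assms(2)] by (auto simp: dist_real_def)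
  have fb: "\<bar>f t\<bar> \<le> \<bar>f 0\<bar> + K" if "t \<in> {0..1}" for t
  proof -
    have "\<bar>f t - f 0\<bar> \<le> K * 1"
      using fl[of t 0] that mult_left_mono[OF _ K, of t 1] by auto
    then show ?thesis by linarith
  qed
  have gb: "\<bar>g t\<bar> \<le> \<bar>g 0\<bar> + M" if "t \<in> {0..1}" for t
  proof -
    have "\<bar>g t - g 0\<bar> \<le> M * 1"
      using gl[of t 0] that mult_left_mono[OF _ M, of t 1] by auto
    then show ?thesis by linarith
  qed
  have "((\<bar>f 0\<bar> + K) * M + (\<bar>g 0\<bar> + M) * K)-lipschitz_on {0..1} (\<lambda>t. f t * g t)"
  proof (rule lipschitz_onI)
    fix s t :: real assume st: "s \<in> {0..1}" "t \<in> {0..1}"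
    have "\<bar>f s * g s - f t * g t\<bar> = \<bar>f s * (g s - g t) + g t * (f s - f t)\<bar>"
      by (simp add: algebra_simps)
    also have "\<dots> \<le> \<bar>f s\<bar> * \<bar>g s - g t\<bar> + \<bar>g t\<bar> * \<bar>f s - f t\<bar>"
      by (metis abs_mult abs_triangle_ineq)
    also have "\<dots> \<le> (\<bar>f 0\<bar> + K) * (M * \<bar>s - t\<bar>) + (\<bar>g 0\<bar> + M) * (K * \<bar>s - t\<bar>)"
      using st K M by (intro add_mono mult_mono fb gb fl gl) auto
    finally show "dist (f s * g s) (f t * g t) \<le> ((\<bar>f 0\<bar> + K) * M + (\<bar>g 0\<bar> + M) * K) * dist s t"
      by (simp add: dist_real_def algebra_simps)
  qed (use K M in simp)
  then show ?thesis ..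
qed

lemma lipschitz_on_unit_interval_if_C1:
  fixes f f' :: "real \<Rightarrow> real"
  assumes der: "\<And>t. t \<in> {0..1} \<Longrightarrow> (f has_real_derivative f' t) (at t within {0..1})"
    and cont: "continuous_on {0..1} f'"
  shows "\<exists>L. L-lipschitz_on {0..1} f"
proof -
  have "bounded (f' ` {0..1})"
    using cont by (intro compact_imp_bounded compact_continuous_image) auto
  then obtain B where B: "B > 0" "\<And>t. t \<in> {0..1} \<Longrightarrow> \<bar>f' t\<bar> \<le> B"
    unfolding bounded_pos by auto
  have "B-lipschitz_on {0..1} f"
  proof (rule lipschitz_onI)
    fix s t :: real assume st: "s \<in> {0..1}" "t \<in> {0..1}"
    have "norm (f s - f t) \<le> B * norm (s - t)"
      by (rule field_differentiable_bound[OF _ der]) (use B st in auto)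
    then show "dist (f s) (f t) \<le> B * dist s t"
      by (simp add: dist_norm)
  qed (use B in simp)
  then show ?thesis ..
qed

text \<open>The function \<open>W\<close> of the overview is followed along the curve with its time
  variable replaced by the normalised primitive of \<open>v\<close>. The right-hand side is the
  energy bound for that clock; by Cauchy--Schwarz it is smallest when \<open>v\<close> is
  proportional to the speed.\<close>

lemma adm_curve_hamilton_jacobi:
  assumes c: "adm_curve \<gamma> u l" and e: "\<gamma> 0 = (x0, y0)" "\<gamma> 1 = (x1, y1)"
    and w: "0 < w" "0 < b" "w + b < pi"
    and v: "continuous_on UNIV v" "\<And>t. 0 < v t"
  shows "w * (y1 - y0) + w / 2 * cot (w + b) * x1\<^sup>2 - w / 2 * cot b * x0\<^sup>2
    \<le> integral {0..1} v / 2 * integral {0..1} (\<lambda>t. (norm (u t))\<^sup>2 / v t)"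
proof -
  from c obtain L C N where h: "L-lipschitz_on {0..1} \<gamma>" "u \<in> borel_measurable borel"
    "\<And>t. norm (u t) \<le> C" "negligible N"
    "\<And>t. t \<in> {0<..<1} - N \<Longrightarrow>
      (\<gamma> has_vector_derivative (fst (u t), fst (\<gamma> t) * snd (u t))) (at t)"
    "((\<lambda>t. norm (u t)) has_integral l) {0..1}"
    by (rule adm_curveE) (rule that)
  define x y where "x t = fst (\<gamma> t)" and "y t = snd (\<gamma> t)" for t
  have x_lip: "L-lipschitz_on {0..1} x" and y_lip: "L-lipschitz_on {0..1} y"
    using h(1) unfolding x_def y_def lipschitz_on_def
    by (meson dist_fst_le dist_snd_le order_trans)+
  have x_der: "(x has_real_derivative fst (u t)) (at t)"
    and y_der: "(y has_real_derivative x t * snd (u t)) (at t)" if "t \<in> {0<..<1} - N" for t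
    using bounded_linear.has_vector_derivative[OF bounded_linear_fst h(5)[OF that]]
      bounded_linear.has_vector_derivative[OF bounded_linear_snd h(5)[OF that]]
    by (simp_all add: x_def[abs_def] y_def[abs_def] has_real_derivative_iff_has_vector_derivative)
  have v_on: "continuous_on S v" for S
    using v(1) continuous_on_subset by blast
  define k where "k = integral {0..1} v"
  have k: "k > 0"
  proof -
    obtain t0 where t0: "t0 \<in> {0..1::real}" "\<forall>t\<in>{0..1}. v t0 \<le> v t"
      using continuous_attains_inf[of "{0..1::real}" v] v_on by auto
    have "integral {0..1} (\<lambda>_::real. v t0) \<le> k"
      unfolding k_def using t0 by (intro integral_le integrable_const_ivl integrable_continuous_real v_on) auto
    then show ?thesis using v(2)[of t0] by simp
  qed
  \<comment> \<open>The new clock: it increases from 0 to 1 with rate \<open>v / k\<close>, so the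
    angle \<open>w * s t + b\<close> runs from \<open>b\<close> to \<open>w + b\<close> inside
    \<open>(0, pi)\<close> and \<open>cot\<close> stays smooth along it.\<close>
  define s where "s t = integral {0..t} v / k" for t
  have s_der: "(s has_real_derivative v t / k) (at t within {0..1})" if "t \<in> {0..1}" for t
    using integral_has_real_derivative[OF v_on that] unfolding s_def
    by (intro DERIV_cdivide) auto
  have s0: "s 0 = 0" and s1: "s 1 = 1"
    using k by (simp_all add: s_def k_def)
  have s_range: "0 \<le> s t \<and> s t \<le> 1" if t: "t \<in> {0..1}" for t
  proof -
    have "integral {0..t} v \<le> k"
      unfolding k_def using t v(2)
      by (intro integral_subset_le integrable_continuous_real v_on) (auto simp: less_imp_le)
    moreover have "0 \<le> integral {0..t} v"
      using v(2) by (intro Henstock_Kurzweil_Integration.integral_nonneg integrable_continuous_real v_on) (auto simp: less_imp_le)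
    ultimately show ?thesis
      using k by (simp add: s_def)
  qed
  have sin_pos: "0 < sin (w * s t + b)" if "t \<in> {0..1}" for t
  proof (rule sin_gt_zero)
    show "0 < w * s t + b"
      using s_range[OF that] w by (intro add_nonneg_pos) auto
    have "w * s t \<le> w"
      using s_range[OF that] w by (intro mult_left_le) auto
    then show "w * s t + b < pi"
      using w by linarith
  qed
  have s_cont: "continuous_on {0..1} s"
    using s_der by (intro DERIV_continuous_on)
  define f f' where "f t = cot (w * s t + b)"
    and "f' t = - (w * (v t / k) / (sin (w * s t + b))\<^sup>2)" for t
  have f_der: "(f has_real_derivative f' t) (at t within {0..1})" if t: "t \<in> {0..1}" for t
  proof -
    have "((\<lambda>t. w * s t + b) has_real_derivative w * (v t / k)) (at t within {0..1})"
      by (auto intro!: derivative_eq_intros s_der t)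
    from DERIV_chain2[OF DERIV_cot this] show ?thesis
      using sin_pos[OF t] unfolding f_def f'_def by (simp add: divide_inverse mult.commute)
  qed
  have f'_cont: "continuous_on {0..1} f'"
    unfolding f'_def using k sin_pos by (intro continuous_intros s_cont v_on) force+
  obtain L1 where L1: "L1-lipschitz_on {0..1} f"
    using lipschitz_on_unit_interval_if_C1[OF f_der f'_cont] by blast
  obtain L2 where L2: "L2-lipschitz_on {0..1} (\<lambda>t. x t * x t)"
    using lipschitz_on_mult_unit_interval[OF x_lip x_lip] by blast
  obtain L3 where L3: "L3-lipschitz_on {0..1} (\<lambda>t. f t * (x t * x t))"
    using lipschitz_on_mult_unit_interval[OF L1 L2] by blast
  define g where "g t = w * y t + w / 2 * (f t * (x t * x t))" for t
  have "(\<bar>w\<bar> * L + \<bar>w / 2\<bar> * L3)-lipschitz_on {0..1} g"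
    unfolding g_def by (intro lipschitz_intros y_lip L3)
  then have "g 1 - g 0 \<le> integral {0..1} (\<lambda>t. k / 2 * ((norm (u t))\<^sup>2 / v t))"
    using h(4)
  proof (rule lipschitz_derivative_bound_integral)
    fix t :: real assume t: "t \<in> {0<..<1} - N"
    have fd: "(f has_real_derivative f' t) (at t)"
      using f_der[of t] t by (simp add: at_within_Icc_at)
    have "(g has_real_derivative w * (x t * snd (u t)) + w / 2 * (f' t * (x t * x t) + f t * (2 * x t * fst (u t)))) (at t)"
      unfolding g_def
      by (auto intro!: derivative_eq_intros fd x_der[OF t] y_der[OF t] simp: algebra_simps)
    moreover have "w * (x t * snd (u t)) + w / 2 * (f' t * (x t * x t) + f t * (2 * x t * fst (u t)))
        \<le> k / 2 * ((norm (u t))\<^sup>2 / v t)"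
    proof -
      define r where "r = v t / k"
      have r: "r > 0"
        using k v(2)[of t] by (simp add: r_def)
      have "f' t = - (w * r * (1 + (f t)\<^sup>2))"
      proof -
        have "1 + (f t)\<^sup>2 = 1 / (sin (w * s t + b))\<^sup>2"
          using sin_pos[of t] t sin_cos_squared_add[of "w * s t + b"]
          by (simp add: f_def cot_def field_simps)
        then show ?thesis by (simp add: f'_def r_def)
      qed
      then have "w * (x t * snd (u t)) + w / 2 * (f' t * (x t * x t) + f t * (2 * x t * fst (u t))) =
          w * f t * x t * fst (u t) + w * x t * snd (u t) - w\<^sup>2 * r * (x t)\<^sup>2 * (1 + (f t)\<^sup>2) / 2"
        by (simp only:) (simp add: field_simps power2_eq_square)
      \<comment> \<open>The Hamilton--Jacobi inequality by completing squares. The defect vanishes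
        exactly when the control is \<open>r\<close> times the horizontal gradient of
        \<open>W\<close>, with components \<open>w * f t * x t\<close> and
        \<open>w * x t\<close>.\<close>
      moreover have "0 \<le> ((fst (u t) - r * w * f t * x t)\<^sup>2 + (snd (u t) - r * w * x t)\<^sup>2) / (2 * r)"
        using r by simp
      moreover have "((fst (u t) - r * w * f t * x t)\<^sup>2 + (snd (u t) - r * w * x t)\<^sup>2) / (2 * r) =
          ((fst (u t))\<^sup>2 + (snd (u t))\<^sup>2) / (2 * r) - w * f t * x t * fst (u t) - w * x t * snd (u t)
          + w\<^sup>2 * r * (x t)\<^sup>2 * (1 + (f t)\<^sup>2) / 2"
        using r by (simp add: field_simps power2_eq_square)
      moreover have "k / 2 * ((norm (u t))\<^sup>2 / v t) = ((fst (u t))\<^sup>2 + (snd (u t))\<^sup>2) / (2 * r)"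
        using k by (simp add: r_def norm_prod_def field_simps)
      ultimately show ?thesis
        by linarith
    qed
    ultimately show "\<exists>d. (g has_real_derivative d) (at t) \<and> d \<le> k / 2 * ((norm (u t))\<^sup>2 / v t)"
      by blast
  next
    obtain t0 where t0: "t0 \<in> {0..1::real}" "\<forall>t\<in>{0..1}. v t0 \<le> v t"
      using continuous_attains_inf[of "{0..1::real}" v] v_on by auto
    \<comment> \<open>On \<open>[0,1]\<close> the maximum is \<open>v t\<close> itself. Off that
      interval it keeps the denominator away from 0, which gives the global bound required for
      integrability.\<close>
    define q where "q t = k / 2 * ((norm (u t))\<^sup>2 / max (v t0) (v t))" for t
    have "q integrable_on {0..1}"
    proof (rule borel_bounded_integrable)
      show "q \<in> borel_measurable borel"
        unfolding q_def using h(2) borel_measurable_continuous_onI[OF v(1)] by measurable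
      show "\<bar>q t\<bar> \<le> k / 2 * (C\<^sup>2 / v t0)" for t
      proof -
        have "(norm (u t))\<^sup>2 / max (v t0) (v t) \<le> C\<^sup>2 / v t0"
          using h(3)[of t] v(2)[of t0] by (intro frac_le power_mono) auto
        then have "k / 2 * ((norm (u t))\<^sup>2 / max (v t0) (v t)) \<le> k / 2 * (C\<^sup>2 / v t0)"
          using k by (intro mult_left_mono) auto
        moreover have "0 \<le> q t"
          using k v(2)[of t] unfolding q_def
          by (intro mult_nonneg_nonneg divide_nonneg_nonneg) (auto simp: le_max_iff_disj)
        ultimately show ?thesis
          by (simp only: q_def abs_of_nonneg)
      qed
    qed
    then show "(\<lambda>t. k / 2 * ((norm (u t))\<^sup>2 / v t)) integrable_on {0..1}"
      by (rule integrable_eq) (use t0 in \<open>auto simp: q_def max_def\<close>)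
  qed
  moreover have "g 1 - g 0 = w * (y1 - y0) + w / 2 * cot (w + b) * x1\<^sup>2 - w / 2 * cot b * x0\<^sup>2"
    by (simp add: g_def f_def s0 s1 x_def y_def e algebra_simps power2_eq_square)
  moreover have "integral {0..1} (\<lambda>t. k / 2 * ((norm (u t))\<^sup>2 / v t)) =
      k / 2 * integral {0..1} (\<lambda>t. (norm (u t))\<^sup>2 / v t)"
    by (rule integral_mult_right)
  ultimately show ?thesis
    unfolding k_def by simp
qed

text \<open>The ideal weight is the speed, for which both integrals equal \<open>l\<close>. The
  speed may vanish and be discontinuous, so \<open>v\<close> is a continuous approximation plus
  \<epsilon>: the approximation index goes to infinity under dominated convergence, and then
  \<epsilon> goes to 0.\<close>

lemma joins_hamilton_jacobi:
  assumes "joins (x0, y0) (x1, y1) l" and w: "0 < w" "0 < b" "w + b < pi"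
  shows "w * (y1 - y0) + w / 2 * cot (w + b) * x1\<^sup>2 - w / 2 * cot b * x0\<^sup>2 \<le> l\<^sup>2 / 2"
    (is "?W \<le> _")
proof -
  obtain \<gamma> u where c: "adm_curve \<gamma> u l" and e: "\<gamma> 0 = (x0, y0)" "\<gamma> 1 = (x1, y1)"
    using assms unfolding joins_def by blast
  from c obtain L C N where h: "L-lipschitz_on {0..1} \<gamma>" "u \<in> borel_measurable borel"
    "\<And>t. norm (u t) \<le> C" "negligible N"
    "\<And>t. t \<in> {0<..<1} - N \<Longrightarrow>
      (\<gamma> has_vector_derivative (fst (u t), fst (\<gamma> t) * snd (u t))) (at t)"
    "((\<lambda>t. norm (u t)) has_integral l) {0..1}"
    by (rule adm_curveE) (rule that)
  have C: "0 \<le> C"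
    using h(3)[of 0] norm_ge_zero order_trans by blast
  have l: "0 \<le> l" "integral {0..1} (\<lambda>t. norm (u t)) = l" "(\<lambda>t. norm (u t)) integrable_on {0..1}"
    using h(6) joins_nonneg[OF assms(1)] by (auto simp: integral_unique)
  have "(\<lambda>t. norm (u t)) \<in> borel_measurable (lebesgue_on UNIV)"
    using h(2) by (simp add: lebesgue_on_UNIV_eq measurable_completion)
  then have "(\<lambda>t. norm (u t)) measurable_on UNIV"
    by (subst measurable_on_iff_borel_measurable) auto
  then obtain M a where a: "negligible M" "\<And>n. continuous_on UNIV (a n)"
      "\<And>t. t \<notin> M \<Longrightarrow> (\<lambda>n. a n t) \<longlonglongrightarrow> norm (u t)"
    unfolding measurable_on_def by auto
  \<comment> \<open>Clipping to \<open>[0, C]\<close> provides the dominating constant and does not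
    disturb the limit, since the speed itself lies in that range.\<close>
  define v where "v n t = max 0 (min C (a n t))" for n :: nat and t
  have v_cont: "continuous_on UNIV (v n)" for n
    unfolding v_def by (intro continuous_intros a(2))
  have v_bd: "0 \<le> v n t" "v n t \<le> C" for n t
    using C by (auto simp: v_def)
  have v_lim: "(\<lambda>n. v n t) \<longlonglongrightarrow> norm (u t)" if "t \<notin> M" for t
  proof -
    have "(\<lambda>n. v n t) \<longlonglongrightarrow> max 0 (min C (norm (u t)))"
      unfolding v_def by (intro tendsto_intros a(3) that)
    then show ?thesis
      using h(3)[of t] by simp
  qed
  have main: "?W \<le> (l + \<epsilon>) / 2 * l" if \<epsilon>: "0 < \<epsilon>" for \<epsilon>
  proof -
    have 1: "(\<lambda>n. integral {0..1} (\<lambda>t. v n t + \<epsilon>)) \<longlonglongrightarrow> l + \<epsilon>"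
    proof -
      define V where "V n t = (if t \<in> M then 0 else v n t + \<epsilon>)" for n t
      define V' where "V' t = (if t \<in> M then 0 else norm (u t) + \<epsilon>)" for t
      have vi: "(\<lambda>t. v n t + \<epsilon>) integrable_on {0..1}" for n
        by (intro integrable_continuous_real continuous_intros continuous_on_subset[OF v_cont]) auto
      have eq: "integral {0..1} (V n) = integral {0..1} (\<lambda>t. v n t + \<epsilon>)" for n
        by (rule integral_spike[OF a(1)]) (simp add: V_def)
      have "(V n) integrable_on {0..1}" for n
        by (rule integrable_spike[OF vi[of n] a(1)]) (simp add: V_def)
      moreover have "norm (V n t) \<le> C + \<epsilon>" for n t
        using v_bd[of n t] \<epsilon> C by (auto simp: V_def)
      moreover have "(\<lambda>n. V n t) \<longlonglongrightarrow> V' t" for t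
        by (auto simp: V_def V'_def intro!: tendsto_intros v_lim)
      ultimately have "(\<lambda>n. integral {0..1} (V n)) \<longlonglongrightarrow> integral {0..1} V'"
        by (intro dominated_convergence(2)[OF _ integrable_const_ivl[where c = "C + \<epsilon>"]])
      moreover have "integral {0..1} V' = integral {0..1} (\<lambda>t. norm (u t) + \<epsilon>)"
        by (rule integral_spike[OF a(1)]) (simp add: V'_def)
      moreover have "\<dots> = l + \<epsilon>"
        using l(2) Henstock_Kurzweil_Integration.integral_add[OF l(3) integrable_const_ivl[of \<epsilon>]] by simp
      ultimately show ?thesis
        by (simp add: eq)
    qed
    have bd: "\<bar>r\<^sup>2 / (z + \<epsilon>)\<bar> \<le> C\<^sup>2 / \<epsilon>" if "0 \<le> r" "r \<le> C" "0 \<le> z" for r z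
      using that \<epsilon> by (auto intro!: frac_le power_mono)
    have i2: "(\<lambda>t. (norm (u t))\<^sup>2 / (norm (u t) + \<epsilon>)) integrable_on {0..1}"
      by (rule borel_bounded_integrable[where C = "C\<^sup>2 / \<epsilon>"]) (use h(2,3) bd in \<open>auto\<close>)
    have 2: "(\<lambda>n. integral {0..1} (\<lambda>t. (norm (u t))\<^sup>2 / (v n t + \<epsilon>))) \<longlonglongrightarrow>
        integral {0..1} (\<lambda>t. (norm (u t))\<^sup>2 / (norm (u t) + \<epsilon>))"
    proof -
      define V where "V n t = (if t \<in> M then 0 else (norm (u t))\<^sup>2 / (v n t + \<epsilon>))" for n t
      define V' where "V' t = (if t \<in> M then 0 else (norm (u t))\<^sup>2 / (norm (u t) + \<epsilon>))" for t
      have vi: "(\<lambda>t. (norm (u t))\<^sup>2 / (v n t + \<epsilon>)) integrable_on {0..1}" for n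
      proof (rule borel_bounded_integrable[where C = "C\<^sup>2 / \<epsilon>"])
        show "(\<lambda>t. (norm (u t))\<^sup>2 / (v n t + \<epsilon>)) \<in> borel_measurable borel"
          using h(2) borel_measurable_continuous_onI[OF v_cont[of n]] by measurable
      qed (use bd h(3) v_bd in auto)
      have eq: "integral {0..1} (V n) = integral {0..1} (\<lambda>t. (norm (u t))\<^sup>2 / (v n t + \<epsilon>))" for n
        by (rule integral_spike[OF a(1)]) (simp add: V_def)
      have "(V n) integrable_on {0..1}" for n
        by (rule integrable_spike[OF vi[of n] a(1)]) (simp add: V_def)
      moreover have "norm (V n t) \<le> C\<^sup>2 / \<epsilon>" for n t
        using bd[of "norm (u t)" "v n t"] h(3)[of t] v_bd[of n t] \<epsilon> by (auto simp: V_def)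
      moreover have "(\<lambda>n. V n t) \<longlonglongrightarrow> V' t" for t
      proof (cases "t \<in> M")
        case False
        have "norm (u t) + \<epsilon> \<noteq> 0"
          using \<epsilon> norm_ge_zero[of "u t"] by linarith
        with False show ?thesis
          by (auto simp: V_def V'_def intro!: tendsto_intros v_lim)
      qed (simp add: V_def V'_def)
      ultimately have "(\<lambda>n. integral {0..1} (V n)) \<longlonglongrightarrow> integral {0..1} V'"
        by (intro dominated_convergence(2)[OF _ integrable_const_ivl[where c = "C\<^sup>2 / \<epsilon>"]])
      moreover have "integral {0..1} V' = integral {0..1} (\<lambda>t. (norm (u t))\<^sup>2 / (norm (u t) + \<epsilon>))"
        by (rule integral_spike[OF a(1)]) (simp add: V'_def)
      ultimately show ?thesis
        by (simp add: eq)
    qed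
    have "?W \<le> integral {0..1} (\<lambda>t. v n t + \<epsilon>) / 2 * integral {0..1} (\<lambda>t. (norm (u t))\<^sup>2 / (v n t + \<epsilon>))" for n
      using \<epsilon> v_bd(1) by (intro adm_curve_hamilton_jacobi[OF c e w] continuous_intros v_cont)
        (simp add: add_nonneg_pos)
    moreover have "(\<lambda>n. integral {0..1} (\<lambda>t. v n t + \<epsilon>) / 2 * integral {0..1} (\<lambda>t. (norm (u t))\<^sup>2 / (v n t + \<epsilon>)))
        \<longlonglongrightarrow> (l + \<epsilon>) / 2 * integral {0..1} (\<lambda>t. (norm (u t))\<^sup>2 / (norm (u t) + \<epsilon>))"
      by (intro tendsto_intros 1 2) simp
    ultimately have "?W \<le> (l + \<epsilon>) / 2 * integral {0..1} (\<lambda>t. (norm (u t))\<^sup>2 / (norm (u t) + \<epsilon>))"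
      by (intro LIMSEQ_le_const) auto
    also have "\<dots> \<le> (l + \<epsilon>) / 2 * l"
    proof (rule mult_left_mono)
      have "(norm (u t))\<^sup>2 / (norm (u t) + \<epsilon>) \<le> norm (u t)" for t
      proof -
        have "0 < norm (u t) + \<epsilon>"
          using \<epsilon> norm_ge_zero[of "u t"] by linarith
        then show ?thesis
          using \<epsilon> by (simp add: pos_divide_le_eq power2_eq_square algebra_simps)
      qed
      then show "integral {0..1} (\<lambda>t. (norm (u t))\<^sup>2 / (norm (u t) + \<epsilon>)) \<le> l"
        unfolding l(2)[symmetric] by (intro integral_le i2 l(3)) auto
    qed (use l \<epsilon> in simp)
    finally show ?thesis .
  qed
  have "?W \<le> (l + 0) / 2 * l"
  proof (rule tendsto_lowerbound)
    show "((\<lambda>\<epsilon>. (l + \<epsilon>) / 2 * l) \<longlongrightarrow> (l + 0) / 2 * l) (at_right 0)"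
      by (intro tendsto_intros) simp
    show "\<forall>\<^sub>F \<epsilon> in at_right 0. ?W \<le> (l + \<epsilon>) / 2 * l"
      using main by (auto simp: eventually_at_right_less intro: eventually_mono[OF eventually_at_right_less])
  qed simp
  then show ?thesis
    by (simp add: power2_eq_square)
qed

section \<open>The Grushin metric and its extremals\<close>

lemma joins_horizontal: "joins (x, y) (x', y) \<bar>x' - x\<bar>"
  by (rule joins_smooth[where \<gamma> = "\<lambda>t. (x + t * (x' - x), y)" and f = "\<lambda>_. x' - x" and g = "\<lambda>_. 0"])
    (auto intro!: derivative_eq_intros has_vector_derivative_Pair
      simp flip: has_real_derivative_iff_has_vector_derivative simp: zero_prod_def norm_prod_def)

lemma joins_vertical:
  assumes "x \<noteq> 0"
  shows "joins (x, y) (x, y') (\<bar>y' - y\<bar> / \<bar>x\<bar>)"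
  by (rule joins_smooth[where \<gamma> = "\<lambda>t. (x, y + t * (y' - y))" and f = "\<lambda>_. 0" and g = "\<lambda>_. (y' - y) / x"])
    (use assms in \<open>auto intro!: derivative_eq_intros has_vector_derivative_Pair
      simp flip: has_real_derivative_iff_has_vector_derivative simp: zero_prod_def norm_prod_def abs_divide\<close>)

text \<open>Vertical motion at abscissa \<open>x\<close> costs the height divided by the modulus of
  \<open>x\<close>. The path therefore moves away from the axis \<open>x = 0\<close> by the square
  root of the height, climbs at a cost of at most that much, and returns: three times the square
  root, plus the horizontal distance.\<close>

lemma joins_ex: "\<exists>l. joins p q l \<and> l \<le> \<bar>fst q - fst p\<bar> + 3 * sqrt \<bar>snd q - snd p\<bar>"
proof -
  obtain x y x' y' where pq: "p = (x, y)" "q = (x', y')"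
    by fastforce
  define h where "h = sqrt \<bar>y' - y\<bar>"
  \<comment> \<open>The sign moves the point away from the singular line, so the abscissa has
    modulus at least \<open>h\<close>.\<close>
  define k where "k = (if 0 \<le> x then h else - h)"
  show ?thesis
  proof (cases "y' = y")
    case True
    then show ?thesis
      using joins_horizontal[of x y x'] pq by auto
  next
    case False
    then have h: "0 < h" "h * h = \<bar>y' - y\<bar>"
      by (simp_all add: h_def)
    have xk: "x + k \<noteq> 0" "h \<le> \<bar>x + k\<bar>" "\<bar>k\<bar> = h"
      using h(1) by (auto simp: k_def)
    have "joins (x, y) (x + k, y) h"
      using joins_horizontal[of x y "x + k"] xk by simp
    from joins_trans[OF joins_trans[OF this joins_vertical[OF xk(1)]] joins_horizontal]
    have "joins (x, y) (x', y') (h + \<bar>y' - y\<bar> / \<bar>x + k\<bar> + \<bar>x' - (x + k)\<bar>)" .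
    moreover have "\<bar>y' - y\<bar> / \<bar>x + k\<bar> \<le> h"
      using h xk by (subst pos_divide_le_eq) (auto intro!: mult_left_mono simp flip: h(2))
    moreover have "\<bar>x' - (x + k)\<bar> \<le> \<bar>x' - x\<bar> + h"
      using xk(3) by linarith
    ultimately show ?thesis
      unfolding pq by (intro exI[of _ "h + \<bar>y' - y\<bar> / \<bar>x + k\<bar> + \<bar>x' - (x + k)\<bar>"]) (simp add: h_def)
  qed
qed

lemma bdd_below_joins: "bdd_below {l. joins p q l}"
  by (rule bdd_belowI[of _ 0]) (simp add: joins_nonneg)

lemma grushin_dist_le_if_joins: "joins p q l \<Longrightarrow> grushin_dist p q \<le> l"
  unfolding grushin_dist_eq by (intro cInf_lower bdd_below_joins) simp

lemma grushin_dist_ge: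
  assumes "\<And>l. joins p q l \<Longrightarrow> c \<le> l"
  shows "c \<le> grushin_dist p q"
  unfolding grushin_dist_eq using joins_ex[of p q] assms by (intro cInf_greatest) auto

lemma joins_near_grushin_dist:
  assumes "0 < \<epsilon>"
  shows "\<exists>l. joins p q l \<and> l < grushin_dist p q + \<epsilon>"
  using cInf_lessD[of "{l. joins p q l}" "grushin_dist p q + \<epsilon>"] joins_ex[of p q] assms
  unfolding grushin_dist_eq by auto

lemma grushin_dist_nonneg: "0 \<le> grushin_dist p q"
  using joins_nonneg by (rule grushin_dist_ge)

lemma grushin_dist_refl: "grushin_dist p p = 0"
  using grushin_dist_le_if_joins[OF joins_refl[of p]] grushin_dist_nonneg[of p p] by linarith

lemma grushin_dist_sym: "grushin_dist p q = grushin_dist q p"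
  unfolding grushin_dist_eq using joins_sym[of p q] joins_sym[of q p]
  by (intro arg_cong[where f = Inf]) auto

lemma grushin_dist_triangle: "grushin_dist p r \<le> grushin_dist p q + grushin_dist q r"
proof (rule field_le_epsilon)
  fix \<epsilon> :: real assume "0 < \<epsilon>"
  then obtain l m where "joins p q l" "l < grushin_dist p q + \<epsilon> / 2"
      "joins q r m" "m < grushin_dist q r + \<epsilon> / 2"
    using joins_near_grushin_dist[of "\<epsilon> / 2"] by (meson half_gt_zero)
  with grushin_dist_le_if_joins[OF joins_trans[of p q l r m]]
  show "grushin_dist p r \<le> grushin_dist p q + grushin_dist q r + \<epsilon>"
    by simp
qed

lemma grushin_dist_le: "grushin_dist p q \<le> \<bar>fst q - fst p\<bar> + 3 * sqrt \<bar>snd q - snd p\<bar>"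
  using joins_ex[of p q] grushin_dist_le_if_joins order_trans by blast

lemma grushin_dist_reflect_y: "grushin_dist (x0, - y0) (x1, - y1) = grushin_dist (x0, y0) (x1, y1)"
  unfolding grushin_dist_eq using joins_reflect_y[of x0 y0 x1 y1] joins_reflect_y[of x0 "- y0" x1 "- y1"]
  by (intro arg_cong[where f = Inf]) auto

lemma grushin_dist_reflect_x: "grushin_dist (- x0, y0) (- x1, y1) = grushin_dist (x0, y0) (x1, y1)"
  unfolding grushin_dist_eq using joins_reflect_x[of x0 y0 x1 y1] joins_reflect_x[of "- x0" y0 "- x1" y1]
  by (intro arg_cong[where f = Inf]) auto

lemma grushin_dist_hamilton_jacobi:
  assumes w: "0 < w" "0 < b" "w + b < pi"
  shows "w * \<bar>y1 - y0\<bar> + w / 2 * cot (w + b) * x1\<^sup>2 - w / 2 * cot b * x0\<^sup>2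
    \<le> (grushin_dist (x0, y0) (x1, y1))\<^sup>2 / 2"
proof -
  have *: "w * (y1 - y0) + w / 2 * cot (w + b) * x1\<^sup>2 - w / 2 * cot b * x0\<^sup>2
    \<le> (grushin_dist (x0, y0) (x1, y1))\<^sup>2 / 2" (is "?W \<le> _") for y0 y1
  proof -
    \<comment> \<open>The infimum ranges over lengths and not over their squares, so the bound is
      solved for \<open>l\<close>; the maximum covers negative \<open>?W\<close>.\<close>
    have "sqrt (2 * max 0 ?W) \<le> grushin_dist (x0, y0) (x1, y1)"
    proof (rule grushin_dist_ge)
      fix l assume l: "joins (x0, y0) (x1, y1) l"
      then have "?W \<le> l\<^sup>2 / 2" by (rule joins_hamilton_jacobi[OF _ w])
      then show "sqrt (2 * max 0 ?W) \<le> l"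
        using joins_nonneg[OF l] by (intro real_le_lsqrt) (auto simp: max_def)
    qed
    then have "(sqrt (2 * max 0 ?W))\<^sup>2 \<le> (grushin_dist (x0, y0) (x1, y1))\<^sup>2"
      by (intro power_mono) auto
    then have "2 * max 0 ?W \<le> (grushin_dist (x0, y0) (x1, y1))\<^sup>2"
      by (subst (asm) real_sqrt_pow2) auto
    moreover have "?W \<le> max 0 ?W"
      by (rule max.cobounded2)
    ultimately have "2 * ?W \<le> (grushin_dist (x0, y0) (x1, y1))\<^sup>2"
      by (meson mult_left_mono order_trans zero_le_numeral)
    then show ?thesis
      by simp
  qed
  show ?thesis
    \<comment> \<open>Ascending and descending pairs are exchanged by the reflection of
      \<open>y\<close>, which produces the absolute value.\<close>
    using *[of y1 y0] *[of "- y1" "- y0"] grushin_dist_reflect_y[of x0 y0 x1 y1]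
    by (auto simp: abs_if)
qed

lemma joins_ge_fst:
  assumes "joins (x0, y0) (x1, y1) l"
  shows "x1 - x0 \<le> l"
proof -
  obtain \<gamma> u where c: "adm_curve \<gamma> u l" and e: "\<gamma> 0 = (x0, y0)" "\<gamma> 1 = (x1, y1)"
    using assms unfolding joins_def by blast
  from c obtain L C N where h: "L-lipschitz_on {0..1} \<gamma>" "u \<in> borel_measurable borel"
    "\<And>t. norm (u t) \<le> C" "negligible N"
    "\<And>t. t \<in> {0<..<1} - N \<Longrightarrow>
      (\<gamma> has_vector_derivative (fst (u t), fst (\<gamma> t) * snd (u t))) (at t)"
    "((\<lambda>t. norm (u t)) has_integral l) {0..1}"
    by (rule adm_curveE) (rule that)
  have "fst (\<gamma> 1) - fst (\<gamma> 0) \<le> integral {0..1} (\<lambda>t. norm (u t))"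
  proof (rule lipschitz_derivative_bound_integral[OF _ h(4)])
    show "L-lipschitz_on {0..1} (\<lambda>t. fst (\<gamma> t))"
      using h(1) unfolding lipschitz_on_def by (meson dist_fst_le order_trans)
    show "(\<lambda>t. norm (u t)) integrable_on {0..1}"
      using h(6) by blast
    fix t assume t: "t \<in> {0<..<1} - N"
    have "((\<lambda>t. fst (\<gamma> t)) has_real_derivative fst (u t)) (at t)"
      using bounded_linear.has_vector_derivative[OF bounded_linear_fst h(5)[OF t]]
      by (simp add: has_real_derivative_iff_has_vector_derivative)
    moreover have "fst (u t) \<le> norm (u t)"
      using norm_fst_le[of "fst (u t)" "snd (u t)"] by simp
    ultimately show "\<exists>d. ((\<lambda>t. fst (\<gamma> t)) has_real_derivative d) (at t) \<and> d \<le> norm (u t)"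
      by blast
  qed
  then show ?thesis
    using e h(6) by (simp add: integral_unique)
qed

lemma grushin_dist_ge_fst: "\<bar>x1 - x0\<bar> \<le> grushin_dist (x0, y0) (x1, y1)"
  using joins_ge_fst joins_reflect_x by (intro grushin_dist_ge) (fastforce simp: abs_le_iff)

lemma grushin_dist_horizontal: "grushin_dist (x0, y) (x1, y) = \<bar>x1 - x0\<bar>"
  using grushin_dist_le_if_joins[OF joins_horizontal] grushin_dist_ge_fst[of x1 x0 y y]
  by (metis order_antisym)

text \<open>With phase \<open>b = pi / 2 - w\<close> the term \<open>cot (w + b)\<close> vanishes,
  so the unknown abscissa \<open>x1\<close> drops out of the bound.\<close>

lemma grushin_dist_bound_snd:
  assumes "0 < w" "w < pi / 2"
  shows "w * \<bar>y1 - y0\<bar> \<le> (grushin_dist (x0, y0) (x1, y1))\<^sup>2 / 2 + w / 2 * tan w * x0\<^sup>2"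
proof -
  have "cot (pi / 2 - w) = tan w" "cot (w + (pi / 2 - w)) = 0"
    by (simp_all add: cot_def tan_def sin_diff cos_diff)
  with grushin_dist_hamilton_jacobi[of w "pi / 2 - w" y1 y0 x1 x0] show ?thesis
    using assms by simp
qed

text \<open>After division by \<open>w\<close>, the error term of
  \<open>grushin_dist_bound_snd\<close> is \<open>tan w * x0\<^sup>2 / 2\<close>. Hence
  \<open>w\<close> is fixed first, to make this term small, and \<delta> is chosen in terms of that
  \<open>w\<close>. The horizontal coordinate is controlled directly.\<close>

lemma dist_less_if_grushin_dist_less:
  assumes "0 < \<epsilon>"
  shows "\<exists>\<delta>>0. \<forall>q. grushin_dist p q < \<delta> \<longrightarrow> dist p q < \<epsilon>"
proof -
  obtain x0 y0 where p: "p = (x0, y0)" by fastforce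
  have "((\<lambda>w. tan w * x0\<^sup>2 / 2) \<longlongrightarrow> tan 0 * x0\<^sup>2 / 2) (at_right 0)"
    by (intro tendsto_intros) auto
  then have "\<forall>\<^sub>F w in at_right 0. tan w * x0\<^sup>2 / 2 < \<epsilon> / 4"
    by (rule order_tendstoD(2)) (use assms in simp)
  moreover have "\<forall>\<^sub>F w in at_right 0. (w::real) \<in> {0<..<pi / 2}"
    by (rule eventually_at_right_real) simp
  ultimately have "\<forall>\<^sub>F w in at_right 0. tan w * x0\<^sup>2 / 2 < \<epsilon> / 4 \<and> w \<in> {0<..<pi / 2}"
    by (rule eventually_conj)
  then obtain w where w: "tan w * x0\<^sup>2 / 2 < \<epsilon> / 4" "0 < w" "w < pi / 2"
    using eventually_happens'[of "at_right (0::real)"] by fastforce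
  define \<delta> where "\<delta> = min (\<epsilon> / 2) (sqrt (\<epsilon> * w / 2))"
  have "dist p q < \<epsilon>" if q: "grushin_dist p q < \<delta>" for q
  proof -
    obtain x1 y1 where q': "q = (x1, y1)" by fastforce
    let ?d = "grushin_dist p q"
    have "?d\<^sup>2 < \<epsilon> * w / 2"
    proof -
      have "?d < sqrt (\<epsilon> * w / 2)" using q by (simp add: \<delta>_def)
      then have "?d\<^sup>2 < (sqrt (\<epsilon> * w / 2))\<^sup>2"
        using grushin_dist_nonneg by (intro power_strict_mono) auto
      then show ?thesis using assms w by simp
    qed
    moreover have "w * \<bar>y1 - y0\<bar> \<le> ?d\<^sup>2 / 2 + w / 2 * tan w * x0\<^sup>2"
      using grushin_dist_bound_snd[OF w(2,3)] p q' by simp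
    moreover have "w * (tan w * x0\<^sup>2 / 2) < w * (\<epsilon> / 4)"
      using w by (intro mult_strict_left_mono)
    ultimately have "w * \<bar>y1 - y0\<bar> < w * (\<epsilon> / 2)"
      by (simp add: algebra_simps)
    then have "\<bar>y1 - y0\<bar> < \<epsilon> / 2"
      using w by simp
    moreover have "\<bar>x1 - x0\<bar> < \<epsilon> / 2"
      using grushin_dist_ge_fst[of x1 x0 y0 y1] q p q' by (simp add: \<delta>_def)
    moreover have "dist p q \<le> \<bar>x0 - x1\<bar> + \<bar>y0 - y1\<bar>"
      using sqrt_sum_squares_le_sum_abs[of "x0 - x1" "y0 - y1"]
      by (simp add: p q' dist_prod_def dist_real_def)
    ultimately show ?thesis by linarith
  qed
  moreover have "0 < \<delta>"
    using assms w by (simp add: \<delta>_def)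
  ultimately show ?thesis by blast
qed

lemma grushin_dist_less_if_dist_less:
  assumes "0 < \<epsilon>"
  shows "\<exists>\<delta>>0. \<forall>q. dist p q < \<delta> \<longrightarrow> grushin_dist p q < \<epsilon>"
proof -
  have "((\<lambda>q. \<bar>fst q - fst p\<bar> + 3 * sqrt \<bar>snd q - snd p\<bar>) \<longlongrightarrow>
      \<bar>fst p - fst p\<bar> + 3 * sqrt \<bar>snd p - snd p\<bar>) (nhds p)"
    by (intro tendsto_intros filterlim_ident)
  then have "\<forall>\<^sub>F q in nhds p. \<bar>fst q - fst p\<bar> + 3 * sqrt \<bar>snd q - snd p\<bar> < \<epsilon>"
    by (rule order_tendstoD(2)) (use assms in simp)
  then have "\<forall>\<^sub>F q in nhds p. grushin_dist p q < \<epsilon>"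
    by (rule eventually_mono) (rule order_le_less_trans[OF grushin_dist_le])
  then show ?thesis
    by (auto simp: eventually_nhds_metric dist_commute)
qed

lemma grushin_dist_eq_0_iff: "grushin_dist p q = 0 \<longleftrightarrow> p = q"
proof
  assume 0: "grushin_dist p q = 0"
  have "dist p q < \<epsilon>" if "0 < \<epsilon>" for \<epsilon>
    using dist_less_if_grushin_dist_less[OF that, of p] 0 by (auto simp del: split_paired_All)
  then show "p = q"
    by (metis dist_pos_lt less_irrefl)
qed (simp add: grushin_dist_refl)

lemma Metric_space_grushin: "Metric_space UNIV grushin_dist"
  by unfold_locales
    (auto simp: grushin_dist_nonneg grushin_dist_sym grushin_dist_eq_0_iff grushin_dist_triangle)

interpretation grushin: Metric_space UNIV grushin_dist
  by (rule Metric_space_grushin)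

lemma mspace_grushin_plane [simp]: "mspace grushin_plane = UNIV"
  and mdist_grushin_plane [simp]: "mdist grushin_plane = grushin_dist"
  unfolding grushin_plane_def by (simp_all add: grushin.mspace_metric grushin.mdist_metric)

lemma openin_grushin_iff: "openin grushin.mtopology U \<longleftrightarrow> open U"
proof
  assume U: "openin grushin.mtopology U"
  show "open U"
    unfolding open_dist
  proof
    fix p assume "p \<in> U"
    then obtain r where "0 < r" "grushin.mball p r \<subseteq> U"
      using U grushin.openin_mtopology by blast
    then show "\<exists>e>0. \<forall>q. dist q p < e \<longrightarrow> q \<in> U"
      using grushin_dist_less_if_dist_less[of r p] by (fastforce simp: dist_commute)
  qed
next
  assume U: "open U"
  show "openin grushin.mtopology U"
    unfolding grushin.openin_mtopology
  proof (intro conjI allI impI)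
    fix p assume "p \<in> U"
    then obtain r where "0 < r" "\<And>q. dist q p < r \<Longrightarrow> q \<in> U"
      using U unfolding open_dist by blast
    then show "\<exists>r>0. grushin.mball p r \<subseteq> U"
      using dist_less_if_grushin_dist_less[of r p] by (fastforce simp: dist_commute)
  qed simp
qed

lemma mtopology_grushin_plane: "mtopology_of grushin_plane = euclidean"
  by (simp add: topology_eq openin_grushin_iff mtopology_of_def flip: open_openin)

section \<open>Minimality of the sine arcs\<close>

text \<open>The primitive of the squared sine that vanishes at 0, that is, the height gained by the
  arc of amplitude 1.\<close>

definition arc_area :: "real \<Rightarrow> real"
  where "arc_area t = (t - sin t * cos t) / 2"

lemma arc_area_deriv: "(arc_area has_real_derivative (sin t)\<^sup>2) (at t within S)"
proof -
  have "(arc_area has_real_derivative (1 - (cos t * cos t - sin t * sin t)) / 2) (at t within S)"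
    unfolding arc_area_def by (auto intro!: derivative_eq_intros)
  moreover have "(1 - (cos t * cos t - sin t * sin t)) / 2 = (sin t)\<^sup>2"
    using sin_cos_squared_add[of t] by (simp add: power2_eq_square)
  ultimately show ?thesis by simp
qed

lemma arc_area_mono: "s \<le> t \<Longrightarrow> arc_area s \<le> arc_area t"
  by (rule DERIV_nonneg_imp_nondecreasing) (auto intro!: exI arc_area_deriv)

lemma arc_area_0 [simp]: "arc_area 0 = 0" and arc_area_pi [simp]: "arc_area pi = pi / 2"
  by (simp_all add: arc_area_def)

text \<open>The extremals are \<open>x = A sin \<theta>\<close>, \<open>dy = A\<^sup>2 sin\<^sup>2 \<theta> d\<theta>\<close> with \<open>\<theta>\<close> running at constant speed
  within \<open>[0,\<pi>]\<close>.\<close>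

lemma grushin_dist_arc:
  assumes ab: "0 \<le> a" "a < b" "b \<le> pi" and A: "0 \<le> A"
    and y: "\<bar>y1 - y0\<bar> = A\<^sup>2 * (arc_area b - arc_area a)"
  shows "grushin_dist (A * sin a, y0) (A * sin b, y1) = A * (b - a)"
proof (rule antisym)
  define w where "w = b - a"
  have w: "0 < w" "w \<le> pi"
    using ab by (simp_all add: w_def)
  define \<sigma> :: real where "\<sigma> = (if y0 \<le> y1 then 1 else - 1)"
  have \<sigma>: "\<sigma> * \<bar>y1 - y0\<bar> = y1 - y0" "\<sigma> * \<sigma> = 1"
    by (auto simp: \<sigma>_def)
  show "grushin_dist (A * sin a, y0) (A * sin b, y1) \<le> A * (b - a)"
  proof (intro grushin_dist_le_if_joins
      joins_smooth[where \<gamma> = "\<lambda>t. (A * sin (a + t * w), y0 + \<sigma> * A\<^sup>2 * (arc_area (a + t * w) - arc_area a))"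
        and f = "\<lambda>t. A * w * cos (a + t * w)" and g = "\<lambda>t. \<sigma> * A * w * sin (a + t * w)"])
    fix t :: real
    have th: "((\<lambda>t. a + t * w) has_real_derivative w) (at t)"
      by (auto intro!: derivative_eq_intros)
    show "((\<lambda>t. (A * sin (a + t * w), y0 + \<sigma> * A\<^sup>2 * (arc_area (a + t * w) - arc_area a))) has_vector_derivative
        (A * w * cos (a + t * w), fst (A * sin (a + t * w), y0 + \<sigma> * A\<^sup>2 * (arc_area (a + t * w) - arc_area a))
          * (\<sigma> * A * w * sin (a + t * w)))) (at t)"
      by (rule has_vector_derivative_Pair;
          unfold has_real_derivative_iff_has_vector_derivative[symmetric])
        (auto intro!: derivative_eq_intros DERIV_chain2[OF arc_area_deriv th] simp: power2_eq_square)
    have "(A * w * cos (a + t * w))\<^sup>2 + (\<sigma> * A * w * sin (a + t * w))\<^sup>2 =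
        (A * w)\<^sup>2 * ((cos (a + t * w))\<^sup>2 + (\<sigma> * \<sigma>) * (sin (a + t * w))\<^sup>2)"
      by (simp add: power2_eq_square algebra_simps)
    also have "\<dots> = (A * w)\<^sup>2"
      using \<sigma> by simp
    finally show "norm (A * w * cos (a + t * w), \<sigma> * A * w * sin (a + t * w)) = A * (b - a)"
      using A w by (simp add: norm_prod_def w_def)
  next
    have "y1 = y0 + \<sigma> * (A\<^sup>2 * (arc_area b - arc_area a))"
      unfolding y[symmetric] \<sigma> by simp
    then show "(A * sin (a + 1 * w), y0 + \<sigma> * A\<^sup>2 * (arc_area (a + 1 * w) - arc_area a)) = (A * sin b, y1)"
      by (simp add: w_def)
  qed (auto intro!: continuous_intros)
  define x0 x1 where "x0 = A * sin a" and "x1 = A * sin b"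
  define d where "d = grushin_dist (x0, y0) (x1, y1)"
  \<comment> \<open>The calibration needs angles strictly inside \<open>(0, pi)\<close>, while
    \<open>a = 0\<close> and \<open>b = pi\<close> are allowed here. The angular interval is shrunk
    by \<open>\<delta> * w\<close> at each end, and \<delta> tends to 0.\<close>
  define E where "E \<delta> = w * (1 - 2 * \<delta>) * \<bar>y1 - y0\<bar> + w * (1 - 2 * \<delta>) / 2 * (cot (b - \<delta> * w) * x1\<^sup>2)
    - w * (1 - 2 * \<delta>) / 2 * (cot (a + \<delta> * w) * x0\<^sup>2)" for \<delta>
  have "E \<delta> \<le> d\<^sup>2 / 2" if "\<delta> \<in> {0<..<1 / 2}" for \<delta>
  proof -
    have *: "w * (1 - 2 * \<delta>) + (a + \<delta> * w) = b - \<delta> * w"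
      by (simp add: w_def algebra_simps)
    have "0 < \<delta> * w"
      using that w by simp
    then show ?thesis
      using grushin_dist_hamilton_jacobi[of "w * (1 - 2 * \<delta>)" "a + \<delta> * w" y1 y0 x1 x0] that w ab
      unfolding * E_def d_def by (simp add: mult.assoc)
  qed
  then have ev: "\<forall>\<^sub>F \<delta> in at_right 0. E \<delta> \<le> d\<^sup>2 / 2"
    by (intro eventually_mono[OF eventually_at_right_real[of 0 "1 / 2"]]) auto
  \<comment> \<open>Where the cotangent becomes singular the sine vanishes, so the squared abscissa
    is 0 and the product is constantly 0.\<close>
  have c1: "((\<lambda>\<delta>. cot (b - \<delta> * w) * x1\<^sup>2) \<longlongrightarrow> cot (b - 0 * w) * x1\<^sup>2) (at_right 0)"
  proof (cases "x1 = 0")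
    case False
    then show ?thesis
      by (intro tendsto_intros) (auto simp: x1_def)
  qed simp
  have c0: "((\<lambda>\<delta>. cot (a + \<delta> * w) * x0\<^sup>2) \<longlongrightarrow> cot (a + 0 * w) * x0\<^sup>2) (at_right 0)"
  proof (cases "x0 = 0")
    case False
    then show ?thesis
      by (intro tendsto_intros) (auto simp: x0_def)
  qed simp
  have "(E \<longlongrightarrow> w * (1 - 2 * 0) * \<bar>y1 - y0\<bar> + w * (1 - 2 * 0) / 2 * (cot (b - 0 * w) * x1\<^sup>2)
    - w * (1 - 2 * 0) / 2 * (cot (a + 0 * w) * x0\<^sup>2)) (at_right 0)"
    unfolding E_def by (intro tendsto_intros c0 c1) auto
  then have "w * (1 - 2 * 0) * \<bar>y1 - y0\<bar> + w * (1 - 2 * 0) / 2 * (cot (b - 0 * w) * x1\<^sup>2)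
    - w * (1 - 2 * 0) / 2 * (cot (a + 0 * w) * x0\<^sup>2) \<le> d\<^sup>2 / 2"
    by (rule tendsto_upperbound[OF _ ev]) simp
  moreover have "cot b * x1\<^sup>2 = A\<^sup>2 * (sin b * cos b)" "cot a * x0\<^sup>2 = A\<^sup>2 * (sin a * cos a)"
    by (simp_all add: x0_def x1_def cot_def power2_eq_square)
  ultimately have "w * (A\<^sup>2 * (arc_area b - arc_area a)) + w / 2 * (A\<^sup>2 * (sin b * cos b))
    - w / 2 * (A\<^sup>2 * (sin a * cos a)) \<le> d\<^sup>2 / 2"
    by (simp add: y)
  \<comment> \<open>The boundary terms with \<open>sin * cos\<close> cancel those in
    \<open>arc_area\<close>, leaving half the squared length of the arc.\<close>
  moreover have "w * (A\<^sup>2 * (arc_area b - arc_area a)) + w / 2 * (A\<^sup>2 * (sin b * cos b))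
    - w / 2 * (A\<^sup>2 * (sin a * cos a)) = (A * w)\<^sup>2 / 2"
    by (simp add: arc_area_def w_def field_simps power2_eq_square)
  ultimately have "(A * w)\<^sup>2 \<le> d\<^sup>2"
    by simp
  then have "A * w \<le> d"
    using grushin_dist_nonneg[of "(x0, y0)" "(x1, y1)"] power2_le_imp_le unfolding d_def by blast
  then show "A * (b - a) \<le> grushin_dist (A * sin a, y0) (A * sin b, y1)"
    by (simp add: d_def w_def x0_def x1_def)
qed

section \<open>Spaces of geodesics\<close>

text \<open>Continuity and boundedness, which membership in \<open>cfunspace\<close> demands, both
  follow from the constant-speed identity.\<close>

lemma mem_mspace_GeoI:
  assumes ext: "\<gamma> \<in> extensional {0..1}"
    and ran: "\<And>t. t \<in> {0..1} \<Longrightarrow> \<gamma> t \<in> mspace X"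
    and geo: "\<And>s t. s \<in> {0..1} \<Longrightarrow> t \<in> {0..1} \<Longrightarrow>
      mdist X (\<gamma> t) (\<gamma> s) = \<bar>t - s\<bar> * mdist X (\<gamma> 0) (\<gamma> 1)"
  shows "\<gamma> \<in> mspace (Geo X)"
proof -
  interpret X: Metric_space "mspace X" "mdist X"
    by (rule Metric_space_mspace_mdist)
  have "Lipschitz_continuous_map (submetric euclidean_metric {0..1}) X \<gamma>"
    unfolding Lipschitz_continuous_map_def
  proof (intro conjI exI ballI)
    show "\<gamma> \<in> mspace (submetric euclidean_metric {0..1}) \<rightarrow> mspace X"
      using ran by auto
    fix s t :: real assume "s \<in> mspace (submetric euclidean_metric {0..1})"
      "t \<in> mspace (submetric euclidean_metric {0..1})"
    then show "mdist X (\<gamma> s) (\<gamma> t) \<le>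
        mdist X (\<gamma> 0) (\<gamma> 1) * mdist (submetric euclidean_metric {0..1}) s t"
      using geo[of t s] by (simp add: dist_real_def)
  qed
  then have cont: "continuous_map (top_of_set {0..1}) (mtopology_of X) \<gamma>"
    using Lipschitz_continuous_imp_continuous_map mtopology_of_submetric
    by (metis mtopology_of_euclidean)
  have "X.mbounded (\<gamma> ` {0..1})"
    unfolding X.mbounded_def
  proof (intro exI subsetI)
    fix p assume "p \<in> \<gamma> ` {0..1}"
    then obtain t where t: "t \<in> {0..1}" "p = \<gamma> t" by blast
    have "mdist X (\<gamma> 0) (\<gamma> t) \<le> mdist X (\<gamma> 0) (\<gamma> 1)"
      using geo[of t 0] t by (simp add: mult_left_le_one_le)
    then show "p \<in> X.mcball (\<gamma> 0) (mdist X (\<gamma> 0) (\<gamma> 1))"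
      using t ran[of 0] ran[of t] by simp
  qed
  then have "\<gamma> \<in> X.fspace {0..1}"
    unfolding X.fspace_def using ext ran by auto
  then show ?thesis
    unfolding Geo_def cfunspace_def mspace_submetric using cont
    by (intro IntI CollectI ballI geo) simp_all
qed

lemma mem_mspace_GeoD:
  assumes "\<gamma> \<in> mspace (Geo X)"
  shows "\<And>t. t \<in> {0..1} \<Longrightarrow> \<gamma> t \<in> mspace X"
    and "\<And>s t. s \<in> {0..1} \<Longrightarrow> t \<in> {0..1} \<Longrightarrow>
      mdist X (\<gamma> t) (\<gamma> s) = \<bar>t - s\<bar> * mdist X (\<gamma> 0) (\<gamma> 1)"
proof -
  interpret X: Metric_space "mspace X" "mdist X"
    by (rule Metric_space_mspace_mdist)
  have "\<gamma> \<in> mspace (cfunspace (top_of_set {0..1}) X)"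
    and geo: "\<forall>s\<in>{0..1}. \<forall>t\<in>{0..1}. mdist X (\<gamma> t) (\<gamma> s) = \<bar>t - s\<bar> * mdist X (\<gamma> 0) (\<gamma> 1)"
    using assms unfolding Geo_def mspace_submetric by blast+
  then have "\<gamma> ` {0..1} \<subseteq> mspace X"
    unfolding cfunspace_def mspace_submetric mspace_funspace X.fspace_def by simp
  then show "\<gamma> t \<in> mspace X" if "t \<in> {0..1}" for t
    using that by blast
  show "mdist X (\<gamma> t) (\<gamma> s) = \<bar>t - s\<bar> * mdist X (\<gamma> 0) (\<gamma> 1)"
    if "s \<in> {0..1}" "t \<in> {0..1}" for s t
    using that geo by blast
qed

lemma mdist_Geo_le_iff:
  assumes "\<gamma> \<in> mspace (Geo X)" "\<eta> \<in> mspace (Geo X)"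
  shows "mdist (Geo X) \<gamma> \<eta> \<le> a \<longleftrightarrow> (\<forall>t\<in>{0..1}. mdist X (\<gamma> t) (\<eta> t) \<le> a)"
proof -
  have "\<gamma> \<in> mspace (funspace {0..1} X)" "\<eta> \<in> mspace (funspace {0..1} X)"
    using assms unfolding Geo_def cfunspace_def mspace_submetric topspace_euclidean_subtopology by blast+
  from funspace_mdist_le[OF this] show ?thesis
    unfolding Geo_def cfunspace_def by simp
qed

lemma space_borel_of_metric [simp]: "space (borel_of_metric X) = mspace X"
  by (simp add: borel_of_metric_def space_measure_of_conv)

lemma measurable_borel_of_metric_if_continuous_map:
  assumes "continuous_map (mtopology_of X) (mtopology_of Y) f"
  shows "f \<in> borel_of_metric X \<rightarrow>\<^sub>M borel_of_metric Y"
  unfolding borel_of_metric_def[of Y]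
proof (rule measurable_measure_of)
  show "{U. openin (mtopology_of Y) U} \<subseteq> Pow (mspace Y)"
    using openin_subset by fastforce
  show "f \<in> space (borel_of_metric X) \<rightarrow> mspace Y"
    using continuous_map_funspace[OF assms] by simp
  fix U assume "U \<in> {U. openin (mtopology_of Y) U}"
  then have "openin (mtopology_of X) {p \<in> mspace X. f p \<in> U}"
    using openin_continuous_map_preimage[OF assms] by simp
  moreover have "{U. openin (mtopology_of X) U} \<subseteq> Pow (mspace X)"
    using openin_subset by fastforce
  ultimately have "{p \<in> mspace X. f p \<in> U} \<in> sets (borel_of_metric X)"
    by (auto simp: borel_of_metric_def)
  moreover have "f -` U \<inter> space (borel_of_metric X) = {p \<in> mspace X. f p \<in> U}"
    by auto
  ultimately show "f -` U \<inter> space (borel_of_metric X) \<in> sets (borel_of_metric X)"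
    by simp
qed

lemma borel_of_euclidean_metric: "borel_of_metric euclidean_metric = borel"
  by (simp add: borel_of_metric_def borel_def flip: open_openin)

lemma measurable_Geo_eval:
  assumes "t \<in> {0..1}"
  shows "(\<lambda>\<gamma>. \<gamma> t) \<in> borel_of_metric (Geo X) \<rightarrow>\<^sub>M borel_of_metric X"
proof (intro measurable_borel_of_metric_if_continuous_map Lipschitz_continuous_imp_continuous_map)
  have "mdist X (\<gamma> t) (\<eta> t) \<le> 1 * mdist (Geo X) \<gamma> \<eta>"
    if "\<gamma> \<in> mspace (Geo X)" "\<eta> \<in> mspace (Geo X)" for \<gamma> \<eta>
    using mdist_Geo_le_iff[OF that, of "mdist (Geo X) \<gamma> \<eta>"] assms by auto
  then show "Lipschitz_continuous_map (Geo X) X (\<lambda>\<gamma>. \<gamma> t)"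
    unfolding Lipschitz_continuous_map_def using mem_mspace_GeoD(1) assms by blast
qed

lemma measurable_Geo_length:
  "(\<lambda>\<gamma>. mdist X (\<gamma> 0) (\<gamma> 1)) \<in> borel_measurable (borel_of_metric (Geo X))"
  unfolding borel_of_euclidean_metric[symmetric]
proof (intro measurable_borel_of_metric_if_continuous_map Lipschitz_continuous_imp_continuous_map)
  interpret X: Metric_space "mspace X" "mdist X"
    by (rule Metric_space_mspace_mdist)
  have "dist (mdist X (\<gamma> 0) (\<gamma> 1)) (mdist X (\<eta> 0) (\<eta> 1)) \<le> 2 * mdist (Geo X) \<gamma> \<eta>"
    if "\<gamma> \<in> mspace (Geo X)" "\<eta> \<in> mspace (Geo X)" for \<gamma> \<eta>
  proof -
    have m: "\<gamma> 0 \<in> mspace X" "\<gamma> 1 \<in> mspace X" "\<eta> 0 \<in> mspace X" "\<eta> 1 \<in> mspace X"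
      by (auto intro!: mem_mspace_GeoD(1) that)
    have "mdist X (\<gamma> 0) (\<eta> 0) \<le> mdist (Geo X) \<gamma> \<eta>" "mdist X (\<gamma> 1) (\<eta> 1) \<le> mdist (Geo X) \<gamma> \<eta>"
      using mdist_Geo_le_iff[OF that, of "mdist (Geo X) \<gamma> \<eta>"] by auto
    then show ?thesis
      using m X.triangle[of "\<gamma> 0" "\<eta> 0" "\<gamma> 1"] X.triangle[of "\<eta> 0" "\<eta> 1" "\<gamma> 1"]
        X.triangle[of "\<eta> 0" "\<gamma> 0" "\<eta> 1"] X.triangle[of "\<gamma> 0" "\<gamma> 1" "\<eta> 1"]
        X.commute[of "\<gamma> 0" "\<eta> 0"] X.commute[of "\<gamma> 1" "\<eta> 1"]
      by (auto simp: dist_real_def abs_le_iff)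
  qed
  then show "Lipschitz_continuous_map (Geo X) euclidean_metric (\<lambda>\<gamma>. mdist X (\<gamma> 0) (\<gamma> 1))"
    unfolding Lipschitz_continuous_map_def by auto
qed

lemma measurable_mcp_factor: "mcp_factor K N t \<in> borel_measurable borel"
proof -
  have "sinh \<in> borel_measurable (borel :: real measure)"
    by (intro borel_measurable_continuous_onI continuous_intros)
  then have "s_fun K \<in> borel_measurable borel"
    unfolding s_fun_def by measurable
  then show ?thesis
    unfolding mcp_factor_def[abs_def] Let_def by measurable
qed

section \<open>The contraction factor for negative curvature bounds\<close>

lemma sinh_mult_le:
  assumes "0 \<le> t" "t \<le> 1" "0 \<le> (\<theta>::real)"
  shows "sinh (t * \<theta>) \<le> t * sinh \<theta>"
proof -
  have "convex_on {0..} (sinh :: real \<Rightarrow> real)"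
    by (rule f''_ge0_imp_convex[where f' = cosh and f'' = sinh]) (auto intro!: derivative_eq_intros)
  from convex_onD[OF this, of t 0 \<theta>] show ?thesis
    using assms by simp
qed

text \<open>Convexity of \<open>sinh\<close> bounds the quotient by \<open>t\<close>, so the factor
  is at most \<open>t powr N\<close>. At length 0 the convention 0/0 = 1 would give the larger value
  \<open>t\<close>, hence the hypothesis on \<open>l\<close>.\<close>

lemma mcp_factor_le:
  assumes K: "K < 0" and N: "4 \<le> N" and t: "t \<in> {0..1}" and l: "0 < l"
  shows "mcp_factor K N t l \<le> t ^ 4"
proof -
  define \<theta> where "\<theta> = sqrt (- K) * (l / sqrt (N - 1))"
  have \<theta>: "0 < \<theta>"
    using K N l by (simp add: \<theta>_def)
  have b: "s_fun K (l / sqrt (N - 1)) = sinh \<theta> / sqrt (- K)"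
    and a: "s_fun K (t * l / sqrt (N - 1)) = sinh (t * \<theta>) / sqrt (- K)"
    using K by (simp_all add: s_fun_def \<theta>_def mult_ac)
  have r: "0 \<le> sinh (t * \<theta>) / sinh \<theta>" "sinh (t * \<theta>) / sinh \<theta> \<le> t"
    using sinh_mult_le[of t \<theta>] t \<theta> by (auto simp: divide_le_eq)
  have "mcp_factor K N t l = t * (sinh (t * \<theta>) / sinh \<theta>) powr (N - 1)"
    unfolding mcp_factor_def Let_def a b using \<theta> K N by simp
  also have "\<dots> \<le> t * t powr (N - 1)"
    using r t N by (intro mult_left_mono powr_mono2) auto
  also have "\<dots> \<le> t * t ^ 3"
  proof (cases "t = 0")
    case False
    then have "t powr (N - 1) \<le> t powr 3"
      using t N by (intro powr_mono') auto
    then show ?thesis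
      using t False by (simp add: mult_left_mono powr_numeral)
  qed simp
  finally show ?thesis
    by (simp add: power_Suc[symmetric] numeral_eq_Suc)
qed

section \<open>The measure contraction property from contraction maps\<close>

text \<open>The volume inequality is phrased for preimages of measurable sets. This form serves both
  definitions: preimages of supersets of an image control its outer measure, and preimages are what
  push-forward measures see. Points are null so that the constant geodesic, whose factor is
  \<open>t\<close> instead of at most \<open>t ^ 4\<close>, can be discarded.\<close>

locale contraction =
  fixes X :: "'a metric" and m :: "'a measure"
  assumes sets_m: "sets m = sets (borel_of_metric X)"
    and null_points: "\<And>x. x \<in> mspace X \<Longrightarrow> AE y in m. y \<noteq> x"
    and contraction_maps: "\<And>x. x \<in> mspace X \<Longrightarrow> \<exists>\<phi>. \<phi> \<in> m \<rightarrow>\<^sub>M borel_of_metric (Geo X) \<and>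
      (\<forall>y\<in>mspace X. \<phi> y 0 = x \<and> \<phi> y 1 = y) \<and>
      (\<forall>t\<in>{0<..<1}. \<forall>B\<in>sets m.
        ennreal (t ^ 4) * emeasure m {y \<in> mspace X. \<phi> y t \<in> B} \<le> emeasure m B)"
begin

lemma space_m: "space m = mspace X"
  using sets_eq_imp_space_eq[OF sets_m] by simp

lemma contraction_map_obtain:
  assumes "x \<in> mspace X"
  obtains \<phi> where "\<phi> \<in> m \<rightarrow>\<^sub>M borel_of_metric (Geo X)"
    "\<And>y. y \<in> mspace X \<Longrightarrow> \<phi> y 0 = x" "\<And>y. y \<in> mspace X \<Longrightarrow> \<phi> y 1 = y"
    "\<And>t B. t \<in> {0..1} \<Longrightarrow> B \<in> sets m \<Longrightarrow>
        ennreal (t ^ 4) * emeasure m {y \<in> mspace X. \<phi> y t \<in> B} \<le> emeasure m B"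
proof -
  obtain \<phi> where \<phi>: "\<phi> \<in> m \<rightarrow>\<^sub>M borel_of_metric (Geo X)"
    "\<forall>y\<in>mspace X. \<phi> y 0 = x \<and> \<phi> y 1 = y"
    "\<forall>t\<in>{0<..<1}. \<forall>B\<in>sets m.
        ennreal (t ^ 4) * emeasure m {y \<in> mspace X. \<phi> y t \<in> B} \<le> emeasure m B"
    using contraction_maps[OF assms] by blast
  have "ennreal (t ^ 4) * emeasure m {y \<in> mspace X. \<phi> y t \<in> B} \<le> emeasure m B"
    if t: "t \<in> {0..1}" and B: "B \<in> sets m" for t B
  proof -
    consider "t = 0" | "t = 1" | "t \<in> {0<..<1}"
      using t by fastforce
    then show ?thesis
    proof cases
      case 2
      have "{y \<in> mspace X. \<phi> y t \<in> B} = B"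
        using \<phi>(2) sets.sets_into_space[OF B] 2 by (auto simp: space_m)
      then show ?thesis
        using 2 by simp
    qed (use \<phi>(3) B in auto)
  qed
  with \<phi> show thesis
    by (intro that[of \<phi>]) blast+
qed

text \<open>Every measurable \<open>B\<close> that contains the contracted set has a preimage
  containing \<open>A\<close>, so the preimage inequality bounds each competitor for the outer
  measure.\<close>

lemma MCP0:
  assumes N: "4 \<le> N"
  shows "MCP0 X m N"
  unfolding MCP0_def
proof
  fix x assume x: "x \<in> mspace X"
  obtain \<phi> where \<phi>: "\<phi> \<in> m \<rightarrow>\<^sub>M borel_of_metric (Geo X)"
    "\<And>y. y \<in> mspace X \<Longrightarrow> \<phi> y 0 = x" "\<And>y. y \<in> mspace X \<Longrightarrow> \<phi> y 1 = y"
    "\<And>t B. t \<in> {0..1} \<Longrightarrow> B \<in> sets m \<Longrightarrow>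
        ennreal (t ^ 4) * emeasure m {y \<in> mspace X. \<phi> y t \<in> B} \<le> emeasure m B"
    by (rule contraction_map_obtain[OF x]) (rule that)
  have "ennreal (t powr N) * emeasure m A \<le> outer_measure_of m ((\<lambda>y. \<phi> y t) ` A)"
    if A: "A \<in> sets m" and t: "t \<in> {0..1}" for A t
    unfolding outer_measure_of_def
  proof (rule INF_greatest)
    fix B assume B: "B \<in> {B \<in> sets m. (\<lambda>y. \<phi> y t) ` A \<subseteq> B}"
    have meas: "(\<lambda>y. \<phi> y t) \<in> m \<rightarrow>\<^sub>M m"
      using measurable_compose[OF \<phi>(1) measurable_Geo_eval[OF t]] measurable_cong_sets[OF refl sets_m]
      by blast
    have "{y \<in> mspace X. \<phi> y t \<in> B} \<in> sets m"
      using measurable_sets[OF meas, of B] B by (simp add: space_m vimage_def Collect_conj_eq inf_commute)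
    moreover have "A \<subseteq> {y \<in> mspace X. \<phi> y t \<in> B}"
      using B sets.sets_into_space[OF A] by (auto simp: space_m)
    ultimately have le: "emeasure m A \<le> emeasure m {y \<in> mspace X. \<phi> y t \<in> B}"
      by (intro emeasure_mono)
    have "t powr N \<le> t ^ 4"
    proof (cases "t = 0")
      case False
      have "t powr N \<le> t powr 4"
        using t N by (intro powr_mono') auto
      then show ?thesis
        using t False by (simp add: powr_numeral)
    qed simp
    then have "ennreal (t powr N) * emeasure m A \<le> ennreal (t ^ 4) * emeasure m {y \<in> mspace X. \<phi> y t \<in> B}"
      by (intro mult_mono le ennreal_leI) auto
    also have "\<dots> \<le> emeasure m B"
      using \<phi>(4) t B by blast
    finally show "ennreal (t powr N) * emeasure m A \<le> emeasure m B" .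
  qed
  then show "\<exists>\<phi>\<in>m \<rightarrow>\<^sub>M borel_of_metric (Geo X).
      (\<forall>y\<in>mspace X. \<phi> y 0 = x \<and> \<phi> y 1 = y) \<and>
      (\<forall>A\<in>sets m. 0 < emeasure m A \<and> emeasure m A < \<infinity> \<longrightarrow>
        (\<forall>t\<in>{0..1}. outer_measure_of m ((\<lambda>y. \<phi> y t) ` A) \<ge> ennreal (t powr N) * emeasure m A))"
    using \<phi>(1-3) by blast
qed

text \<open>The required measure on geodesics is the image of the uniform distribution on
  \<open>A\<close> under the contraction map. Almost everywhere the density is at most
  \<open>t ^ 4\<close> times the mass of \<open>A\<close>, and this mass cancels the normalisation
  of the uniform distribution.\<close>

lemma MCP_Ohta:
  assumes K: "K < 0" and N: "4 \<le> N"
  shows "MCP_Ohta X m K N"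
  unfolding MCP_Ohta_def
proof (intro ballI impI)
  fix x A assume x: "x \<in> mspace X" and A: "A \<in> sets m"
    and "0 < emeasure m A \<and> emeasure m A < \<infinity> \<and>
      (K > 0 \<longrightarrow> A \<subseteq> mball_of X x (pi * sqrt ((N - 1) / K)))"
  then have A0: "emeasure m A \<noteq> 0" "emeasure m A \<noteq> \<infinity>"
    by auto
  obtain \<phi> where \<phi>: "\<phi> \<in> m \<rightarrow>\<^sub>M borel_of_metric (Geo X)"
    "\<And>y. y \<in> mspace X \<Longrightarrow> \<phi> y 0 = x" "\<And>y. y \<in> mspace X \<Longrightarrow> \<phi> y 1 = y"
    "\<And>t B. t \<in> {0..1} \<Longrightarrow> B \<in> sets m \<Longrightarrow>
        ennreal (t ^ 4) * emeasure m {y \<in> mspace X. \<phi> y t \<in> B} \<le> emeasure m B"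
    by (rule contraction_map_obtain[OF x]) (rule that)
  define U where "U = uniform_measure m A"
  have U: "sets U = sets m" "space U = mspace X" "prob_space U"
    using A0 by (auto simp: U_def space_m intro: prob_space_uniform_measure)
  have \<phi>U: "\<phi> \<in> U \<rightarrow>\<^sub>M borel_of_metric (Geo X)"
    using \<phi>(1) measurable_cong_sets[OF U(1) refl] by blast
  define P where "P = distr U (borel_of_metric (Geo X)) \<phi>"
  have P: "sets P = sets (borel_of_metric (Geo X))" "space P = mspace (Geo X)"
    by (simp_all add: P_def)
  have eval: "(\<lambda>\<gamma>. \<gamma> t) \<in> borel_of_metric (Geo X) \<rightarrow>\<^sub>M m" if "t \<in> {0..1}" for t
    using measurable_Geo_eval[OF that] measurable_cong_sets[OF refl sets_m] by blast
  show "\<exists>P. prob_space P \<and> sets P = sets (borel_of_metric (Geo X)) \<and>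
        distr P m (\<lambda>\<gamma>. \<gamma> 0) = return m x \<and>
        distr P m (\<lambda>\<gamma>. \<gamma> 1) = uniform_measure m A \<and>
        (\<forall>t\<in>{0..1}. \<forall>B\<in>sets m. emeasure m B \<ge>
          emeasure
            (distr
              (density P (\<lambda>\<gamma>. ennreal (mcp_factor K N t (mdist X (\<gamma> 0) (\<gamma> 1))) * emeasure m A))
              m (\<lambda>\<gamma>. \<gamma> t))
            B)"
  proof (intro exI[of _ P] conjI ballI)
    show "prob_space P"
      unfolding P_def by (rule prob_space.prob_space_distr[OF U(3) \<phi>U])
    show "sets P = sets (borel_of_metric (Geo X))"
      by (rule P)
    have "distr P m (\<lambda>\<gamma>. \<gamma> 0) = distr U m (\<lambda>y. \<phi> y 0)"
      unfolding P_def using distr_distr[OF eval \<phi>U, of 0] by (simp add: comp_def)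
    also have "\<dots> = distr U m (\<lambda>y. x)"
      by (rule distr_cong) (auto simp: U \<phi>)
    also have "\<dots> = return m x"
      by (rule prob_space.distr_const[OF U(3)]) (simp add: space_m x)
    finally show "distr P m (\<lambda>\<gamma>. \<gamma> 0) = return m x" .
    have "distr P m (\<lambda>\<gamma>. \<gamma> 1) = distr U m (\<lambda>y. \<phi> y 1)"
      unfolding P_def using distr_distr[OF eval \<phi>U, of 1] by (simp add: comp_def)
    also have "\<dots> = distr U m (\<lambda>y. y)"
      by (rule distr_cong) (auto simp: U \<phi>)
    also have "\<dots> = U"
      by (rule distr_id2) (simp add: U)
    finally show "distr P m (\<lambda>\<gamma>. \<gamma> 1) = uniform_measure m A"
      by (simp add: U_def)
    fix t B assume t: "t \<in> {0..1::real}" and B: "B \<in> sets m"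
    define f where "f \<gamma> = ennreal (mcp_factor K N t (mdist X (\<gamma> 0) (\<gamma> 1))) * emeasure m A" for \<gamma> :: "real \<Rightarrow> 'a"
    have f: "f \<in> borel_measurable (borel_of_metric (Geo X))"
      unfolding f_def
      using measurable_compose[OF measurable_Geo_length measurable_mcp_factor] by measurable
    define T where "T = {y \<in> mspace X. \<phi> y t \<in> B}"
    have T: "T \<in> sets m"
      using measurable_sets[OF measurable_compose[OF \<phi>(1) eval[OF t]] B]
      by (simp add: space_m vimage_def T_def Collect_conj_eq inf_commute)
    have ev: "(\<lambda>\<gamma>. \<gamma> t) -` B \<inter> mspace (Geo X) \<in> sets (borel_of_metric (Geo X))"
      using measurable_sets[OF eval[OF t] B] by simp
    have "(\<lambda>\<gamma>. \<gamma> t) \<in> density P f \<rightarrow>\<^sub>M m"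
      using eval[OF t] measurable_cong_sets[of "density P f" "borel_of_metric (Geo X)" m m] P by auto
    then have "emeasure (distr (density P f) m (\<lambda>\<gamma>. \<gamma> t)) B = emeasure (density P f) ((\<lambda>\<gamma>. \<gamma> t) -` B \<inter> mspace (Geo X))"
      using B by (subst emeasure_distr) (auto simp: P)
    also have "\<dots> = (\<integral>\<^sup>+\<gamma>. f \<gamma> * indicator ((\<lambda>\<gamma>. \<gamma> t) -` B \<inter> mspace (Geo X)) \<gamma> \<partial>P)"
      using f ev measurable_cong_sets[OF P(1) refl] by (intro emeasure_density) (auto simp: P)
    also have "\<dots> = (\<integral>\<^sup>+y. f (\<phi> y) * indicator ((\<lambda>\<gamma>. \<gamma> t) -` B \<inter> mspace (Geo X)) (\<phi> y) \<partial>U)"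
      unfolding P_def
      by (intro nn_integral_distr[OF \<phi>U])
        (simp, intro borel_measurable_times_ennreal f borel_measurable_indicator ev)
    also have "\<dots> \<le> (\<integral>\<^sup>+y. ennreal (t ^ 4) * emeasure m A * indicator T y \<partial>U)"
    proof (rule nn_integral_mono_AE)
      have "AE y in m. y \<noteq> x"
        by (rule null_points[OF x])
      then have "AE y in U. y \<noteq> x"
        unfolding U_def using A by (intro AE_uniform_measureI) (auto elim: eventually_mono)
      moreover have "AE y in U. y \<in> mspace X"
        using AE_space[of U] by (simp add: U)
      ultimately show "AE y in U. f (\<phi> y) * indicator ((\<lambda>\<gamma>. \<gamma> t) -` B \<inter> mspace (Geo X)) (\<phi> y)
          \<le> ennreal (t ^ 4) * emeasure m A * indicator T y"
      proof eventually_elim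
        case (elim y)
        have "0 < mdist X x y"
          by (rule Metric_space.mdist_pos_less[OF Metric_space_mspace_mdist]) (use elim x in auto)
        then have "mcp_factor K N t (mdist X (\<phi> y 0) (\<phi> y 1)) \<le> t ^ 4"
          using mcp_factor_le[OF K N t] elim(2) by (simp add: \<phi>)
        then have "f (\<phi> y) \<le> ennreal (t ^ 4) * emeasure m A"
          unfolding f_def by (intro mult_right_mono ennreal_leI) auto
        then show ?case
          using elim(2) by (auto simp: T_def indicator_def)
      qed
    qed
    also have "\<dots> = ennreal (t ^ 4) * emeasure m A * emeasure U T"
      using T U by (subst nn_integral_cmult_indicator) auto
    also have "\<dots> = ennreal (t ^ 4) * (emeasure m A * (emeasure m (A \<inter> T) / emeasure m A))"
      unfolding U_def using A T by (simp add: emeasure_uniform_measure mult.assoc)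
    also have "\<dots> = ennreal (t ^ 4) * emeasure m (A \<inter> T)"
    proof -
      have "emeasure m A * (emeasure m (A \<inter> T) / emeasure m A) = emeasure m (A \<inter> T)"
        unfolding ennreal_times_divide using A0
        by (subst mult.commute) (simp add: mult_divide_eq_ennreal)
      then show ?thesis by simp
    qed
    also have "\<dots> \<le> ennreal (t ^ 4) * emeasure m T"
      using T by (intro mult_left_mono emeasure_mono) auto
    also have "\<dots> \<le> emeasure m B"
      unfolding T_def by (rule \<phi>(4)[OF t B])
    finally show "emeasure (distr (density P (\<lambda>\<gamma>. ennreal (mcp_factor K N t (mdist X (\<gamma> 0) (\<gamma> 1))) * emeasure m A))
        m (\<lambda>\<gamma>. \<gamma> t)) B \<le> emeasure m B"
      unfolding f_def .
  qed
qed

lemma MCP: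
  assumes "K \<le> 0" "4 \<le> N"
  shows "MCP X m K N"
  using assms MCP0 MCP_Ohta unfolding MCP_def by auto

end

section \<open>Extremals with given end points\<close>

lemma sin_minus_id_cos_pos:
  assumes "0 < w" "w \<le> pi"
  shows "w * cos w < sin w"
proof -
  have "sin 0 - 0 * cos 0 < sin w - w * cos w"
  proof (rule DERIV_pos_imp_increasing_open[OF assms(1)])
    fix t assume "0 < t" "t < w"
    then have "0 < t * sin t"
      using assms by (intro mult_pos_pos sin_gt_zero) auto
    then show "\<exists>y. ((\<lambda>w. sin w - w * cos w) has_real_derivative y) (at t) \<and> 0 < y"
      by (intro exI[of _ "t * sin t"]) (auto intro!: derivative_eq_intros)
  qed (intro continuous_intros)
  then show ?thesis by simp
qed

text \<open>A coefficient of the quadratic form \<open>displacement\<close> below. It is also the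
  height divided by \<open>x1\<^sup>2\<close> at which the arc of angle \<open>w\<close> from the
  origin reaches abscissa \<open>x1\<close>.\<close>

definition disp_diag :: "real \<Rightarrow> real"
  where "disp_diag w = (w - sin w * cos w) / (2 * (sin w)\<^sup>2)"

definition disp_mixed :: "real \<Rightarrow> real"
  where "disp_mixed w = (sin w - w * cos w) / (sin w)\<^sup>2"

text \<open>\<open>displacement w x0 x1\<close> is the vertical displacement \<open>\<integral> w x\<^sup>2\<close> over unit time along the solution of
  \<open>x'' = - w\<^sup>2 x\<close> with end points \<open>x0\<close>, \<open>x1\<close>; \<open>chord w x0 x1\<close> is that solution. The correct value \<open>displacement 0 x0 x1 = 0\<close>
  is an instance of \<open>a / 0 = 0\<close>.\<close>

definition displacement :: "real \<Rightarrow> real \<Rightarrow> real \<Rightarrow> real"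
  where "displacement w x0 x1 = (x0\<^sup>2 + x1\<^sup>2) * disp_diag w + x0 * x1 * disp_mixed w"

definition chord :: "real \<Rightarrow> real \<Rightarrow> real \<Rightarrow> real \<Rightarrow> real"
  where "chord w x0 x1 t = (x0 * sin ((1 - t) * w) + x1 * sin (t * w)) / sin w"

definition displacement_deriv :: "real \<Rightarrow> real \<Rightarrow> real \<Rightarrow> real"
  where "displacement_deriv w x0 x1 =
    ((x0\<^sup>2 + x1\<^sup>2) * (sin w - w * cos w) + x0 * x1 * (w * (1 + (cos w)\<^sup>2) - 2 * sin w * cos w)) / (sin w) ^ 3"

lemma disp_diag_deriv:
  assumes "sin w \<noteq> 0"
  shows "(disp_diag has_real_derivative (sin w - w * cos w) / (sin w) ^ 3) (at w)"
proof -
  have "(disp_diag has_real_derivative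
      ((1 - (cos w * cos w - sin w * sin w)) * (2 * (sin w)\<^sup>2) - (w - sin w * cos w) * (2 * (2 * sin w * cos w)))
      / (2 * (sin w)\<^sup>2 * (2 * (sin w)\<^sup>2))) (at w)"
    unfolding disp_diag_def using assms
    by (auto intro!: derivative_eq_intros simp: power2_eq_square)
  moreover have "1 - (cos w * cos w - sin w * sin w) = 2 * (sin w)\<^sup>2"
    using sin_cos_squared_add[of w] by (simp add: power2_eq_square)
  moreover have "(2 * (sin w)\<^sup>2 * (2 * (sin w)\<^sup>2) - (w - sin w * cos w) * (2 * (2 * sin w * cos w)))
      / (2 * (sin w)\<^sup>2 * (2 * (sin w)\<^sup>2)) = ((sin w) ^ 3 + sin w * (cos w)\<^sup>2 - w * cos w) / (sin w) ^ 3"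
    using assms by (simp add: field_simps power2_eq_square power3_eq_cube)
  moreover have "(sin w) ^ 3 + sin w * (cos w)\<^sup>2 = sin w"
  proof -
    have "(sin w) ^ 3 + sin w * (cos w)\<^sup>2 = sin w * ((sin w)\<^sup>2 + (cos w)\<^sup>2)"
      by (simp only: distrib_left power2_eq_square power3_eq_cube mult.assoc)
    also have "\<dots> = sin w"
      by (simp only: sin_cos_squared_add mult_1_right)
    finally show ?thesis .
  qed
  ultimately show ?thesis
    by (simp only:)
qed

lemma disp_mixed_deriv:
  assumes "sin w \<noteq> 0"
  shows "(disp_mixed has_real_derivative (w * (1 + (cos w)\<^sup>2) - 2 * sin w * cos w) / (sin w) ^ 3) (at w)"
proof -
  have "(disp_mixed has_real_derivative
      (w * sin w * (sin w)\<^sup>2 - (sin w - w * cos w) * (2 * sin w * cos w)) / ((sin w)\<^sup>2 * (sin w)\<^sup>2)) (at w)"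
    unfolding disp_mixed_def using assms
    by (auto intro!: derivative_eq_intros simp: power2_eq_square)
  moreover have "(w * sin w * (sin w)\<^sup>2 - (sin w - w * cos w) * (2 * sin w * cos w)) / ((sin w)\<^sup>2 * (sin w)\<^sup>2)
      = (w * ((sin w)\<^sup>2 + 2 * (cos w)\<^sup>2) - 2 * sin w * cos w) / (sin w) ^ 3"
    using assms by (simp add: field_simps power2_eq_square power3_eq_cube)
  moreover have "(sin w)\<^sup>2 + 2 * (cos w)\<^sup>2 = 1 + (cos w)\<^sup>2"
    using sin_cos_squared_add[of w] by simp
  ultimately show ?thesis
    by simp
qed

lemma displacement_has_deriv:
  assumes "sin w \<noteq> 0"
  shows "((\<lambda>w. displacement w x0 x1) has_real_derivative displacement_deriv w x0 x1) (at w)"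
proof -
  have "((\<lambda>w. displacement w x0 x1) has_real_derivative
      (x0\<^sup>2 + x1\<^sup>2) * ((sin w - w * cos w) / (sin w) ^ 3) +
      x0 * x1 * ((w * (1 + (cos w)\<^sup>2) - 2 * sin w * cos w) / (sin w) ^ 3)) (at w)"
    unfolding displacement_def
    by (intro DERIV_add DERIV_cmult disp_diag_deriv disp_mixed_deriv assms)
  then show ?thesis
    by (simp add: displacement_deriv_def add_divide_distrib)
qed

text \<open>The mixed coefficient is nonnegative by
  \<open>2 * cos w \<le> 1 + (cos w)\<^sup>2\<close> and \<open>sin w \<le> w\<close>. Since both
  ends lie in the same half-plane, \<open>x0 * x1\<close> is nonnegative too, and the diagonal part
  is strictly positive.\<close>

lemma displacement_deriv_pos:
  assumes "0 < w" "w < pi" "0 \<le> x0" "0 \<le> x1" "0 < x0 \<or> 0 < x1"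
  shows "0 < displacement_deriv w x0 x1"
proof -
  have s: "0 < sin w"
    using assms by (intro sin_gt_zero)
  have "2 * sin w * cos w \<le> sin w * (1 + (cos w)\<^sup>2)"
    using s sum_squares_bound[of 1 "cos w"] by (simp add: mult.assoc mult.commute)
  also have "\<dots> \<le> w * (1 + (cos w)\<^sup>2)"
    using assms sin_x_le_x[of w] by (intro mult_right_mono) auto
  finally have "0 \<le> x0 * x1 * (w * (1 + (cos w)\<^sup>2) - 2 * sin w * cos w)"
    using assms by simp
  moreover have "0 < (x0\<^sup>2 + x1\<^sup>2) * (sin w - w * cos w)"
    using assms sin_minus_id_cos_pos[of w] by (intro mult_pos_pos) (auto simp: sum_power2_gt_zero_iff)
  ultimately show ?thesis
    unfolding displacement_deriv_def using s by simp
qed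

lemma displacement_strict_mono:
  assumes "0 < v" "v < w" "w < pi" "0 \<le> x0" "0 \<le> x1" "0 < x0 \<or> 0 < x1"
  shows "displacement v x0 x1 < displacement w x0 x1"
proof (rule DERIV_pos_imp_increasing[OF assms(2)])
  fix t assume "v \<le> t" "t \<le> w"
  then have t: "0 < t" "t < pi"
    using assms by auto
  then show "\<exists>y. ((\<lambda>w. displacement w x0 x1) has_real_derivative y) (at t) \<and> 0 < y"
    using displacement_has_deriv[of t x0 x1] displacement_deriv_pos[OF t assms(4-6)] sin_gt_zero[OF t]
    by auto
qed

lemma displacement_less_iff:
  assumes "0 < v" "v < pi" "0 < w" "w < pi" "0 \<le> x0" "0 \<le> x1" "0 < x0 \<or> 0 < x1"
  shows "displacement v x0 x1 < displacement w x0 x1 \<longleftrightarrow> v < w"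
  using displacement_strict_mono[of v w x0 x1] displacement_strict_mono[of w v x0 x1] assms
  by (metis linorder_neqE_linordered_idom order_less_asym)

lemma displacement_isCont: "sin w \<noteq> 0 \<Longrightarrow> isCont (\<lambda>w. displacement w x0 x1) w"
  using displacement_has_deriv DERIV_isCont by blast

lemma displacement_at_0: "((\<lambda>w. displacement w x0 x1) \<longlongrightarrow> 0) (at_right 0)"
proof -
  have "((\<lambda>w::real. (w - sin w * cos w) / (2 * (sin w)\<^sup>2)) \<longlongrightarrow> 0) (at_right 0)"
    by real_asymp
  moreover have "((\<lambda>w::real. (sin w - w * cos w) / (sin w)\<^sup>2) \<longlongrightarrow> 0) (at_right 0)"
    by real_asymp
  ultimately have "((\<lambda>w. displacement w x0 x1) \<longlongrightarrow> (x0\<^sup>2 + x1\<^sup>2) * 0 + x0 * x1 * 0) (at_right 0)"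
    unfolding displacement_def disp_diag_def disp_mixed_def by (intro tendsto_intros)
  then show ?thesis by simp
qed

text \<open>The diagonal coefficient blows up at \<open>pi\<close> and the mixed one is nonnegative,
  so the product \<open>x0 * x1\<close> cannot compensate.\<close>

lemma displacement_at_pi:
  assumes "0 \<le> x0" "0 \<le> x1" "0 < x0 \<or> 0 < x1"
  shows "filterlim (\<lambda>w. displacement w x0 x1) at_top (at_left pi)"
proof -
  have "filterlim (\<lambda>v::real. (pi - v + sin v * cos v) / (2 * (sin v)\<^sup>2)) at_top (at_right 0)"
    using pi_gt_zero by real_asymp
  then have "filterlim (\<lambda>v. disp_diag (pi - v)) at_top (at_right 0)"
    by (simp add: disp_diag_def)
  then have "filterlim disp_diag at_top (at_left pi)"
    unfolding at_left_minus[of pi] filterlim_filtermap at_right_to_0[of "- pi"] by (simp add: add.commute)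
  then have "filterlim (\<lambda>w. (x0\<^sup>2 + x1\<^sup>2) * disp_diag w) at_top (at_left pi)"
    using assms by (intro filterlim_tendsto_pos_mult_at_top[OF tendsto_const]) (auto simp: sum_power2_gt_zero_iff)
  moreover have "\<forall>\<^sub>F w in at_left pi. (x0\<^sup>2 + x1\<^sup>2) * disp_diag w \<le> displacement w x0 x1"
  proof (rule eventually_mono[OF eventually_at_left_real[OF pi_gt_zero]])
    fix w assume "w \<in> {0<..<pi}"
    then have "0 \<le> disp_mixed w"
      unfolding disp_mixed_def using sin_minus_id_cos_pos[of w] by simp
    then show "(x0\<^sup>2 + x1\<^sup>2) * disp_diag w \<le> displacement w x0 x1"
      using assms by (simp add: displacement_def)
  qed
  ultimately show ?thesis
    by (rule filterlim_at_top_mono)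
qed

lemma displacement_surj:
  assumes "0 \<le> x0" "0 \<le> x1" "0 < x0 \<or> 0 < x1" "0 < Y"
  shows "\<exists>w. 0 < w \<and> w < pi \<and> displacement w x0 x1 = Y"
proof -
  have "\<forall>\<^sub>F w in at_right 0. displacement w x0 x1 < Y \<and> w \<in> {0<..<pi}"
    using order_tendstoD(2)[OF displacement_at_0 assms(4)]
    by (rule eventually_conj[OF _ eventually_at_right_real[OF pi_gt_zero]])
  then obtain a where a: "displacement a x0 x1 < Y" "a \<in> {0<..<pi}"
    using eventually_happens'[of "at_right (0::real)"] by fastforce
  have "\<forall>\<^sub>F w in at_left pi. Y < displacement w x0 x1 \<and> w \<in> {0<..<pi}"
    using displacement_at_pi[OF assms(1-3)]
    by (intro eventually_conj[OF _ eventually_at_left_real[OF pi_gt_zero]])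
      (simp add: filterlim_at_top_dense)
  then obtain b where b: "Y < displacement b x0 x1" "b \<in> {0<..<pi}"
    using eventually_happens'[of "at_left pi"] by fastforce
  have ab: "a < b"
    using displacement_less_iff[of a b x0 x1] a b assms by auto
  obtain w where "a \<le> w" "w \<le> b" "displacement w x0 x1 = Y"
  proof (rule IVT[of "\<lambda>w. displacement w x0 x1" a Y b, THEN exE])
    show "\<forall>w. a \<le> w \<and> w \<le> b \<longrightarrow> isCont (\<lambda>w. displacement w x0 x1) w"
      using a b sin_gt_zero by (intro allI impI displacement_isCont) (metis greaterThanLessThan_iff less_le_trans le_less_trans less_irrefl)
  qed (use a b ab in auto)
  then show ?thesis
    using a b by (intro exI[of _ w]) auto
qed

lemma displacement_0 [simp]: "displacement 0 x0 x1 = 0"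
  by (simp add: displacement_def disp_diag_def disp_mixed_def)

lemma chord_0 [simp]: "sin w \<noteq> 0 \<Longrightarrow> chord w x0 x1 0 = x0"
  and chord_1 [simp]: "sin w \<noteq> 0 \<Longrightarrow> chord w x0 x1 1 = x1"
  by (simp_all add: chord_def)

text \<open>The oscillation with these end values is \<open>A * sin (a + t * w)\<close>, and
  \<open>c\<close> below is \<open>A * cos a\<close>. Since \<open>x0\<close> is nonnegative the
  phase \<open>a\<close> can be taken in \<open>[0, pi]\<close>; since \<open>x1\<close> is
  nonnegative and \<open>w < pi\<close>, the final phase cannot pass \<open>pi\<close>.\<close>

lemma polar_form:
  assumes "0 \<le> x0" "0 \<le> x1" "0 < x0 \<or> 0 < x1" "0 < w" "w < pi"
  obtains A a where "0 < A" "0 \<le> a" "a + w \<le> pi" "x0 = A * sin a" "x1 = A * sin (a + w)"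
proof -
  have s: "0 < sin w"
    using assms by (intro sin_gt_zero)
  define c where "c = (x1 - x0 * cos w) / sin w"
  define A where "A = sqrt (x0\<^sup>2 + c\<^sup>2)"
  have x1: "x1 = x0 * cos w + c * sin w"
    using s by (simp add: c_def)
  have "x0 \<noteq> 0 \<or> c \<noteq> 0"
    using x1 assms(3) by auto
  then have A: "0 < A"
    by (simp add: A_def sum_power2_gt_zero_iff)
  have A2: "A\<^sup>2 = x0\<^sup>2 + c\<^sup>2"
    by (simp add: A_def)
  have "(c / A)\<^sup>2 + (x0 / A)\<^sup>2 = (x0\<^sup>2 + c\<^sup>2) / A\<^sup>2"
    by (simp add: power_divide add_divide_distrib)
  also have "\<dots> = 1"
    using A by (simp add: A2[symmetric])
  finally have "(c / A)\<^sup>2 + (x0 / A)\<^sup>2 = 1" .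
  moreover have "0 \<le> x0 / A"
    using A assms by simp
  ultimately obtain a where a: "0 \<le> a" "a \<le> pi" "c / A = cos a" "x0 / A = sin a"
    using sincos_total_pi[of "x0 / A" "c / A"] by auto
  have x0a: "x0 = A * sin a" and ca: "c = A * cos a"
    using a A by (simp_all add: field_simps)
  have x1a: "x1 = A * sin (a + w)"
    unfolding x1 x0a ca by (simp add: sin_add algebra_simps)
  have "a + w \<le> pi"
  proof (rule ccontr)
    assume "\<not> a + w \<le> pi"
    then have "sin (a + w) < 0"
      using a assms by (intro sin_lt_zero) auto
    then show False
      using x1a A assms(2) by (simp add: zero_le_mult_iff)
  qed
  with A a x0a x1a show thesis
    by (intro that)
qed

lemma chord_polar:
  assumes "sin w \<noteq> 0"
  shows "chord w (A * sin a) (A * sin (a + w)) t = A * sin (a + t * w)"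
proof -
  define u v where "u = t * w" and "v = (1 - t) * w"
  have w: "w = u + v"
    by (simp add: u_def v_def algebra_simps)
  have "sin a * sin v + sin (a + (u + v)) * sin u = sin (u + v) * sin (a + u)"
    using sin_cos_squared_add[of u] unfolding sin_add cos_add by algebra
  then have "A * sin a * sin v + A * sin (a + w) * sin u = A * sin (a + u) * sin w"
    unfolding w[symmetric] by algebra
  then show ?thesis
    using assms unfolding chord_def u_def[symmetric] v_def[symmetric]
    by (simp only:) simp
qed

lemma displacement_polar:
  assumes "sin w \<noteq> 0"
  shows "displacement w (A * sin a) (A * sin (a + w)) = A\<^sup>2 * (arc_area (a + w) - arc_area a)"
proof -
  define s c p q where "s = sin w" and "c = cos w" and "p = sin a" and "q = cos a"
  have sc: "c\<^sup>2 = 1 - s\<^sup>2" "q\<^sup>2 = 1 - p\<^sup>2"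
    using sin_cos_squared_add2[of w] sin_cos_squared_add2[of a] by (simp_all add: s_def c_def p_def q_def algebra_simps)
  define r where "r = p * c + q * s"
  have r: "sin (a + w) = r" "cos (a + w) = q * c - p * s"
    by (simp_all add: sin_add cos_add s_def c_def p_def q_def r_def)
  have 1: "p\<^sup>2 + r\<^sup>2 - 2 * p * r * c = s\<^sup>2"
    using sc unfolding r_def by algebra
  have 2: "- (p\<^sup>2 + r\<^sup>2) * s * c + 2 * p * r * s = s\<^sup>2 * (p * q - r * (q * c - p * s))"
    using sc unfolding r_def by algebra
  have "displacement w (A * sin a) (A * sin (a + w)) =
      A\<^sup>2 * (w * (p\<^sup>2 + r\<^sup>2 - 2 * p * r * c) + (- (p\<^sup>2 + r\<^sup>2) * s * c + 2 * p * r * s)) / (2 * s\<^sup>2)"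
    using assms unfolding displacement_def disp_diag_def disp_mixed_def r
    by (simp add: s_def[symmetric] c_def[symmetric] p_def[symmetric] field_simps power2_eq_square)
  also have "\<dots> = A\<^sup>2 * (arc_area (a + w) - arc_area a)"
    using assms unfolding 1 2 arc_area_def r
    by (simp add: s_def[symmetric] p_def[symmetric] q_def[symmetric] field_simps power2_eq_square)
  finally show ?thesis .
qed

text \<open>Well defined for positive \<open>Y\<close> and nonnegative ends that are not both 0, by
  strict monotonicity and surjectivity of \<open>displacement\<close> in \<open>w\<close>. For two
  ends on the axis \<open>x = 0\<close> the displacement vanishes for every \<open>w\<close>, so
  that case is treated apart.\<close>

definition frequency :: "real \<Rightarrow> real \<Rightarrow> real \<Rightarrow> real"
  where "frequency x0 x1 Y = (THE w. 0 < w \<and> w < pi \<and> displacement w x0 x1 = Y)"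

lemma frequency_unique:
  assumes "0 \<le> x0" "0 \<le> x1" "0 < x0 \<or> 0 < x1" "0 < w" "w < pi"
  shows "frequency x0 x1 (displacement w x0 x1) = w"
  unfolding frequency_def
proof (rule the_equality)
  fix v assume v: "0 < v \<and> v < pi \<and> displacement v x0 x1 = displacement w x0 x1"
  show "v = w"
  proof (rule linorder_cases[of v w])
    assume "v < w"
    then show ?thesis
      using displacement_strict_mono[of v w x0 x1] assms v by simp
  next
    assume "w < v"
    then show ?thesis
      using displacement_strict_mono[of w v x0 x1] assms v by simp
  qed
qed (use assms in simp)

lemma frequency_props:
  assumes "0 \<le> x0" "0 \<le> x1" "0 < x0 \<or> 0 < x1" "0 < Y"
  shows "0 < frequency x0 x1 Y" "frequency x0 x1 Y < pi" "displacement (frequency x0 x1 Y) x0 x1 = Y"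
  using displacement_surj[OF assms] frequency_unique[OF assms(1-3)] by auto

text \<open>By monotonicity, comparing the frequency with a constant \<open>v\<close> amounts to
  comparing \<open>Y\<close> with \<open>displacement v\<close>. For fixed \<open>v\<close> this is
  a strict inequality between continuous functions of the end point, hence stable nearby.\<close>

lemma frequency_continuous_on:
  assumes "0 \<le> x0"
  shows "continuous_on {q. 0 \<le> fst q \<and> (0 < x0 \<or> 0 < fst q) \<and> 0 < snd q} (\<lambda>q. frequency x0 (fst q) (snd q))"
    (is "continuous_on ?R _")
  unfolding continuous_on_def
proof
  fix q assume q: "q \<in> ?R"
  define w where "w = frequency x0 (fst q) (snd q)"
  have w: "0 < w" "w < pi" "displacement w x0 (fst q) = snd q"
    using frequency_props[of x0 "fst q" "snd q"] q assms by (auto simp: w_def)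
  have c: "((\<lambda>q'. displacement v x0 (fst q')) \<longlongrightarrow> displacement v x0 (fst q)) (at q within ?R)" for v
    unfolding displacement_def by (intro tendsto_intros)
  have inR: "\<forall>\<^sub>F q' in at q within ?R. q' \<in> ?R"
    by (simp add: eventually_at_topological) blast
  show "((\<lambda>q. frequency x0 (fst q) (snd q)) \<longlongrightarrow> frequency x0 (fst q) (snd q)) (at q within ?R)"
    unfolding w_def[symmetric]
  proof (rule order_tendstoI)
    fix e assume e: "e < w"
    \<comment> \<open>The threshold is moved into \<open>(0, w)\<close>, where the comparison by
      monotonicity is available.\<close>
    define v where "v = max e (w / 2)"
    have v: "0 < v" "v < w" "e \<le> v"
      using e w by (auto simp: v_def)
    have "((\<lambda>q'. snd q' - displacement v x0 (fst q')) \<longlongrightarrow> snd q - displacement v x0 (fst q)) (at q within ?R)"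
      by (intro tendsto_intros c)
    moreover have "0 < snd q - displacement v x0 (fst q)"
      using displacement_strict_mono[of v w x0 "fst q"] v w q assms by auto
    ultimately have "\<forall>\<^sub>F q' in at q within ?R. 0 < snd q' - displacement v x0 (fst q')"
      by (rule order_tendstoD(1))
    then show "\<forall>\<^sub>F q' in at q within ?R. e < frequency x0 (fst q') (snd q')"
      using inR
    proof eventually_elim
      case (elim q')
      then have "v < frequency x0 (fst q') (snd q')"
        using displacement_less_iff[of v "frequency x0 (fst q') (snd q')" x0 "fst q'"]
          frequency_props[of x0 "fst q'" "snd q'"] v w assms by auto
      then show ?case
        using v by simp
    qed
  next
    fix e assume e: "w < e"
    define v where "v = min e ((w + pi) / 2)"
    have v: "w < v" "v < pi" "v \<le> e"
      using e w by (auto simp: v_def min_less_iff_disj)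
    have "((\<lambda>q'. displacement v x0 (fst q') - snd q') \<longlongrightarrow> displacement v x0 (fst q) - snd q) (at q within ?R)"
      by (intro tendsto_intros c)
    moreover have "0 < displacement v x0 (fst q) - snd q"
      using displacement_strict_mono[of w v x0 "fst q"] v w q assms by auto
    ultimately have "\<forall>\<^sub>F q' in at q within ?R. 0 < displacement v x0 (fst q') - snd q'"
      by (rule order_tendstoD(1))
    then show "\<forall>\<^sub>F q' in at q within ?R. frequency x0 (fst q') (snd q') < e"
      using inR
    proof eventually_elim
      case (elim q')
      then have "frequency x0 (fst q') (snd q') < v"
        using displacement_less_iff[of "frequency x0 (fst q') (snd q')" v x0 "fst q'"]
          frequency_props[of x0 "fst q'" "snd q'"] v w assms by auto
      then show ?case
        using v by simp
    qed
  qed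
qed

section \<open>Geodesics of the half-plane\<close>

definition half_plane :: "real \<Rightarrow> (real \<times> real) set"
  where "half_plane \<sigma> = {p. 0 \<le> \<sigma> * fst p}"

lemma half_plane_eq: "half_plane_pos = half_plane 1" "half_plane_neg = half_plane (- 1)"
  by (auto simp: half_plane_pos_def half_plane_neg_def half_plane_def)

lemma closed_half_plane: "closed (half_plane \<sigma>)"
  unfolding half_plane_def by (intro closed_Collect_le continuous_intros)

lemma sets_borel_of_grushin_submetric:
  assumes "closed S"
  shows "sets (restrict_space lborel S) = sets (borel_of_metric (submetric grushin_plane S))"
proof -
  have "sets (restrict_space lborel S) = (\<inter>) S ` sigma_sets UNIV {U. open U}"
    by (simp add: sets_restrict_space borel_def)
  also have "\<dots> = sigma_sets S ((\<inter>) S ` {U. open U})"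
  proof (rule sigma_sets_Int)
    have "S \<in> sets borel"
      using assms by simp
    then show "S \<in> sigma_sets UNIV {U. open U}"
      by (simp add: borel_def)
  qed simp
  also have "(\<inter>) S ` {U. open U} = {U. openin (top_of_set S) U}"
    by (auto simp: openin_open)
  also have "sigma_sets S {U. openin (top_of_set S) U} = sets (borel_of_metric (submetric grushin_plane S))"
    unfolding borel_of_metric_def mtopology_of_submetric mtopology_grushin_plane
    by (subst sets_measure_of) (auto dest: openin_imp_subset)
  finally show ?thesis .
qed

lemma grushin_dist_tendsto:
  assumes "(f \<longlongrightarrow> p) F"
  shows "((\<lambda>q. grushin_dist p (f q)) \<longlongrightarrow> 0) F"
proof (rule tendstoI)
  fix e :: real assume "0 < e"
  then obtain \<delta> where "0 < \<delta>" "\<forall>q. dist p q < \<delta> \<longrightarrow> grushin_dist p q < e"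
    using grushin_dist_less_if_dist_less by blast
  then show "\<forall>\<^sub>F q in F. dist (grushin_dist p (f q)) 0 < e"
    using tendstoD[OF assms, of \<delta>]
    by (auto elim!: eventually_mono simp: grushin_dist_nonneg dist_commute simp del: split_paired_All)
qed

text \<open>Geodesics are equicontinuous, so pointwise continuity in the end point gives uniform continuity.\<close>

lemma continuous_map_into_Geo:
  fixes \<phi> :: "real \<times> real \<Rightarrow> real \<Rightarrow> real \<times> real"
  assumes geo: "\<And>y. y \<in> R \<Longrightarrow> \<phi> y \<in> mspace (Geo (submetric grushin_plane S))"
    and cont: "\<And>t. t \<in> {0..1} \<Longrightarrow> continuous_on R (\<lambda>y. \<phi> y t)"
  shows "continuous_map (top_of_set R) (mtopology_of (Geo (submetric grushin_plane S))) \<phi>"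
proof -
  let ?G = "Geo (submetric grushin_plane S)"
  interpret G: Metric_space "mspace ?G" "mdist ?G"
    by (rule Metric_space_mspace_mdist)
  have geoD: "grushin_dist (\<phi> y t) (\<phi> y s) = \<bar>t - s\<bar> * grushin_dist (\<phi> y 0) (\<phi> y 1)"
    if "y \<in> R" "s \<in> {0..1}" "t \<in> {0..1}" for y s t
    using mem_mspace_GeoD(2)[OF geo[OF that(1)] that(2,3)] by simp
  have "openin (top_of_set R) {y \<in> R. \<phi> y \<in> U}" if U: "openin G.mtopology U" for U
    unfolding openin_euclidean_subtopology_iff
  proof (intro conjI ballI)
    fix q assume "q \<in> {y \<in> R. \<phi> y \<in> U}"
    then have q: "q \<in> R" "\<phi> q \<in> U" by auto
    obtain r where r: "0 < r" "G.mball (\<phi> q) r \<subseteq> U"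
      using U q(2) G.openin_mtopology by blast
    define D where "D = grushin_dist (\<phi> q 0) (\<phi> q 1)"
    have D: "0 \<le> D"
      by (simp add: D_def grushin_dist_nonneg)
    \<comment> \<open>The mesh \<open>1 / n\<close> is so fine that a geodesic of length at most
      \<open>D + 1\<close> moves by less than \<open>r / 8\<close> between neighbouring
      nodes.\<close>
    obtain n :: nat where n: "8 * (D + 1) / r < real n"
      using reals_Archimedean2 by blast
    have n0: "0 < real n"
      using n r D by (smt (verit) divide_nonneg_pos)
    have nr: "(D + 1) / real n < r / 8"
      using n n0 r by (simp add: field_simps)
    \<comment> \<open>The bound \<open>1 / 2\<close> at both ends keeps the length of the nearby
      geodesic below \<open>D + 1\<close>; the bound \<open>r / 8\<close> at the nodes makes the
      three errors add up to less than \<open>r / 2\<close>.\<close>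
    define e where "e = min (1 / 2) (r / 8)"
    have e: "0 < e" using r by (simp add: e_def)
    have "\<forall>\<^sub>F y in at q within R. \<forall>k\<in>{..n}. grushin_dist (\<phi> q (real k / real n)) (\<phi> y (real k / real n)) < e"
    proof (rule eventually_ball_finite)
      show "\<forall>k\<in>{..n}. \<forall>\<^sub>F y in at q within R. grushin_dist (\<phi> q (real k / real n)) (\<phi> y (real k / real n)) < e"
      proof
        fix k assume "k \<in> {..n}"
        then have "real k / real n \<in> {0..1}"
          using n0 by auto
        from cont[OF this] have "((\<lambda>y. \<phi> y (real k / real n)) \<longlongrightarrow> \<phi> q (real k / real n)) (at q within R)"
          using q(1) unfolding continuous_on_def by blast
        from order_tendstoD(2)[OF grushin_dist_tendsto[OF this] e]
        show "\<forall>\<^sub>F y in at q within R. grushin_dist (\<phi> q (real k / real n)) (\<phi> y (real k / real n)) < e" .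
      qed
    qed simp
    then obtain d where d: "0 < d" "\<And>y k. y \<in> R \<Longrightarrow> y \<noteq> q \<Longrightarrow> dist y q < d \<Longrightarrow> k \<le> n \<Longrightarrow>
        grushin_dist (\<phi> q (real k / real n)) (\<phi> y (real k / real n)) < e"
      unfolding eventually_at by fastforce
    have "\<phi> y \<in> U" if y: "y \<in> R" "dist y q < d" for y
    proof (cases "y = q")
      case False
      have near: "grushin_dist (\<phi> q (real k / real n)) (\<phi> y (real k / real n)) < e" if "k \<le> n" for k
        using d(2)[OF y(1) False y(2) that] .
      have D': "grushin_dist (\<phi> y 0) (\<phi> y 1) \<le> D + 1"
        using near[of 0] near[of n] n0 grushin_dist_triangle[of "\<phi> y 0" "\<phi> y 1" "\<phi> q 0"]
          grushin_dist_triangle[of "\<phi> q 0" "\<phi> y 1" "\<phi> q 1"] grushin_dist_sym[of "\<phi> y 0" "\<phi> q 0"]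
        by (simp add: e_def D_def)
      have "grushin_dist (\<phi> q s) (\<phi> y s) \<le> r / 2" if s: "s \<in> {0..1}" for s
      proof -
        define k where "k = nat \<lfloor>s * real n\<rfloor>"
        have k: "real k \<le> s * real n" "s * real n < real k + 1"
          using s n0 by (auto simp: k_def)
        have kn: "k \<le> n"
        proof -
          have "real k \<le> 1 * real n"
            using k(1) s n0 by (metis atLeastAtMost_iff less_imp_le mult_right_mono order_trans)
          then show ?thesis by simp
        qed
        define t where "t = real k / real n"
        have "s - t = (s * real n - real k) / real n"
          using n0 by (simp add: t_def field_simps)
        then have "0 \<le> s - t" "s - t \<le> 1 / real n"
          using k n0 by (simp_all add: divide_right_mono)
        then have t: "t \<in> {0..1}" "\<bar>s - t\<bar> \<le> 1 / real n"
          using kn n0 by (auto simp: t_def)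
        have "grushin_dist (\<phi> q s) (\<phi> q t) \<le> 1 / real n * (D + 1)"
          unfolding geoD[OF q(1) t(1) s] D_def[symmetric] using t(2) D by (intro mult_mono) auto
        moreover have "grushin_dist (\<phi> y t) (\<phi> y s) \<le> 1 / real n * (D + 1)"
          unfolding geoD[OF y(1) s t(1)] using t(2) D D'
          by (intro mult_mono) (auto simp: abs_minus_commute grushin_dist_nonneg)
        moreover have "grushin_dist (\<phi> q t) (\<phi> y t) < r / 8"
          using near[OF kn] by (simp add: t_def e_def)
        moreover have "1 / real n * (D + 1) < r / 8"
          using nr by simp
        ultimately show ?thesis
          using grushin_dist_triangle[of "\<phi> q s" "\<phi> y s" "\<phi> q t"]
            grushin_dist_triangle[of "\<phi> q t" "\<phi> y s" "\<phi> y t"] r(1) by linarith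
      qed
      then have "mdist ?G (\<phi> q) (\<phi> y) \<le> r / 2"
        unfolding mdist_Geo_le_iff[OF geo[OF q(1)] geo[OF y(1)]] by simp
      then have "\<phi> y \<in> G.mball (\<phi> q) r"
        using r(1) geo q(1) y(1) by simp
      then show ?thesis
        using r(2) by blast
    qed (use q in simp)
    with d(1) show "\<exists>d>0. \<forall>y\<in>R. dist y q < d \<longrightarrow> y \<in> {y \<in> R. \<phi> y \<in> U}"
      by blast
  qed simp
  then show ?thesis
    unfolding mtopology_of_def continuous_map_def using geo by (auto simp: Pi_iff)
qed

text \<open>On each of finitely many Borel pieces the preimage of an open set is relatively open,
  hence Borel, and so is the union. Continuity across the pieces is not claimed.\<close>

lemma measurable_into_Geo:
  fixes \<phi> :: "real \<times> real \<Rightarrow> real \<Rightarrow> real \<times> real"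
  assumes S: "closed S"
    and geo: "\<And>y. y \<in> S \<Longrightarrow> \<phi> y \<in> mspace (Geo (submetric grushin_plane S))"
    and fin: "finite \<R>" "S = \<Union>\<R>" "\<And>R. R \<in> \<R> \<Longrightarrow> R \<in> sets borel"
    and cont: "\<And>R t. R \<in> \<R> \<Longrightarrow> t \<in> {0..1} \<Longrightarrow> continuous_on R (\<lambda>y. \<phi> y t)"
  shows "\<phi> \<in> restrict_space lborel S \<rightarrow>\<^sub>M borel_of_metric (Geo (submetric grushin_plane S))"
proof -
  let ?G = "Geo (submetric grushin_plane S)"
  show ?thesis
    unfolding borel_of_metric_def
  proof (rule measurable_measure_of)
    show "{U. openin (mtopology_of ?G) U} \<subseteq> Pow (mspace ?G)"
      using openin_subset by fastforce
    show "\<phi> \<in> space (restrict_space lborel S) \<rightarrow> mspace ?G"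
      using geo by (simp add: space_restrict_space)
    fix U assume U: "U \<in> {U. openin (mtopology_of ?G) U}"
    have "{y \<in> R. \<phi> y \<in> U} \<in> sets borel" if R: "R \<in> \<R>" for R
    proof -
      have "continuous_map (top_of_set R) (mtopology_of ?G) \<phi>"
        by (rule continuous_map_into_Geo) (use geo cont R fin(2) in auto)
      then have "openin (top_of_set R) {y \<in> R. \<phi> y \<in> U}"
        using openin_continuous_map_preimage[of "top_of_set R" "mtopology_of ?G" \<phi> U] U by simp
      then obtain V where "open V" "{y \<in> R. \<phi> y \<in> U} = R \<inter> V"
        unfolding openin_open by blast
      then show ?thesis
        using fin(3)[OF R] by simp
    qed
    then have "(\<Union>R\<in>\<R>. {y \<in> R. \<phi> y \<in> U}) \<in> sets borel"
      using fin(1) by blast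
    moreover have "\<phi> -` U \<inter> space (restrict_space lborel S) = (\<Union>R\<in>\<R>. {y \<in> R. \<phi> y \<in> U})"
      unfolding space_restrict_space by (auto simp: fin(2))
    ultimately show "\<phi> -` U \<inter> space (restrict_space lborel S) \<in> sets (restrict_space lborel S)"
      using S by (auto simp: sets_restrict_space_iff space_restrict_space)
  qed
qed

text \<open>The geodesic of the right half-plane from \<open>(x0, y0)\<close> to \<open>q\<close>, for \<open>x0 \<ge> 0\<close>.\<close>

definition geodesic :: "real \<times> real \<Rightarrow> real \<times> real \<Rightarrow> real \<Rightarrow> real \<times> real"
  where "geodesic p q t =
    (let x0 = fst p; y0 = snd p; x1 = fst q; Y = snd q - snd p; w = frequency x0 x1 \<bar>Y\<bar> in
      if Y = 0 then (x0 + t * (x1 - x0), y0)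
      else if x0 = 0 \<and> x1 = 0 then
        (sqrt (2 * \<bar>Y\<bar> / pi) * sin (t * pi), y0 + 2 * Y / pi * arc_area (t * pi))
      else (chord w x0 x1 t, y0 + sgn Y * displacement (t * w) x0 (chord w x0 x1 t)))"

text \<open>Both nonhorizontal branches of \<open>geodesic\<close> are sine arcs. Two points of the
  axis \<open>x = 0\<close> are joined by a full half-wave, with \<open>a = 0\<close>,
  \<open>w = pi\<close> and squared amplitude \<open>2 * \<bar>Y\<bar> / pi\<close>; otherwise the
  arc comes from \<open>polar_form\<close>.\<close>

lemma geodesic_arc_ex:
  assumes "p \<in> half_plane 1" "q \<in> half_plane 1" "snd p \<noteq> snd q"
  obtains A a w where "0 < A" "0 \<le> a" "0 < w" "a + w \<le> pi"
    "\<And>t. t \<in> {0..1} \<Longrightarrow> geodesic p q t =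
      (A * sin (a + t * w), snd p + sgn (snd q - snd p) * (A\<^sup>2 * (arc_area (a + t * w) - arc_area a)))"
    "geodesic p q 0 = p" "geodesic p q 1 = q"
proof -
  obtain x0 y0 x1 y1 where pq: "p = (x0, y0)" "q = (x1, y1)"
    by fastforce
  define Y where "Y = y1 - y0"
  have x: "0 \<le> x0" "0 \<le> x1" and Y: "Y \<noteq> 0" "0 < \<bar>Y\<bar>" "sgn Y * \<bar>Y\<bar> = Y"
    using assms by (auto simp: half_plane_def pq Y_def sgn_mult_abs)
  show thesis
  proof (cases "x0 = 0 \<and> x1 = 0")
    case True
    define A where "A = sqrt (2 * \<bar>Y\<bar> / pi)"
    have A: "0 < A" "A\<^sup>2 = 2 * \<bar>Y\<bar> / pi"
      using Y by (simp_all add: A_def)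
    have g: "geodesic p q t = (A * sin (t * pi), y0 + sgn Y * (A\<^sup>2 * arc_area (t * pi)))" for t
    proof -
      have "2 * Y / pi * arc_area (t * pi) = sgn Y * (A\<^sup>2 * arc_area (t * pi))"
        unfolding A(2) using Y(3) by (cases "Y = 0") (simp_all add: abs_sgn)
      then show ?thesis
        using Y True by (simp add: geodesic_def pq Let_def Y_def[symmetric] A_def)
    qed
    show thesis
    proof (rule that[OF A(1), of 0 pi])
      show "geodesic p q 0 = p"
        by (simp add: g) (simp add: pq True)
      have "sgn Y * (A\<^sup>2 * (pi / 2)) = Y"
        unfolding A(2) using Y(3) by simp
      then show "geodesic p q 1 = q"
        by (simp add: g) (simp add: pq True Y_def)
    qed (auto simp: g[unfolded pq] pq Y_def)
  next
    case False
    then have x': "0 < x0 \<or> 0 < x1"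
      using x by auto
    define w where "w = frequency x0 x1 \<bar>Y\<bar>"
    have w: "0 < w" "w < pi" "displacement w x0 x1 = \<bar>Y\<bar>"
      using frequency_props[OF x x' Y(2)] by (simp_all add: w_def)
    obtain A a where A: "0 < A" "0 \<le> a" "a + w \<le> pi" "x0 = A * sin a" "x1 = A * sin (a + w)"
      using polar_form[OF x x' w(1,2)] .
    have sw: "sin w \<noteq> 0"
      using sin_gt_zero[OF w(1,2)] by simp
    have g: "geodesic p q t = (chord w x0 x1 t, y0 + sgn Y * displacement (t * w) x0 (chord w x0 x1 t))" for t
      using Y False by (auto simp: geodesic_def pq Let_def Y_def[symmetric] w_def)
    have c: "chord w x0 x1 t = A * sin (a + t * w)" for t
      using chord_polar[OF sw] A by simp
    have "displacement (t * w) x0 (chord w x0 x1 t) = A\<^sup>2 * (arc_area (a + t * w) - arc_area a)"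
      if "t \<in> {0..1}" for t
    proof (cases "t = 0")
      case False
      then have tw: "0 < t * w"
        using that w by simp
      have "t * w \<le> 1 * w"
        using that w by (intro mult_right_mono) auto
      then have "t * w < pi"
        using w by linarith
      then have "sin (t * w) \<noteq> 0"
        using sin_gt_zero[OF tw] by simp
      from displacement_polar[OF this, of A a] show ?thesis
        by (simp only: c A(4)[symmetric])
    qed simp
    then have g': "geodesic p q t = (A * sin (a + t * w), y0 + sgn Y * (A\<^sup>2 * (arc_area (a + t * w) - arc_area a)))"
      if "t \<in> {0..1}" for t
      using that by (simp add: g c)
    show thesis
    proof (rule that[OF A(1,2) w(1) A(3)])
      show "geodesic p q 0 = p"
        using g[of 0] sw by (simp add: pq)
      show "geodesic p q 1 = q"
        using g[of 1] sw w Y(3) by (simp add: pq Y_def)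
    qed (use g'[unfolded pq] in \<open>simp add: pq Y_def\<close>)
  qed
qed

text \<open>A sub-arc of a sine arc is a sine arc of the same amplitude with angles still in
  \<open>[0, pi]\<close>, so \<open>grushin_dist_arc\<close> gives the distance between any two of
  its points.\<close>

lemma geodesic_props:
  assumes p: "p \<in> half_plane 1" and q: "q \<in> half_plane 1"
  shows "geodesic p q 0 = p" "geodesic p q 1 = q"
    and "\<And>t. t \<in> {0..1} \<Longrightarrow> geodesic p q t \<in> half_plane 1"
    and "\<And>s t. s \<in> {0..1} \<Longrightarrow> t \<in> {0..1} \<Longrightarrow>
      grushin_dist (geodesic p q t) (geodesic p q s) = \<bar>t - s\<bar> * grushin_dist p q"
proof -
  have *: "geodesic p q 0 = p \<and> geodesic p q 1 = q \<and>
    (\<forall>t\<in>{0..1}. geodesic p q t \<in> half_plane 1) \<and>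
    (\<exists>D. \<forall>s\<in>{0..1}. \<forall>t\<in>{0..1}. s \<le> t \<longrightarrow> grushin_dist (geodesic p q s) (geodesic p q t) = (t - s) * D)"
  proof (cases "snd p = snd q")
    case True
    obtain x0 y0 x1 where pq: "p = (x0, y0)" "q = (x1, y0)"
      using True by (metis prod.collapse)
    have x: "0 \<le> x0" "0 \<le> x1"
      using p q by (auto simp: half_plane_def pq)
    have g: "geodesic p q t = (x0 + t * (x1 - x0), y0)" for t
      by (simp add: geodesic_def pq)
    have "0 \<le> x0 + t * (x1 - x0)" if "t \<in> {0..1}" for t
    proof -
      have "0 \<le> (1 - t) * x0 + t * x1"
        using x that by (intro add_nonneg_nonneg mult_nonneg_nonneg) auto
      then show ?thesis by (simp add: algebra_simps)
    qed
    moreover have "grushin_dist (geodesic p q s) (geodesic p q t) = (t - s) * \<bar>x1 - x0\<bar>" if "s \<le> t" for s t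
    proof -
      have "x0 + t * (x1 - x0) - (x0 + s * (x1 - x0)) = (t - s) * (x1 - x0)"
        by (simp add: algebra_simps)
      then show ?thesis
        using that by (simp add: g grushin_dist_horizontal abs_mult)
    qed
    ultimately show ?thesis
      by (auto simp: g[unfolded pq] half_plane_def pq)
  next
    case False
    obtain A a w where A: "0 < A" "0 \<le> a" "0 < w" "a + w \<le> pi"
      and g: "\<And>t. t \<in> {0..1} \<Longrightarrow> geodesic p q t =
        (A * sin (a + t * w), snd p + sgn (snd q - snd p) * (A\<^sup>2 * (arc_area (a + t * w) - arc_area a)))"
      and e: "geodesic p q 0 = p" "geodesic p q 1 = q"
      by (rule geodesic_arc_ex[OF p q False]) (rule that)
    have th: "0 \<le> a + t * w" "a + t * w \<le> pi" if "t \<in> {0..1}" for t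
    proof -
      have "t * w \<le> w" "0 \<le> t * w"
        using that A by (auto intro: mult_left_le_one_le)
      then show "0 \<le> a + t * w" "a + t * w \<le> pi"
        using A by linarith+
    qed
    have "0 \<le> A * sin (a + t * w)" if "t \<in> {0..1}" for t
      using th[OF that] A by (intro mult_nonneg_nonneg sin_ge_zero) auto
    moreover have "grushin_dist (geodesic p q s) (geodesic p q t) = (t - s) * (A * w)"
      if st: "s \<in> {0..1}" "t \<in> {0..1}" "s \<le> t" for s t
    proof (cases "s = t")
      case True
      then show ?thesis by (simp add: grushin_dist_refl)
    next
      case False
      with st have "s < t" by simp
      have sg: "\<bar>sgn (snd q - snd p)\<bar> = 1"
        using \<open>snd p \<noteq> snd q\<close> by (simp add: abs_sgn_eq)
      have lt: "a + s * w < a + t * w"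
        using \<open>s < t\<close> A by simp
      have "(snd p + sgn (snd q - snd p) * (A\<^sup>2 * (arc_area (a + t * w) - arc_area a)))
          - (snd p + sgn (snd q - snd p) * (A\<^sup>2 * (arc_area (a + s * w) - arc_area a)))
          = sgn (snd q - snd p) * (A\<^sup>2 * (arc_area (a + t * w) - arc_area (a + s * w)))"
        by (simp add: algebra_simps)
      then have "\<bar>(snd p + sgn (snd q - snd p) * (A\<^sup>2 * (arc_area (a + t * w) - arc_area a)))
          - (snd p + sgn (snd q - snd p) * (A\<^sup>2 * (arc_area (a + s * w) - arc_area a)))\<bar>
          = A\<^sup>2 * (arc_area (a + t * w) - arc_area (a + s * w))"
        using arc_area_mono[OF less_imp_le[OF lt]] \<open>snd p \<noteq> snd q\<close> by (simp add: abs_mult sg)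
      from grushin_dist_arc[OF th(1)[OF st(1)] lt th(2)[OF st(2)] less_imp_le[OF A(1)] this]
      show ?thesis
        unfolding g[OF st(1)] g[OF st(2)] by (simp add: algebra_simps)
    qed
    ultimately show ?thesis
      using e g by (auto simp: half_plane_def)
  qed
  then show e: "geodesic p q 0 = p" "geodesic p q 1 = q"
    and "\<And>t. t \<in> {0..1} \<Longrightarrow> geodesic p q t \<in> half_plane 1"
    by blast+
  obtain D where D: "\<And>s t. s \<in> {0..1} \<Longrightarrow> t \<in> {0..1} \<Longrightarrow> s \<le> t \<Longrightarrow>
      grushin_dist (geodesic p q s) (geodesic p q t) = (t - s) * D"
    using * by blast
  have "grushin_dist p q = D"
    using D[of 0 1] e by simp
  then show "grushin_dist (geodesic p q t) (geodesic p q s) = \<bar>t - s\<bar> * grushin_dist p q"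
    if "s \<in> {0..1}" "t \<in> {0..1}" for s t
    using D[of s t] D[of t s] that grushin_dist_sym[of "geodesic p q t" "geodesic p q s"]
    by (cases "s \<le> t") auto
qed

text \<open>The branches in the definition of \<open>geodesic\<close>, the last one split further by
  the sign of the height difference so that \<open>sgn\<close> is constant on each piece.\<close>

definition geodesic_pieces :: "real \<times> real \<Rightarrow> (real \<times> real) set set"
  where "geodesic_pieces p = (let H = half_plane 1; Z = {q. fst p = 0 \<and> fst q = 0} in
    {H \<inter> {q. snd q = snd p}, H \<inter> {q. snd q \<noteq> snd p} \<inter> Z,
     H \<inter> {q. snd p < snd q} - Z, H \<inter> {q. snd q < snd p} - Z})"

lemma geodesic_pieces:
  shows "finite (geodesic_pieces p)" "\<Union> (geodesic_pieces p) = half_plane 1"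
    and "R \<in> geodesic_pieces p \<Longrightarrow> R \<in> sets borel"
proof -
  show "finite (geodesic_pieces p)" "\<Union> (geodesic_pieces p) = half_plane 1"
    by (auto simp: geodesic_pieces_def Let_def)
  have m0: "half_plane 1 \<in> sets borel"
    using closed_half_plane by (rule borel_closed)
  have m1: "{q :: real \<times> real. snd q = c} \<in> sets borel" for c
    by (intro borel_closed closed_Collect_eq continuous_intros)
  have m2: "{q :: real \<times> real. c < snd q} \<in> sets borel" "{q :: real \<times> real. snd q < c} \<in> sets borel" for c
    by (intro borel_open open_Collect_less continuous_intros)+
  have "{q :: real \<times> real. fst q = 0} \<in> sets borel"
    by (intro borel_closed closed_Collect_eq continuous_intros)
  then have m3: "{q :: real \<times> real. d = 0 \<and> fst q = 0} \<in> sets borel" for d :: real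
    by (cases "d = 0") auto
  have m4: "{q :: real \<times> real. snd q \<noteq> c} \<in> sets borel" for c
    by (intro borel_open open_Collect_neq continuous_intros)
  show "R \<in> geodesic_pieces p \<Longrightarrow> R \<in> sets borel"
    unfolding geodesic_pieces_def Let_def
    by (elim insertE emptyE) (simp_all only: sets.Int sets.Diff m0 m1 m2 m3 m4)
qed

lemma continuous_on_geodesic:
  assumes p: "p \<in> half_plane 1" and R: "R \<in> geodesic_pieces p" and t: "t \<in> {0..1}"
  shows "continuous_on R (\<lambda>q. geodesic p q t)"
proof -
  obtain x0 y0 where p': "p = (x0, y0)"
    by fastforce
  have x0: "0 \<le> x0"
    using p by (simp add: half_plane_def p')
  have main: "continuous_on S (\<lambda>q. geodesic p q t)"
    if s: "s = 1 \<or> s = - 1" and S: "S \<subseteq> {q. 0 \<le> fst q \<and> (0 < x0 \<or> 0 < fst q) \<and> 0 < s * (snd q - y0)}" for s :: real and S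
  proof -
    define w where "w q = frequency x0 (fst q) (s * (snd q - y0))" for q :: "real \<times> real"
    have wp: "0 < w q \<and> w q < pi" if "q \<in> S" for q
      using frequency_props[OF x0, of "fst q" "s * (snd q - y0)"] that S by (auto simp: w_def)
    have w: "continuous_on S w"
    proof -
      have "continuous_on S (\<lambda>q. (fst q, s * (snd q - y0)))"
        by (intro continuous_intros)
      moreover have "(\<lambda>q. (fst q, s * (snd q - y0))) ` S
          \<subseteq> {q. 0 \<le> fst q \<and> (0 < x0 \<or> 0 < fst q) \<and> 0 < snd q}"
        using S by auto
      ultimately show ?thesis
        using continuous_on_compose2[OF frequency_continuous_on[OF x0]] unfolding w_def by fastforce
    qed
    have g: "geodesic p q t = (chord (w q) x0 (fst q) t,
        y0 + s * displacement (t * w q) x0 (chord (w q) x0 (fst q) t))" if "q \<in> S" for q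
    proof -
      have "\<bar>snd q - y0\<bar> = s * (snd q - y0)" "sgn (snd q - y0) = s" "snd q - y0 \<noteq> 0" "\<not> (x0 = 0 \<and> fst q = 0)"
        using that S s by auto
      then show ?thesis
        by (auto simp: geodesic_def p' w_def Let_def)
    qed
    have ch: "continuous_on S (\<lambda>q. chord (w q) x0 (fst q) t)"
      unfolding chord_def using wp sin_gt_zero by (intro continuous_intros w) force
    have "continuous_on S (\<lambda>q. displacement (t * w q) x0 (chord (w q) x0 (fst q) t))"
    \<comment> \<open>At \<open>t = 0\<close> the displacement is constantly 0 by the convention
      \<open>a / 0 = 0\<close>; for other times \<open>t * w q\<close> stays in
      \<open>(0, pi)\<close> and no denominator vanishes.\<close>
    proof (cases "t = 0")
      case False
      have "sin (t * w q) \<noteq> 0" if "q \<in> S" for q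
      proof -
        have "t * w q \<le> 1 * w q"
          using wp[OF that] t by (intro mult_right_mono) auto
        then have "t * w q < pi"
          using wp[OF that] by linarith
        then have "0 < sin (t * w q)"
          using wp[OF that] t False by (intro sin_gt_zero mult_pos_pos) auto
        then show ?thesis by simp
      qed
      then show ?thesis
        unfolding displacement_def disp_diag_def disp_mixed_def
        by (intro continuous_intros w ch) auto
    qed simp
    with ch have "continuous_on S (\<lambda>q. (chord (w q) x0 (fst q) t,
        y0 + s * displacement (t * w q) x0 (chord (w q) x0 (fst q) t)))"
      by (intro continuous_intros)
    then show ?thesis
      by (rule continuous_on_eq) (simp add: g)
  qed
  consider "R = half_plane 1 \<inter> {q. snd q = y0}"
    | "R = half_plane 1 \<inter> {q. snd q \<noteq> y0} \<inter> {q. x0 = 0 \<and> fst q = 0}"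
    | "R = half_plane 1 \<inter> {q. y0 < snd q} - {q. x0 = 0 \<and> fst q = 0}"
    | "R = half_plane 1 \<inter> {q. snd q < y0} - {q. x0 = 0 \<and> fst q = 0}"
    using R by (auto simp: geodesic_pieces_def Let_def p')
  then show ?thesis
  proof cases
    case 1
    have "continuous_on R (\<lambda>q. (x0 + t * (fst q - x0), y0))"
      by (intro continuous_intros)
    then show ?thesis
      by (rule continuous_on_eq) (auto simp: 1 geodesic_def p')
  next
    case 2
    have "continuous_on R (\<lambda>q. (sqrt (2 * \<bar>snd q - y0\<bar> / pi) * sin (t * pi),
        y0 + 2 * (snd q - y0) / pi * arc_area (t * pi)))"
      by (intro continuous_intros) auto
    then show ?thesis
      by (rule continuous_on_eq) (auto simp: 2 geodesic_def p')
  next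
    case 3
    show ?thesis
      by (rule main[of 1]) (use x0 in \<open>auto simp: 3 half_plane_def\<close>)
  next
    case 4
    show ?thesis
      by (rule main[of "- 1"]) (use x0 in \<open>auto simp: 4 half_plane_def\<close>)
  qed
qed

section \<open>Contraction of volume\<close>

text \<open>Up to the factor \<open>A\<^sup>2 / sin w\<close>, the derivative of the height in the
  frequency for fixed abscissas, hence the Jacobian of passing from \<open>(x, w)\<close> to
  \<open>(x, Y)\<close>.\<close>

definition arc_jacobian :: "real \<Rightarrow> real \<Rightarrow> real"
  where "arc_jacobian a w = sin w - w * cos a * cos (a + w)"

lemma displacement_deriv_polar:
  assumes "sin w \<noteq> 0"
  shows "displacement_deriv w (A * sin a) (A * sin (a + w)) = A\<^sup>2 * arc_jacobian a w / sin w"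
proof -
  define s c p q where "s = sin w" and "c = cos w" and "p = sin a" and "q = cos a"
  have sc: "c\<^sup>2 = 1 - s\<^sup>2" "q\<^sup>2 = 1 - p\<^sup>2"
    using sin_cos_squared_add2[of w] sin_cos_squared_add2[of a] by (simp_all add: s_def c_def p_def q_def algebra_simps)
  define r where "r = p * c + q * s"
  have r: "sin (a + w) = r" "cos (a + w) = q * c - p * s"
    by (simp_all add: sin_add cos_add s_def c_def p_def q_def r_def)
  have "((A * p)\<^sup>2 + (A * r)\<^sup>2) * (s - w * c) + A * p * (A * r) * (w * (1 + c\<^sup>2) - 2 * s * c) =
      A\<^sup>2 * (s - w * q * (q * c - p * s)) * s\<^sup>2"
    using sc unfolding r_def by algebra
  then have "displacement_deriv w (A * p) (A * r) = A\<^sup>2 * (s - w * q * (q * c - p * s)) * s\<^sup>2 / s ^ 3"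
    by (simp add: displacement_deriv_def s_def c_def)
  also have "\<dots> = A\<^sup>2 * (s - w * q * (q * c - p * s)) / s"
    using assms by (simp add: s_def[symmetric] power2_eq_square power3_eq_cube)
  finally show ?thesis
    unfolding arc_jacobian_def r by (simp add: s_def p_def q_def)
qed

lemma arc_jacobian_deriv:
  "(arc_jacobian a has_real_derivative sin (a + w) * (sin a + w * cos a)) (at w)"
proof -
  have "(arc_jacobian a has_real_derivative cos w - (cos a * cos (a + w) - w * cos a * sin (a + w))) (at w)"
    unfolding arc_jacobian_def by (auto intro!: derivative_eq_intros)
  moreover have "cos w = cos (a + w) * cos a + sin (a + w) * sin a"
    using cos_diff[of "a + w" a] by simp
  ultimately show ?thesis
    by (simp add: algebra_simps)
qed

text \<open>Here the half-plane is used: its geodesics keep both angles in \<open>[0,\<pi>]\<close>.\<close>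

lemma arc_jacobian_growth:
  assumes "0 \<le> a" "0 < w" "a + w \<le> pi"
  shows "w * (sin (a + w) * (sin a + w * cos a)) \<le> 3 * arc_jacobian a w"
proof -
  \<comment> \<open>The case \<open>a = 0\<close> of the claim: the function vanishes at 0 and its
    derivative is \<open>v * (sin v - v * cos v)\<close>.\<close>
  have "3 * sin 0 - 3 * 0 * cos 0 - 0\<^sup>2 * sin 0 \<le> 3 * sin w - 3 * w * cos w - w\<^sup>2 * sin w"
  proof (rule DERIV_nonneg_imp_nondecreasing[where f = "\<lambda>w. 3 * sin w - 3 * w * cos w - w\<^sup>2 * sin w"])
    fix v assume v: "0 \<le> v" "v \<le> w"
    have "((\<lambda>w. 3 * sin w - 3 * w * cos w - w\<^sup>2 * sin w) has_real_derivative v * (sin v - v * cos v)) (at v)"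
      by (auto intro!: derivative_eq_intros simp: algebra_simps power2_eq_square)
    moreover have "v * cos v \<le> sin v"
      using sin_minus_id_cos_pos[of v] v assms by (cases "v = 0") auto
    ultimately show "\<exists>y. ((\<lambda>w. 3 * sin w - 3 * w * cos w - w\<^sup>2 * sin w) has_real_derivative y) (at v) \<and> 0 \<le> y"
      using v by (intro exI[of _ "v * (sin v - v * cos v)"]) auto
  qed (use assms in simp)
  then have 0: "0 \<le> 3 * sin w - 3 * w * cos w - w\<^sup>2 * sin w"
    by simp
  have sa: "0 \<le> sin a" and st: "0 \<le> sin (a + w)"
    using assms by (auto intro!: sin_ge_zero)
  \<comment> \<open>The comparison \<open>\<theta> * cos \<theta> \<le> sin \<theta>\<close> at
    \<open>\<theta> = a + w\<close>, which is at least \<open>w / 2\<close>.\<close>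
  have 1: "w / 2 * cos (a + w) \<le> sin (a + w)"
  proof (cases "cos (a + w) \<le> 0")
    case True
    then have "w / 2 * cos (a + w) \<le> 0"
      using assms by (simp add: mult_nonneg_nonpos)
    then show ?thesis
      using st by simp
  next
    case False
    then have "w / 2 * cos (a + w) \<le> (a + w) * cos (a + w)"
      using assms by (intro mult_right_mono) auto
    also have "\<dots> \<le> sin (a + w)"
      using sin_minus_id_cos_pos[of "a + w"] assms by simp
    finally show ?thesis .
  qed
  \<comment> \<open>The general defect is the one for \<open>a = 0\<close> plus a multiple of
    \<open>sin a\<close>, and both parts are nonnegative.\<close>
  have "3 * arc_jacobian a w - w * (sin (a + w) * (sin a + w * cos a)) =
      (3 * sin w - 3 * w * cos w - w\<^sup>2 * sin w) + 2 * w * sin a * (sin (a + w) - w / 2 * cos (a + w))"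
    using sin_cos_squared_add[of a] unfolding arc_jacobian_def sin_add cos_add by algebra
  moreover have "0 \<le> 2 * w * sin a * (sin (a + w) - w / 2 * cos (a + w))"
    using assms sa 1 by (intro mult_nonneg_nonneg) auto
  ultimately show ?thesis
    using 0 by linarith
qed

text \<open>Writing \<open>J\<close> for the Jacobian, \<open>arc_jacobian_growth\<close> reads
  \<open>w * J' \<le> 3 * J\<close>, which is the statement that \<open>J / w ^ 3\<close> has
  nonpositive derivative.\<close>

lemma arc_jacobian_cube:
  assumes "0 \<le> a" "0 < w" "a + w \<le> pi" "0 < t" "t < 1"
  shows "t ^ 3 * arc_jacobian a w \<le> arc_jacobian a (t * w)"
proof -
  have tw: "0 < t * w" "t * w < w"
    using assms by auto
  have "arc_jacobian a w / w ^ 3 \<le> arc_jacobian a (t * w) / (t * w) ^ 3"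
  proof (rule DERIV_nonpos_imp_nonincreasing[where f = "\<lambda>v. arc_jacobian a v / v ^ 3"])
    fix v assume v: "t * w \<le> v" "v \<le> w"
    then have v0: "0 < v"
      using tw by linarith
    have "((\<lambda>v. arc_jacobian a v / v ^ 3) has_real_derivative
        (sin (a + v) * (sin a + v * cos a) * v ^ 3 - arc_jacobian a v * (3 * v ^ 2)) / (v ^ 3 * v ^ 3)) (at v)"
      using v0 by (auto intro!: derivative_eq_intros arc_jacobian_deriv)
    moreover have "(sin (a + v) * (sin a + v * cos a) * v ^ 3 - arc_jacobian a v * (3 * v ^ 2)) =
        v ^ 2 * (v * (sin (a + v) * (sin a + v * cos a)) - 3 * arc_jacobian a v)"
      by (simp add: algebra_simps power2_eq_square power3_eq_cube)
    moreover have "v ^ 2 * (v * (sin (a + v) * (sin a + v * cos a)) - 3 * arc_jacobian a v) / (v ^ 3 * v ^ 3) \<le> 0"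
      using arc_jacobian_growth[of a v] assms v v0
      by (intro divide_nonpos_pos mult_nonneg_nonpos) auto
    ultimately show "\<exists>y. ((\<lambda>v. arc_jacobian a v / v ^ 3) has_real_derivative y) (at v) \<and> y \<le> 0"
      by auto
  qed (rule less_imp_le[OF tw(2)])
  then have "arc_jacobian a w / w ^ 3 * (t * w) ^ 3 \<le> arc_jacobian a (t * w)"
    using tw by (simp add: pos_le_divide_eq)
  then show ?thesis
    using assms by (simp add: power_mult_distrib mult.commute)
qed

text \<open>The pointwise volume inequality. On the right, \<open>t\<close> is the Jacobian of
  scaling the frequency, \<open>sin (t * w) / sin w\<close> is the slope of \<open>chord\<close> in
  the end abscissa, and the last factor converts frequency back to height. In polar form
  \<open>sin (t * w)\<close> cancels, and \<open>arc_jacobian_cube\<close> supplies the remaining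
  \<open>t ^ 3\<close>.\<close>

lemma displacement_deriv_contraction:
  assumes x: "0 \<le> x0" "0 < x" and w: "0 < w" "w < pi" and t: "0 < t" "t < 1"
  shows "t ^ 4 * displacement_deriv w x0 x
    \<le> t * (sin (t * w) / sin w) * displacement_deriv (t * w) x0 (chord w x0 x t)"
proof -
  obtain A a where A: "0 < A" "0 \<le> a" "a + w \<le> pi" "x0 = A * sin a" "x = A * sin (a + w)"
    using polar_form[of x0 x w] x w by auto
  have tw: "0 < t * w" "t * w < w"
    using w t by auto
  have s: "0 < sin w" "0 < sin (t * w)"
    using w tw by (auto intro!: sin_gt_zero)
  have "t ^ 4 * (A\<^sup>2 * arc_jacobian a w / sin w) = t * (A\<^sup>2 * (t ^ 3 * arc_jacobian a w)) / sin w"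
    by (simp add: power4_eq_xxxx power3_eq_cube)
  also have "\<dots> \<le> t * (A\<^sup>2 * arc_jacobian a (t * w)) / sin w"
    using arc_jacobian_cube[OF A(2) w(1) A(3) t] t s
    by (intro divide_right_mono mult_left_mono) auto
  also have "\<dots> = t * (sin (t * w) / sin w) * (A\<^sup>2 * arc_jacobian a (t * w) / sin (t * w))"
    using s by simp
  finally show ?thesis
    using s chord_polar[of w A a t] displacement_deriv_polar[of w A a] displacement_deriv_polar[of "t * w" A a]
    unfolding A(4,5) by simp
qed

section \<open>Change of variables from height to frequency\<close>

text \<open>The derivative is only controlled inside \<open>(0, b)\<close>, so the substitution is
  made on an exhausting sequence of compact intervals, and both sides pass to the limit by monotone
  convergence.\<close>

lemma nn_integral_substitution_halfline:
  fixes F g g' :: "real \<Rightarrow> real"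
  assumes meas: "F \<in> borel_measurable borel" "g \<in> borel_measurable borel" "g' \<in> borel_measurable borel"
    and der: "\<And>w. 0 < w \<Longrightarrow> w < b \<Longrightarrow> (g has_real_derivative g' w) (at w)"
    and cont: "continuous_on {0<..<b} g'"
    and pos: "\<And>w. 0 < w \<Longrightarrow> w < b \<Longrightarrow> 0 < g' w"
    and lim: "(g \<longlongrightarrow> 0) (at_right 0)" "filterlim g at_top (at_left b)"
    and b: "0 < b"
  shows "(\<integral>\<^sup>+Y. ennreal (F Y) * indicator {0<..} Y \<partial>lborel)
    = (\<integral>\<^sup>+w. ennreal (F (g w) * g' w) * indicator {0<..<b} w \<partial>lborel)"
proof -
  \<comment> \<open>The shift by 3 puts \<open>l n\<close> below \<open>b / 2\<close> for every
    \<open>n\<close>, so already the first interval is nondegenerate.\<close>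
  define l u where "l n = b / real (n + 3)" and "u n = b - b / real (n + 3)" for n
  have l_pos: "0 < l n" "u n = b - l n" for n
    using b by (simp_all add: l_def u_def)
  have l_half: "l n < b / 2" for n
  proof -
    have "l n \<le> b / 3"
      unfolding l_def using b by (intro divide_left_mono) auto
    then show ?thesis
      using b by linarith
  qed
  have lu: "0 < l n" "l n < u n" "u n < b" for n
    using l_pos[of n] l_half[of n] by linarith+
  have mono_l: "l m \<le> l n" if "n \<le> m" for n m
    using b that by (simp add: l_def frac_le)
  have l0: "l \<longlonglongrightarrow> 0"
    unfolding l_def by real_asymp
  have l_right: "filterlim l (at_right 0) sequentially"
    using l0 lu(1) by (simp add: filterlim_at less_imp_neq[symmetric])
  have "u \<longlonglongrightarrow> b - 0"
    unfolding l_pos(2)[abs_def] by (intro tendsto_intros l0)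
  then have u_left: "filterlim u (at_left b) sequentially"
    using lu(3) by (simp add: filterlim_at less_imp_neq)
  have g_mono: "g v \<le> g w" if "0 < v" "v \<le> w" "w < b" for v w
    using that by (intro DERIV_nonneg_imp_nondecreasing[of v w g]) (auto intro!: exI der less_imp_le[OF pos])
  have g_mono': "g v < g w" if "0 < v" "v < w" "w < b" for v w
    using that by (intro DERIV_pos_imp_increasing[of v w g]) (auto intro!: exI der pos)
  have g_pos: "0 < g w" if "0 < w" "w < b" for w
  proof -
    have "0 \<le> g (w / 2)"
    proof (rule tendsto_upperbound[OF lim(1)])
      show "\<forall>\<^sub>F v in at_right 0. g v \<le> g (w / 2)"
        by (rule eventually_mono[OF eventually_at_right_real[of 0 "w / 2"]]) (use that in \<open>auto intro!: g_mono\<close>)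
    qed simp
    also have "\<dots> < g w"
      using that by (intro g_mono') auto
    finally show ?thesis .
  qed
  define P where "P n Y = ennreal (F Y) * indicator {g (l n)..g (u n)} Y" for n Y
  define Q where "Q n w = ennreal (F (g w) * g' w) * indicator {l n..u n} w" for n w
  have PQ: "integral\<^sup>N lborel (P n) = integral\<^sup>N lborel (Q n)" for n
  proof -
    have "(\<integral>\<^sup>+Y. ennreal (F Y * indicator {g (l n)..g (u n)} Y) \<partial>lborel) =
        (\<integral>\<^sup>+w. ennreal (F (g w) * g' w * indicator {l n..u n} w) \<partial>lborel)"
    proof (rule nn_integral_substitution)
      show "set_borel_measurable borel {g (l n)..g (u n)} F"
        using meas(1) unfolding set_borel_measurable_def by measurable
      show "continuous_on {l n..u n} g'"
        by (rule continuous_on_subset[OF cont]) (use lu[of n] in auto)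
    qed (use lu[of n] in \<open>auto intro!: der less_imp_le[OF pos]\<close>)
    then show ?thesis
      unfolding P_def Q_def by (simp add: ennreal_indicator[symmetric] ennreal_mult'' )
  qed
  have "(\<lambda>n. integral\<^sup>N lborel (P n)) \<longlonglongrightarrow> (\<integral>\<^sup>+Y. ennreal (F Y) * indicator {0<..} Y \<partial>lborel)"
  proof (rule nn_integral_LIMSEQ)
    show "incseq P"
      unfolding incseq_def le_fun_def P_def
    proof (intro allI impI mult_left_mono)
      fix n m Y assume nm: "n \<le> (m::nat)"
      have "g (l m) \<le> g (l n)" "g (u n) \<le> g (u m)"
        using mono_l[OF nm] lu[of n] lu[of m] l_pos(2) by (auto intro!: g_mono)
      then show "indicator {g (l n)..g (u n)} Y \<le> (indicator {g (l m)..g (u m)} Y :: ennreal)"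
        by (auto simp: indicator_def)
    qed simp
    show "P n \<in> borel_measurable lborel" for n
      unfolding P_def using meas by measurable
    fix Y
    show "(\<lambda>n. P n Y) \<longlonglongrightarrow> ennreal (F Y) * indicator {0<..} Y"
    proof (cases "0 < Y")
      case True
      have "\<forall>\<^sub>F n in sequentially. g (l n) < Y"
        using order_tendstoD(2)[OF filterlim_compose[OF lim(1) l_right] True] .
      moreover have "\<forall>\<^sub>F n in sequentially. Y \<le> g (u n)"
        using filterlim_compose[OF lim(2) u_left] by (simp add: filterlim_at_top)
      ultimately have "\<forall>\<^sub>F n in sequentially. P n Y = ennreal (F Y) * indicator {0<..} Y"
        by eventually_elim (simp add: P_def True)
      then show ?thesis
        by (rule tendsto_eventually)
    next
      case False
      then have "P n Y = 0" for n
        using g_pos[of "l n"] lu[of n] by (auto simp: P_def indicator_def)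
      then show ?thesis
        using False by simp
    qed
  qed
  moreover have "(\<lambda>n. integral\<^sup>N lborel (Q n)) \<longlonglongrightarrow> (\<integral>\<^sup>+w. ennreal (F (g w) * g' w) * indicator {0<..<b} w \<partial>lborel)"
  proof (rule nn_integral_LIMSEQ)
    show "incseq Q"
      unfolding incseq_def le_fun_def Q_def
    proof (intro allI impI mult_left_mono)
      fix n m w assume nm: "n \<le> (m::nat)"
      show "indicator {l n..u n} w \<le> (indicator {l m..u m} w :: ennreal)"
        using mono_l[OF nm] l_pos(2) by (auto simp: indicator_def)
    qed simp
    show "Q n \<in> borel_measurable lborel" for n
      unfolding Q_def using meas by measurable
    fix w
    show "(\<lambda>n. Q n w) \<longlonglongrightarrow> ennreal (F (g w) * g' w) * indicator {0<..<b} w"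
    proof (cases "0 < w \<and> w < b")
      case True
      have "\<forall>\<^sub>F n in sequentially. l n < w"
        using True by (intro order_tendstoD(2)[OF l0]) auto
      moreover have "\<forall>\<^sub>F n in sequentially. w < u n"
        using True by (intro order_tendstoD(1)[OF \<open>u \<longlonglongrightarrow> b - 0\<close>]) auto
      ultimately have "\<forall>\<^sub>F n in sequentially. Q n w = ennreal (F (g w) * g' w) * indicator {0<..<b} w"
        by eventually_elim (simp add: Q_def True)
      then show ?thesis
        by (rule tendsto_eventually)
    next
      case False
      then have "Q n w = 0" for n
        using lu[of n] by (auto simp: Q_def indicator_def)
      then show ?thesis
        using False by (auto simp: indicator_def)
    qed
  qed
  ultimately show ?thesis
    unfolding PQ by (rule LIMSEQ_unique)
qed

lemma displacement_measurable [measurable]: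
  assumes [measurable]: "f \<in> borel_measurable M" "h \<in> borel_measurable M"
  shows "(\<lambda>z. displacement (f z) x0 (h z)) \<in> borel_measurable M"
    and "(\<lambda>z. displacement_deriv (f z) x0 (h z)) \<in> borel_measurable M"
    and "(\<lambda>z. chord (f z) x0 (h z) t) \<in> borel_measurable M"
  unfolding displacement_def displacement_deriv_def chord_def disp_diag_def disp_mixed_def
  by measurable

lemma nn_integral_displacement_substitution:
  assumes F: "F \<in> borel_measurable borel" and x: "0 \<le> x0" "0 < x"
  shows "(\<integral>\<^sup>+Y. ennreal (F Y) * indicator {0<..} Y \<partial>lborel)
    = (\<integral>\<^sup>+w. ennreal (F (displacement w x0 x) * displacement_deriv w x0 x) * indicator {0<..<pi} w \<partial>lborel)"
proof (rule nn_integral_substitution_halfline[OF F])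
  have s: "sin w \<noteq> 0" if "0 < w" "w < pi" for w
    using sin_gt_zero[OF that] by simp
  show "((\<lambda>w. displacement w x0 x) has_real_derivative displacement_deriv w x0 x) (at w)"
    if "0 < w" "w < pi" for w
    using s[OF that] by (rule displacement_has_deriv)
  show "continuous_on {0<..<pi} (\<lambda>w. displacement_deriv w x0 x)"
    unfolding displacement_deriv_def using s by (intro continuous_intros) auto
  show "0 < displacement_deriv w x0 x" if "0 < w" "w < pi" for w
    using x that by (intro displacement_deriv_pos) auto
  show "((\<lambda>w. displacement w x0 x) \<longlongrightarrow> 0) (at_right 0)"
    by (rule displacement_at_0)
  show "filterlim (\<lambda>w. displacement w x0 x) at_top (at_left pi)"
    using x by (intro displacement_at_pi) auto
qed (use displacement_measurable[of "\<lambda>w. w" borel "\<lambda>_. x"] in auto)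


lemma displacement_pos:
  assumes "0 < w" "w < pi" "0 \<le> x0" "0 \<le> x1" "0 < x0 \<or> 0 < x1"
  shows "0 < displacement w x0 x1"
proof -
  define v where "v = w / 2"
  have v: "0 < v" "v < w" "v < pi"
    using assms by (auto simp: v_def)
  have "sin v * cos v \<le> sin v * 1"
    using sin_gt_zero[OF v(1,3)] by (intro mult_left_mono) auto
  also have "\<dots> \<le> v"
    using sin_x_le_x[of v] v by simp
  finally have "0 \<le> disp_diag v"
    by (simp add: disp_diag_def)
  moreover have "0 \<le> disp_mixed v"
    using sin_minus_id_cos_pos[of v] v by (simp add: disp_mixed_def)
  ultimately have "0 \<le> displacement v x0 x1"
    using assms by (simp add: displacement_def)
  also have "\<dots> < displacement w x0 x1"
    using v assms by (intro displacement_strict_mono)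
  finally show ?thesis .
qed

text \<open>In the coordinates \<open>(x, w)\<close> the contraction is triangular: for fixed
  \<open>w\<close> it is affine in \<open>x\<close>, and then \<open>w\<close> is scaled by
  \<open>t\<close>. Each change of variable may enlarge the domain of integration, which only helps.
  Fubini makes the two changes separately accessible, and the height is restored at the end.\<close>

lemma nn_integral_contraction_quadrant:
  assumes x0: "0 \<le> x0" and t: "0 < t" "t < 1" and B[measurable]: "B \<in> sets (borel :: (real \<times> real) measure)"
  shows "ennreal (t ^ 4) * (\<integral>\<^sup>+x. (\<integral>\<^sup>+Y.
      indicator B (chord (frequency x0 x Y) x0 x t,
        displacement (t * frequency x0 x Y) x0 (chord (frequency x0 x Y) x0 x t))
      * indicator {0<..} Y \<partial>lborel) * indicator {0<..} x \<partial>lborel)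
    \<le> (\<integral>\<^sup>+x. (\<integral>\<^sup>+Y. indicator B (x, Y) * indicator {0<..} Y \<partial>lborel) * indicator {0<..} x \<partial>lborel)"
    (is "_ * ?L \<le> ?R")
proof -
  define \<beta> :: "real \<Rightarrow> real \<Rightarrow> real" where "\<beta> x Y = indicator B (x, Y)" for x Y
  have \<beta>[measurable]: "(\<lambda>z. \<beta> (f z) (g z)) \<in> borel_measurable M"
    if [measurable]: "f \<in> borel_measurable M" "g \<in> borel_measurable M" for f g and M :: "'z measure"
    unfolding \<beta>_def by measurable
  have \<beta>0: "0 \<le> \<beta> x Y" for x Y
    by (simp add: \<beta>_def)
  have \<beta>_e: "indicator B (x, Y) = ennreal (\<beta> x Y)" for x Y
    by (simp add: \<beta>_def ennreal_indicator)
  define I where "I w = (indicator {0<..<pi} w :: ennreal)" for w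
  define J where "J x = (indicator {0<..} x :: ennreal)" for x :: real
  have [measurable]: "I \<in> borel_measurable borel" "J \<in> borel_measurable borel"
    unfolding I_def J_def by measurable
  define c where "c w x = chord w x0 x t" for w x
  define \<psi> where "\<psi> w x = ennreal (\<beta> x (displacement (t * w) x0 x) * displacement_deriv (t * w) x0 x)" for w x
  have [measurable]: "(\<lambda>z. \<psi> (f z) (g z)) \<in> borel_measurable M"
    if [measurable]: "f \<in> borel_measurable M" "g \<in> borel_measurable M" for f g and M :: "(real \<times> real) measure"
    unfolding \<psi>_def by measurable
  have [measurable]: "\<psi> w \<in> borel_measurable borel" for w
    unfolding \<psi>_def by measurable
  define H where "H v = (\<integral>\<^sup>+x. ennreal (\<beta> x (displacement v x0 x) * displacement_deriv v x0 x) * J x \<partial>lborel)" for v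
  have s: "0 < sin w" "0 < sin (t * w)" "0 < t * w" "t * w < pi" if "w \<in> {0<..<pi}" for w
  proof -
    have "t * w < 1 * w"
      using that t by (intro mult_strict_right_mono) auto
    moreover have "w < pi"
      using that by simp
    ultimately show *: "t * w < pi"
      by linarith
    show "0 < t * w"
      using that t by simp
    then show "0 < sin (t * w)"
      using * by (rule sin_gt_zero)
    show "0 < sin w"
      using that by (auto intro!: sin_gt_zero)
  qed
  have "?L = (\<integral>\<^sup>+x. (\<integral>\<^sup>+w. ennreal (\<beta> (c w x) (displacement (t * w) x0 (c w x)) * displacement_deriv w x0 x)
      * I w \<partial>lborel) * J x \<partial>lborel)"
  proof (rule nn_integral_cong)
    fix x :: real
    show "(\<integral>\<^sup>+Y. indicator B (chord (frequency x0 x Y) x0 x t,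
        displacement (t * frequency x0 x Y) x0 (chord (frequency x0 x Y) x0 x t))
        * indicator {0<..} Y \<partial>lborel) * indicator {0<..} x
      = (\<integral>\<^sup>+w. ennreal (\<beta> (c w x) (displacement (t * w) x0 (c w x)) * displacement_deriv w x0 x)
        * I w \<partial>lborel) * J x"
    proof (cases "0 < x")
      case x: True
      \<comment> \<open>Extension by 0 to nonpositive heights turns the frequency into a Borel
        function on the whole line.\<close>
      define fr where "fr Y = (if Y \<in> {0<..} then frequency x0 x Y else 0)" for Y
      define F where "F Y = \<beta> (c (fr Y) x) (displacement (t * fr Y) x0 (c (fr Y) x))" for Y
      have "continuous_on {0<..} (\<lambda>Y. (x, Y))"
        by (intro continuous_intros)
      moreover have "(\<lambda>Y. (x, Y)) ` {0<..} \<subseteq> {q. 0 \<le> fst q \<and> (0 < x0 \<or> 0 < fst q) \<and> 0 < snd q}"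
        using x by auto
      ultimately have "continuous_on {0<..} (\<lambda>Y. frequency x0 (fst (x, Y)) (snd (x, Y)))"
        by (rule continuous_on_compose2[OF frequency_continuous_on[OF x0]])
      then have "continuous_on {0<..} (\<lambda>Y. frequency x0 x Y)"
        by simp
      then have [measurable]: "fr \<in> borel_measurable borel"
        unfolding fr_def by (intro borel_measurable_continuous_on_if) auto
      have F: "F \<in> borel_measurable borel"
        unfolding F_def c_def by measurable
      have "(\<integral>\<^sup>+Y. indicator B (chord (frequency x0 x Y) x0 x t,
          displacement (t * frequency x0 x Y) x0 (chord (frequency x0 x Y) x0 x t))
          * indicator {0<..} Y \<partial>lborel) = (\<integral>\<^sup>+Y. ennreal (F Y) * indicator {0<..} Y \<partial>lborel)"
      proof (rule nn_integral_cong)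
        fix Y :: real
        show "indicator B (chord (frequency x0 x Y) x0 x t,
            displacement (t * frequency x0 x Y) x0 (chord (frequency x0 x Y) x0 x t))
            * indicator {0<..} Y = ennreal (F Y) * indicator {0<..} Y"
          by (cases "0 < Y") (simp_all add: F_def fr_def c_def \<beta>_e)
      qed
      also have "\<dots> = (\<integral>\<^sup>+w. ennreal (F (displacement w x0 x) * displacement_deriv w x0 x) * indicator {0<..<pi} w \<partial>lborel)"
        by (rule nn_integral_displacement_substitution[OF F x0 x])
      also have "\<dots> = (\<integral>\<^sup>+w. ennreal (\<beta> (c w x) (displacement (t * w) x0 (c w x)) * displacement_deriv w x0 x)
          * I w \<partial>lborel)"
      proof (rule nn_integral_cong)
        fix w :: real
        show "ennreal (F (displacement w x0 x) * displacement_deriv w x0 x) * indicator {0<..<pi} w =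
            ennreal (\<beta> (c w x) (displacement (t * w) x0 (c w x)) * displacement_deriv w x0 x) * I w"
        proof (cases "w \<in> {0<..<pi}")
          case True
          then have "0 < displacement w x0 x"
            using x x0 by (intro displacement_pos) auto
          moreover have "frequency x0 x (displacement w x0 x) = w"
            using True x x0 by (intro frequency_unique) auto
          ultimately have "fr (displacement w x0 x) = w"
            by (simp add: fr_def)
          then show ?thesis
            by (simp add: F_def I_def)
        qed (simp add: I_def)
      qed
      finally show ?thesis
        using x by (simp add: J_def)
    qed (simp add: J_def)
  qed
  then have "ennreal (t ^ 4) * ?L = ennreal (t ^ 4) * (\<integral>\<^sup>+x. (\<integral>\<^sup>+w.
      ennreal (\<beta> (c w x) (displacement (t * w) x0 (c w x)) * displacement_deriv w x0 x) * I w \<partial>lborel) * J x \<partial>lborel)"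
    by (simp only:)
  also have "\<dots> = (\<integral>\<^sup>+x. ennreal (t ^ 4) * ((\<integral>\<^sup>+w.
      ennreal (\<beta> (c w x) (displacement (t * w) x0 (c w x)) * displacement_deriv w x0 x) * I w \<partial>lborel) * J x) \<partial>lborel)"
    unfolding c_def by (rule nn_integral_cmult[symmetric]) measurable
  also have "\<dots> = (\<integral>\<^sup>+x. (\<integral>\<^sup>+w. ennreal (t ^ 4) * (ennreal (\<beta> (c w x) (displacement (t * w) x0 (c w x)) * displacement_deriv w x0 x)
      * I w * J x) \<partial>lborel) \<partial>lborel)"
    unfolding c_def
    by (intro nn_integral_cong) (subst nn_integral_cmult, measurable, subst nn_integral_multc, measurable)
  also have "\<dots> \<le> (\<integral>\<^sup>+x. (\<integral>\<^sup>+w. ennreal t * (ennreal (sin (t * w) / sin w) * \<psi> w (c w x)) * I w * J x \<partial>lborel) \<partial>lborel)"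
  proof (intro nn_integral_mono)
    fix x w :: real
    show "ennreal (t ^ 4) * (ennreal (\<beta> (c w x) (displacement (t * w) x0 (c w x)) * displacement_deriv w x0 x) * I w * J x)
        \<le> ennreal t * (ennreal (sin (t * w) / sin w) * \<psi> w (c w x)) * I w * J x"
    proof (cases "w \<in> {0<..<pi} \<and> 0 < x")
      case True
      have "t ^ 4 * (\<beta> (c w x) (displacement (t * w) x0 (c w x)) * displacement_deriv w x0 x) \<le>
          t * (sin (t * w) / sin w * (\<beta> (c w x) (displacement (t * w) x0 (c w x)) * displacement_deriv (t * w) x0 (c w x)))"
        using mult_left_mono[OF displacement_deriv_contraction[of x0 x w t] \<beta>0[of "c w x" "displacement (t * w) x0 (c w x)"]] True x0 t
        by (simp add: c_def mult_ac)
      then show ?thesis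
        using True s[of w] t unfolding \<psi>_def I_def J_def
        by (auto simp: ennreal_mult'[symmetric] less_imp_le intro!: ennreal_leI)
    qed (auto simp: I_def J_def)
  qed
  also have "\<dots> = (\<integral>\<^sup>+w. (\<integral>\<^sup>+x. ennreal t * (ennreal (sin (t * w) / sin w) * \<psi> w (c w x)) * I w * J x \<partial>lborel) \<partial>lborel)"
    unfolding c_def by (rule lborel_pair.Fubini') measurable
  also have "\<dots> \<le> (\<integral>\<^sup>+w. ennreal t * H (t * w) * I w \<partial>lborel)"
  proof (rule nn_integral_mono)
    fix w :: real
    show "(\<integral>\<^sup>+x. ennreal t * (ennreal (sin (t * w) / sin w) * \<psi> w (c w x)) * I w * J x \<partial>lborel) \<le> ennreal t * H (t * w) * I w"
    proof (cases "w \<in> {0<..<pi}")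
      case True
      define k where "k = sin (t * w) / sin w"
      \<comment> \<open>The intercept of the affine map from \<open>x\<close> to
        \<open>chord w x0 x t\<close>, whose slope is \<open>k\<close>.\<close>
      define d where "d = x0 * sin ((1 - t) * w) / sin w"
      have k: "0 < k"
        using s[OF True] by (simp add: k_def)
      have "0 \<le> sin ((1 - t) * w)"
      proof (rule sin_ge_zero)
        have "(1 - t) * w \<le> 1 * w"
          using True t by (intro mult_right_mono) auto
        moreover have "w < pi"
          using True by simp
        ultimately show "(1 - t) * w \<le> pi"
          by linarith
      qed (use True t in auto)
      then have d: "0 \<le> d"
        using s(1)[OF True] x0 by (simp add: d_def)
      have c: "c w x = d + k * x" for x
        by (simp add: c_def chord_def d_def k_def add_divide_distrib)
      \<comment> \<open>Since \<open>d\<close> is nonnegative and \<open>k\<close> positive,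
        positive \<open>x\<close> have positive images, so the indicator may be evaluated at the
        image before substituting.\<close>
      have "(\<integral>\<^sup>+x. ennreal k * \<psi> w (d + k * x) * J x \<partial>lborel) \<le> (\<integral>\<^sup>+x. ennreal k * (\<psi> w (d + k * x) * J (d + k * x)) \<partial>lborel)"
        using k d by (intro nn_integral_mono) (auto simp: J_def indicator_def add_nonneg_pos)
      also have "\<dots> = ennreal k * (\<integral>\<^sup>+x. \<psi> w (d + k * x) * J (d + k * x) \<partial>lborel)"
        by (rule nn_integral_cmult) measurable
      also have "\<dots> = (\<integral>\<^sup>+x. \<psi> w x * J x \<partial>lborel)"
        using k by (subst nn_integral_real_affine[where c = k and t = d]) auto
      also have "\<dots> = H (t * w)"
        by (simp add: H_def \<psi>_def)
      finally have le: "(\<integral>\<^sup>+x. ennreal k * \<psi> w (d + k * x) * J x \<partial>lborel) \<le> H (t * w)" .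
      have "(\<integral>\<^sup>+x. ennreal t * (ennreal (sin (t * w) / sin w) * \<psi> w (c w x)) * I w * J x \<partial>lborel)
          = (\<integral>\<^sup>+x. ennreal t * (ennreal k * \<psi> w (d + k * x) * J x) \<partial>lborel)"
        using True by (intro nn_integral_cong) (simp add: c I_def k_def mult.assoc)
      also have "\<dots> = ennreal t * (\<integral>\<^sup>+x. ennreal k * \<psi> w (d + k * x) * J x \<partial>lborel)"
        by (rule nn_integral_cmult) measurable
      also have "\<dots> \<le> ennreal t * H (t * w)"
        by (intro mult_left_mono le) simp
      finally show ?thesis
        using True by (simp add: I_def)
    qed (simp add: I_def)
  qed
  \<comment> \<open>The same enlargement for the frequency: \<open>t * w\<close> lies in
    \<open>(0, pi)\<close> whenever \<open>w\<close> does.\<close>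
  also have "\<dots> \<le> (\<integral>\<^sup>+w. ennreal t * (H (t * w) * I (t * w)) \<partial>lborel)"
    using s by (intro nn_integral_mono) (auto simp: I_def indicator_def mult.assoc)
  also have "\<dots> = ennreal t * (\<integral>\<^sup>+w. H (0 + t * w) * I (0 + t * w) \<partial>lborel)"
    unfolding H_def by (simp add: nn_integral_cmult)
  also have "\<dots> = (\<integral>\<^sup>+w. H w * I w \<partial>lborel)"
    unfolding H_def using t
    by (subst nn_integral_real_affine[where c = t and t = 0, of "\<lambda>w. (\<integral>\<^sup>+x. ennreal (\<beta> x (displacement w x0 x) * displacement_deriv w x0 x) * J x \<partial>lborel) * I w"]) auto
  also have "\<dots> = (\<integral>\<^sup>+w. (\<integral>\<^sup>+x. ennreal (\<beta> x (displacement w x0 x) * displacement_deriv w x0 x) * I w * J x \<partial>lborel) \<partial>lborel)"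
    unfolding H_def by (subst nn_integral_multc[symmetric]) (auto simp: mult_ac)
  also have "\<dots> = (\<integral>\<^sup>+x. (\<integral>\<^sup>+w. ennreal (\<beta> x (displacement w x0 x) * displacement_deriv w x0 x) * I w * J x \<partial>lborel) \<partial>lborel)"
    by (rule lborel_pair.Fubini') measurable
  also have "\<dots> = ?R"
  proof (rule nn_integral_cong)
    fix x :: real
    show "(\<integral>\<^sup>+w. ennreal (\<beta> x (displacement w x0 x) * displacement_deriv w x0 x) * I w * J x \<partial>lborel)
      = (\<integral>\<^sup>+Y. indicator B (x, Y) * indicator {0<..} Y \<partial>lborel) * indicator {0<..} x"
    proof (cases "0 < x")
      case True
      have "(\<lambda>Y. \<beta> x Y) \<in> borel_measurable borel"
        by measurable
      from nn_integral_displacement_substitution[OF this x0 True] True show ?thesis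
        by (simp add: I_def J_def \<beta>_e)
    qed (simp add: J_def)
  qed
  finally show ?thesis .
qed

section \<open>Transport to either half-plane by reflection\<close>

definition reflect_fst :: "real \<Rightarrow> real \<times> real \<Rightarrow> real \<times> real"
  where "reflect_fst \<sigma> p = (\<sigma> * fst p, snd p)"

lemma fst_reflect_fst [simp]: "fst (reflect_fst \<sigma> p) = \<sigma> * fst p"
  and snd_reflect_fst [simp]: "snd (reflect_fst \<sigma> p) = snd p"
  by (simp_all add: reflect_fst_def)

lemma reflect_fst_half_plane: "reflect_fst \<sigma> p \<in> half_plane 1 \<longleftrightarrow> p \<in> half_plane \<sigma>"
  by (simp add: half_plane_def)

lemma continuous_on_reflect_fst [continuous_intros]:
  "continuous_on S f \<Longrightarrow> continuous_on S (\<lambda>x. reflect_fst \<sigma> (f x))"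
  unfolding reflect_fst_def by (intro continuous_intros)

lemma reflect_fst_measurable: "reflect_fst \<sigma> \<in> borel_measurable borel"
  by (intro borel_measurable_continuous_onI continuous_intros)

lemma emeasure_lborel_pair:
  assumes "A \<in> sets (borel :: (real \<times> real) measure)"
  shows "emeasure lborel A = (\<integral>\<^sup>+x. \<integral>\<^sup>+y. indicator A (x, y) \<partial>lborel \<partial>lborel)"
proof -
  have "emeasure lborel A = emeasure (lborel \<Otimes>\<^sub>M lborel) A"
    by (simp add: lborel_prod)
  also have "\<dots> = (\<integral>\<^sup>+x. \<integral>\<^sup>+y. indicator A (x, y) \<partial>lborel \<partial>lborel)"
    using assms by (intro lborel.emeasure_pair_measure) (simp only: lborel_prod sets_lborel)
  finally show ?thesis .
qed

context
  fixes \<sigma> :: real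
  assumes \<sigma>: "\<sigma> = 1 \<or> \<sigma> = - 1"
begin

lemma reflect_fst_reflect_fst [simp]: "reflect_fst \<sigma> (reflect_fst \<sigma> p) = p"
  using \<sigma> by (auto simp: reflect_fst_def)

lemma grushin_dist_reflect_fst:
  "grushin_dist (reflect_fst \<sigma> p) (reflect_fst \<sigma> q) = grushin_dist p q"
  using \<sigma> grushin_dist_reflect_x[of "fst p" "snd p" "fst q" "snd q"] by (auto simp: reflect_fst_def)

lemma emeasure_lborel_reflect_fst:
  assumes A: "A \<in> sets (borel :: (real \<times> real) measure)"
  shows "emeasure lborel (reflect_fst \<sigma> -` A) = emeasure lborel A"
proof -
  note [measurable] = A
  have B: "reflect_fst \<sigma> -` A \<in> sets borel"
    using measurable_sets[OF reflect_fst_measurable A] by simp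
  have "emeasure lborel A = ennreal \<bar>\<sigma>\<bar> * (\<integral>\<^sup>+x. \<integral>\<^sup>+y. indicator A (0 + \<sigma> * x, y) \<partial>lborel \<partial>lborel)"
    unfolding emeasure_lborel_pair[OF A] using \<sigma> by (intro nn_integral_real_affine) auto
  also have "\<dots> = emeasure lborel (reflect_fst \<sigma> -` A)"
    unfolding emeasure_lborel_pair[OF B] using \<sigma> by (auto simp: reflect_fst_def indicator_def)
  finally show ?thesis by simp
qed

text \<open>For \<sigma> = -1 this conjugates the right half-plane geodesic by the reflection.
  Restriction to \<open>{0..1}\<close> makes it \<open>undefined\<close> elsewhere, as elements of
  \<open>Geo\<close> must be.\<close>

definition half_geodesic :: "real \<times> real \<Rightarrow> real \<times> real \<Rightarrow> real \<Rightarrow> real \<times> real"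
  where "half_geodesic p q = (\<lambda>t\<in>{0..1}. reflect_fst \<sigma> (geodesic (reflect_fst \<sigma> p) (reflect_fst \<sigma> q) t))"

abbreviation half_space :: "(real \<times> real) metric"
  where "half_space \<equiv> submetric grushin_plane (half_plane \<sigma>)"

abbreviation half_measure :: "(real \<times> real) measure"
  where "half_measure \<equiv> restrict_space lborel (half_plane \<sigma>)"

lemma half_geodesic_eq:
  "t \<in> {0..1} \<Longrightarrow> half_geodesic p q t = reflect_fst \<sigma> (geodesic (reflect_fst \<sigma> p) (reflect_fst \<sigma> q) t)"
  by (simp add: half_geodesic_def)

lemma half_geodesic_ends:
  assumes "p \<in> half_plane \<sigma>" "q \<in> half_plane \<sigma>"
  shows "half_geodesic p q 0 = p" "half_geodesic p q 1 = q"
  using geodesic_props(1,2)[of "reflect_fst \<sigma> p" "reflect_fst \<sigma> q"] assms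
  by (simp_all add: half_geodesic_eq reflect_fst_half_plane)

lemma half_geodesic_mem_Geo:
  assumes p: "p \<in> half_plane \<sigma>" and q: "q \<in> half_plane \<sigma>"
  shows "half_geodesic p q \<in> mspace (Geo half_space)"
proof (rule mem_mspace_GeoI)
  have p': "reflect_fst \<sigma> p \<in> half_plane 1" "reflect_fst \<sigma> q \<in> half_plane 1"
    using p q by (simp_all add: reflect_fst_half_plane)
  show "half_geodesic p q \<in> extensional {0..1}"
    by (simp add: half_geodesic_def)
  show "half_geodesic p q t \<in> mspace half_space" if "t \<in> {0..1}" for t
    using geodesic_props(3)[OF p' that] reflect_fst_half_plane[of \<sigma> "half_geodesic p q t"] that
    by (simp add: half_geodesic_eq)
  show "mdist half_space (half_geodesic p q t) (half_geodesic p q s)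
      = \<bar>t - s\<bar> * mdist half_space (half_geodesic p q 0) (half_geodesic p q 1)"
    if "s \<in> {0..1}" "t \<in> {0..1}" for s t
    using geodesic_props(4)[OF p' that] that half_geodesic_ends[OF p q]
    by (simp add: half_geodesic_eq[of s] half_geodesic_eq[of t] grushin_dist_reflect_fst)
qed

lemma half_geodesic_measurable:
  assumes p: "p \<in> half_plane \<sigma>"
  shows "half_geodesic p \<in> half_measure \<rightarrow>\<^sub>M borel_of_metric (Geo half_space)"
proof (rule measurable_into_Geo[where \<R> = "(\<lambda>R. reflect_fst \<sigma> -` R) ` geodesic_pieces (reflect_fst \<sigma> p)"])
  show "closed (half_plane \<sigma>)"
    by (rule closed_half_plane)
  show "half_plane \<sigma> = \<Union> ((\<lambda>R. reflect_fst \<sigma> -` R) ` geodesic_pieces (reflect_fst \<sigma> p))"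
    using geodesic_pieces(2)[of "reflect_fst \<sigma> p"] reflect_fst_half_plane[of \<sigma>] by blast
  fix Q assume "Q \<in> (\<lambda>R. reflect_fst \<sigma> -` R) ` geodesic_pieces (reflect_fst \<sigma> p)"
  then obtain R where R: "R \<in> geodesic_pieces (reflect_fst \<sigma> p)" and Q: "Q = reflect_fst \<sigma> -` R"
    by blast
  show "Q \<in> sets borel"
    unfolding Q using measurable_sets[OF reflect_fst_measurable geodesic_pieces(3)[OF R]] by simp
  fix t :: real assume t: "t \<in> {0..1}"
  have p': "reflect_fst \<sigma> p \<in> half_plane 1"
    using p by (simp add: reflect_fst_half_plane)
  have "continuous_on Q (\<lambda>q. geodesic (reflect_fst \<sigma> p) (reflect_fst \<sigma> q) t)"
    by (rule continuous_on_compose2[OF continuous_on_geodesic[OF p' R t]])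
      (auto simp: Q intro!: continuous_intros)
  then show "continuous_on Q (\<lambda>q. half_geodesic p q t)"
    unfolding half_geodesic_eq[OF t] by (rule continuous_on_reflect_fst)
qed (auto simp: geodesic_pieces(1) half_geodesic_mem_Geo[OF p])

lemma sets_half_measure: "sets half_measure = sets (borel_of_metric half_space)"
  by (rule sets_borel_of_grushin_submetric[OF closed_half_plane])

lemma half_geodesic_preimage:
  assumes p: "p \<in> half_plane \<sigma>" and t: "t \<in> {0..1}" and B: "B \<in> sets borel" "B \<subseteq> half_plane \<sigma>"
  shows "{q \<in> half_plane \<sigma>. half_geodesic p q t \<in> B} \<in> sets borel"
proof -
  have H: "half_plane \<sigma> \<in> sets borel"
    by (rule borel_closed[OF closed_half_plane])
  have "B \<in> sets (borel_of_metric half_space)"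
    using B H by (simp add: sets_half_measure[symmetric] sets_restrict_space_iff)
  from measurable_sets[OF measurable_compose[OF half_geodesic_measurable[OF p] measurable_Geo_eval[OF t]] this]
  have "(\<lambda>q. half_geodesic p q t) -` B \<inter> half_plane \<sigma> \<in> sets half_measure"
    by (simp add: space_restrict_space)
  moreover have "(\<lambda>q. half_geodesic p q t) -` B \<inter> half_plane \<sigma> = {q \<in> half_plane \<sigma>. half_geodesic p q t \<in> B}"
    by auto
  ultimately show ?thesis
    using H by (simp add: sets_restrict_space_iff)
qed

end

section \<open>The volume inequality on a half-plane\<close>

lemma emeasure_open_quadrant:
  assumes s: "s = 1 \<or> s = - 1" and A: "A \<in> sets (borel :: (real \<times> real) measure)"
  shows "emeasure lborel (A \<inter> {q. 0 < fst q \<and> 0 < s * (snd q - y0)})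
    = (\<integral>\<^sup>+x. (\<integral>\<^sup>+Y. indicator A (x, y0 + s * Y) * indicator {0<..} Y \<partial>lborel) * indicator {0<..} x \<partial>lborel)"
proof -
  note [measurable] = A
  let ?Q = "{q :: real \<times> real. 0 < fst q \<and> 0 < s * (snd q - y0)}"
  have "open ({q :: real \<times> real. 0 < fst q} \<inter> {q. 0 < s * (snd q - y0)})"
    by (intro open_Int open_Collect_less continuous_intros)
  then have Q: "?Q \<in> sets borel"
    by (auto intro!: borel_open simp: Collect_conj_eq)
  then have "emeasure lborel (A \<inter> ?Q) = (\<integral>\<^sup>+x. \<integral>\<^sup>+y. indicator (A \<inter> ?Q) (x, y) \<partial>lborel \<partial>lborel)"
    using A by (intro emeasure_lborel_pair) auto
  also have "\<dots> = (\<integral>\<^sup>+x. (\<integral>\<^sup>+Y. indicator A (x, y0 + s * Y) * indicator {0<..} Y \<partial>lborel) * indicator {0<..} x \<partial>lborel)"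
  proof (rule nn_integral_cong)
    fix x :: real
    have m: "(\<lambda>y. indicator (A \<inter> ?Q) (x, y) :: ennreal) \<in> borel_measurable borel"
      using Q by measurable
    have "(\<integral>\<^sup>+y. indicator (A \<inter> ?Q) (x, y) \<partial>lborel) = ennreal \<bar>s\<bar> * (\<integral>\<^sup>+Y. indicator (A \<inter> ?Q) (x, y0 + s * Y) \<partial>lborel)"
      using s by (intro nn_integral_real_affine[OF m]) auto
    also have "\<dots> = (\<integral>\<^sup>+Y. indicator A (x, y0 + s * Y) * indicator {0<..} Y * indicator {0<..} x \<partial>lborel)"
      using s by (auto intro!: nn_integral_cong simp: indicator_def)
    also have "\<dots> = (\<integral>\<^sup>+Y. indicator A (x, y0 + s * Y) * indicator {0<..} Y \<partial>lborel) * indicator {0<..} x"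
      by (rule nn_integral_multc) measurable
    finally show "(\<integral>\<^sup>+y. indicator (A \<inter> ?Q) (x, y) \<partial>lborel) =
        (\<integral>\<^sup>+Y. indicator A (x, y0 + s * Y) * indicator {0<..} Y \<partial>lborel) * indicator {0<..} x" .
  qed
  finally show ?thesis .
qed

text \<open>The quadrant estimate is used above and below the height of \<open>p\<close>. The end
  points left out lie on the lines \<open>fst q = 0\<close> and \<open>snd q = y0\<close>, which are
  null, and the parts of \<open>B\<close> in the two quadrants are disjoint.\<close>

lemma emeasure_geodesic_contraction:
  assumes p: "p \<in> half_plane 1" and t: "t \<in> {0<..<1}" and B: "B \<in> sets borel" "B \<subseteq> half_plane 1"
  shows "ennreal (t ^ 4) * emeasure lborel {q \<in> half_plane 1. geodesic p q t \<in> B} \<le> emeasure lborel B"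
proof -
  obtain x0 y0 where p': "p = (x0, y0)"
    by fastforce
  have x0: "0 \<le> x0"
    using p by (simp add: half_plane_def p')
  define E where "E = {q \<in> half_plane 1. geodesic p q t \<in> B}"
  have "E = {q \<in> half_plane 1. half_geodesic 1 p q t \<in> B}"
    using t by (auto simp: E_def half_geodesic_eq reflect_fst_def)
  then have E: "E \<in> sets borel"
    using half_geodesic_preimage[of 1 p t B] p t B by simp
  define Q where "Q s = {q :: real \<times> real. 0 < fst q \<and> 0 < s * (snd q - y0)}" for s
  have Q: "Q s \<in> sets borel" for s
  proof -
    have "open ({q :: real \<times> real. 0 < fst q} \<inter> {q. 0 < s * (snd q - y0)})"
      by (intro open_Int open_Collect_less continuous_intros)
    then show ?thesis
      unfolding Q_def by (auto intro!: borel_open simp: Collect_conj_eq)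
  qed
  have quad: "ennreal (t ^ 4) * emeasure lborel (E \<inter> Q s) \<le> emeasure lborel (B \<inter> Q s)" if s: "s = 1 \<or> s = - 1" for s
  proof -
    \<comment> \<open>The set \<open>B\<close> in coordinates where \<open>p\<close> has height 0
      and the quadrant opens upwards.\<close>
    define B' where "B' = {z :: real \<times> real. (fst z, y0 + s * snd z) \<in> B}"
    have B': "B' \<in> sets borel"
    proof -
      have "(\<lambda>z :: real \<times> real. (fst z, y0 + s * snd z)) \<in> borel_measurable borel"
        by (intro borel_measurable_continuous_onI continuous_intros)
      from measurable_sets[OF this B(1)] show ?thesis
        by (simp add: B'_def vimage_def)
    qed
    have "emeasure lborel (E \<inter> Q s) = (\<integral>\<^sup>+x. (\<integral>\<^sup>+Y. indicator E (x, y0 + s * Y) * indicator {0<..} Y \<partial>lborel) * indicator {0<..} x \<partial>lborel)"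
      unfolding Q_def by (rule emeasure_open_quadrant[OF s E])
    also have "\<dots> = (\<integral>\<^sup>+x. (\<integral>\<^sup>+Y.
      indicator B' (chord (frequency x0 x Y) x0 x t,
        displacement (t * frequency x0 x Y) x0 (chord (frequency x0 x Y) x0 x t))
      * indicator {0<..} Y \<partial>lborel) * indicator {0<..} x \<partial>lborel)"
    proof (rule nn_integral_cong)
      fix x :: real
      show "(\<integral>\<^sup>+Y. indicator E (x, y0 + s * Y) * indicator {0<..} Y \<partial>lborel) * indicator {0<..} x =
        (\<integral>\<^sup>+Y. indicator B' (chord (frequency x0 x Y) x0 x t,
        displacement (t * frequency x0 x Y) x0 (chord (frequency x0 x Y) x0 x t))
        * indicator {0<..} Y \<partial>lborel) * indicator {0<..} x"
      proof (cases "0 < x")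
        case x: True
        have "indicator E (x, y0 + s * Y) * indicator {0<..} Y = (indicator B' (chord (frequency x0 x Y) x0 x t,
            displacement (t * frequency x0 x Y) x0 (chord (frequency x0 x Y) x0 x t))
            * indicator {0<..} Y :: ennreal)" for Y
        proof (cases "0 < Y")
          case True
          have "\<bar>s * Y\<bar> = Y" "sgn (s * Y) = s" "s * Y \<noteq> 0"
            using True s by auto
          then have "geodesic p (x, y0 + s * Y) t = (chord (frequency x0 x Y) x0 x t,
            y0 + s * displacement (t * frequency x0 x Y) x0 (chord (frequency x0 x Y) x0 x t))"
            using x by (simp add: geodesic_def p' Let_def)
          then show ?thesis
            using x by (simp add: E_def B'_def half_plane_def indicator_def)
        qed simp
        then show ?thesis by simp
      qed simp
    qed
    finally have "ennreal (t ^ 4) * emeasure lborel (E \<inter> Q s) \<le>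
        (\<integral>\<^sup>+x. (\<integral>\<^sup>+Y. indicator B' (x, Y) * indicator {0<..} Y \<partial>lborel) * indicator {0<..} x \<partial>lborel)"
      using nn_integral_contraction_quadrant[OF x0 _ _ B', of t] t by simp
    also have "\<dots> = (\<integral>\<^sup>+x. (\<integral>\<^sup>+Y. indicator B (x, y0 + s * Y) * indicator {0<..} Y \<partial>lborel) * indicator {0<..} x \<partial>lborel)"
      by (simp add: B'_def indicator_def)
    also have "\<dots> = emeasure lborel (B \<inter> Q s)"
      unfolding Q_def by (rule emeasure_open_quadrant[OF s B(1), symmetric])
    finally show ?thesis .
  qed
  define N where "N = {q :: real \<times> real. fst q = 0 \<or> snd q = y0}"
  have N: "N \<in> sets borel"
  proof -
    have "closed ({q :: real \<times> real. fst q = 0} \<union> {q. snd q = y0})"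
      by (intro closed_Un closed_Collect_eq continuous_intros)
    then show ?thesis
      unfolding N_def by (auto intro!: borel_closed simp: Collect_disj_eq)
  qed
  have null: "emeasure lborel N = 0"
  proof -
    have "emeasure lborel N = (\<integral>\<^sup>+x. \<integral>\<^sup>+y. indicator N (x, y) \<partial>lborel \<partial>lborel)"
      using N by (rule emeasure_lborel_pair)
    also have "\<dots> = (\<integral>\<^sup>+(x::real). 0 \<partial>lborel)"
    proof (rule nn_integral_cong_AE)
      show "AE x in lborel. (\<integral>\<^sup>+y. indicator N (x, y) \<partial>lborel) = 0"
        using AE_lborel_singleton[of "0::real"]
      proof eventually_elim
        case (elim x)
        have "(\<integral>\<^sup>+y. indicator N (x, y) \<partial>lborel) = (\<integral>\<^sup>+y. indicator {y0} y \<partial>lborel)"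
          using elim by (intro nn_integral_cong) (simp add: N_def indicator_def)
        then show ?case by simp
      qed
    qed
    finally show ?thesis by simp
  qed
  have "emeasure lborel E \<le> emeasure lborel ((E \<inter> Q 1) \<union> (E \<inter> Q (- 1)) \<union> N)"
  proof (rule emeasure_mono)
    show "E \<subseteq> (E \<inter> Q 1) \<union> (E \<inter> Q (- 1)) \<union> N"
      by (auto simp: E_def Q_def N_def half_plane_def)
    show "(E \<inter> Q 1) \<union> (E \<inter> Q (- 1)) \<union> N \<in> sets lborel"
      using E Q N by simp
  qed
  also have "\<dots> \<le> emeasure lborel ((E \<inter> Q 1) \<union> (E \<inter> Q (- 1))) + emeasure lborel N"
    using E Q N by (intro emeasure_subadditive) auto
  also have "\<dots> \<le> emeasure lborel (E \<inter> Q 1) + emeasure lborel (E \<inter> Q (- 1))"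
    using E Q null emeasure_subadditive[of "E \<inter> Q 1" lborel "E \<inter> Q (- 1)"] by simp
  finally have "ennreal (t ^ 4) * emeasure lborel E \<le>
      ennreal (t ^ 4) * (emeasure lborel (E \<inter> Q 1) + emeasure lborel (E \<inter> Q (- 1)))"
    by (rule mult_left_mono) simp
  also have "\<dots> \<le> emeasure lborel (B \<inter> Q 1) + emeasure lborel (B \<inter> Q (- 1))"
    unfolding distrib_left by (intro add_mono quad) auto
  also have "\<dots> = emeasure lborel ((B \<inter> Q 1) \<union> (B \<inter> Q (- 1)))"
  proof (rule plus_emeasure)
    show "B \<inter> Q 1 \<in> sets lborel" "B \<inter> Q (- 1) \<in> sets lborel"
      using B Q by simp_all
    show "B \<inter> Q 1 \<inter> (B \<inter> Q (- 1)) = {}"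
      by (auto simp: Q_def)
  qed
  also have "\<dots> \<le> emeasure lborel B"
    using B by (intro emeasure_mono) auto
  finally show ?thesis
    unfolding E_def .
qed

lemma contraction_half_plane:
  assumes \<sigma>: "\<sigma> = 1 \<or> \<sigma> = - 1"
  shows "contraction (submetric grushin_plane (half_plane \<sigma>)) (restrict_space lborel (half_plane \<sigma>))"
proof
  let ?X = "submetric grushin_plane (half_plane \<sigma>)"
  let ?m = "restrict_space lborel (half_plane \<sigma>)"
  have H: "half_plane \<sigma> \<in> sets borel"
    by (rule borel_closed[OF closed_half_plane])
  show "sets ?m = sets (borel_of_metric ?X)"
    by (rule sets_half_measure[OF \<sigma>])
  show "AE y in ?m. y \<noteq> x" for x
    using AE_lborel_singleton[of x] H by (auto simp: AE_restrict_space_iff elim: eventually_mono)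
  fix x assume "x \<in> mspace ?X"
  then have x: "x \<in> half_plane \<sigma>"
    by simp
  have "ennreal (t ^ 4) * emeasure ?m {y \<in> mspace ?X. half_geodesic \<sigma> x y t \<in> B} \<le> emeasure ?m B"
    if t: "t \<in> {0<..<1}" and B: "B \<in> sets ?m" for t B
  proof -
    have B': "B \<in> sets borel" "B \<subseteq> half_plane \<sigma>"
      using B H by (auto simp: sets_restrict_space_iff)
    define C where "C = reflect_fst \<sigma> -` B"
    have C: "C \<in> sets borel"
      using measurable_sets[OF reflect_fst_measurable B'(1)] by (simp add: C_def)
    have C': "C \<subseteq> half_plane 1"
    proof
      fix q assume "q \<in> C"
      then have "reflect_fst \<sigma> q \<in> half_plane \<sigma>"
        using B'(2) by (auto simp: C_def)
      then show "q \<in> half_plane 1"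
        using \<sigma> by (auto simp: half_plane_def)
    qed
    define x' where "x' = reflect_fst \<sigma> x"
    have x': "x' \<in> half_plane 1"
      using x by (simp add: x'_def reflect_fst_half_plane)
    define D where "D = {q \<in> half_plane 1. geodesic x' q t \<in> C}"
    have eq: "{y \<in> half_plane \<sigma>. half_geodesic \<sigma> x y t \<in> B} = reflect_fst \<sigma> -` D"
      using t by (auto simp: D_def C_def half_geodesic_eq[OF \<sigma>] x'_def reflect_fst_half_plane)
    have "D = {q \<in> half_plane 1. half_geodesic 1 x' q t \<in> C}"
      using t by (auto simp: D_def half_geodesic_eq reflect_fst_def)
    then have D: "D \<in> sets borel"
      using half_geodesic_preimage[of 1 x' t C] x' t C C' by simp
    have "ennreal (t ^ 4) * emeasure lborel (reflect_fst \<sigma> -` D) \<le> emeasure lborel B"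
      using emeasure_geodesic_contraction[OF x' t C C'] emeasure_lborel_reflect_fst[OF \<sigma> D]
        emeasure_lborel_reflect_fst[OF \<sigma> B'(1)]
      by (simp add: D_def C_def)
    moreover have "emeasure ?m B = emeasure lborel B"
      using H B' by (simp add: emeasure_restrict_space)
    moreover have "emeasure ?m {y \<in> mspace ?X. half_geodesic \<sigma> x y t \<in> B} = emeasure lborel (reflect_fst \<sigma> -` D)"
      using H by (simp add: emeasure_restrict_space eq[symmetric] Collect_restrict)
    ultimately show ?thesis by simp
  qed
  then show "\<exists>\<phi>. \<phi> \<in> ?m \<rightarrow>\<^sub>M borel_of_metric (Geo ?X) \<and>
      (\<forall>y\<in>mspace ?X. \<phi> y 0 = x \<and> \<phi> y 1 = y) \<and>
      (\<forall>t\<in>{0<..<1}. \<forall>B\<in>sets ?m.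
        ennreal (t ^ 4) * emeasure ?m {y \<in> mspace ?X. \<phi> y t \<in> B} \<le> emeasure ?m B)"
    using half_geodesic_measurable[OF \<sigma> x] half_geodesic_ends[OF \<sigma> x]
    by (intro exI[of _ "half_geodesic \<sigma> x"]) simp
qed

section \<open>Midpoints from the origin\<close>

text \<open>The minimal arc starts at phase 0 and has amplitude \<open>x1 / sin w\<close>.\<close>

lemma grushin_dist_origin:
  assumes "0 < x1" "0 < w" "w < pi"
  shows "grushin_dist (0, 0) (x1, x1\<^sup>2 * disp_diag w) = x1 * w / sin w"
proof -
  have s: "0 < sin w"
    using assms by (intro sin_gt_zero)
  have "grushin_dist (x1 / sin w * sin 0, 0) (x1 / sin w * sin w, x1\<^sup>2 * disp_diag w) = x1 / sin w * (w - 0)"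
  proof (rule grushin_dist_arc)
    have "0 \<le> disp_diag w"
      using displacement_pos[of w 0 1] assms by (simp add: displacement_def)
    then have "\<bar>x1\<^sup>2 * disp_diag w - 0\<bar> = x1\<^sup>2 * disp_diag w"
      by simp
    then show "\<bar>x1\<^sup>2 * disp_diag w - 0\<bar> = (x1 / sin w)\<^sup>2 * (arc_area w - arc_area 0)"
      by (simp only: disp_diag_def) (simp add: arc_area_def power_divide)
  qed (use assms s in auto)
  then show ?thesis
    using s by simp
qed

text \<open>The limit of the calibration as the phase \<open>b\<close> tends to 0; the singular term
  \<open>cot b\<close> is multiplied by the squared abscissa of the origin, which is 0.\<close>

lemma grushin_dist_origin_lower:
  assumes "0 < w" "w < pi"
  shows "w * \<bar>Y\<bar> + w / 2 * cot w * x\<^sup>2 \<le> (grushin_dist (0, 0) (x, Y))\<^sup>2 / 2"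
proof -
  have "((\<lambda>b. w * \<bar>Y\<bar> + w / 2 * cot (w + b) * x\<^sup>2) \<longlongrightarrow> w * \<bar>Y\<bar> + w / 2 * cot (w + 0) * x\<^sup>2) (at_right 0)"
    using sin_gt_zero[OF assms] by (intro tendsto_intros) auto
  moreover have "\<forall>\<^sub>F b in at_right 0. w * \<bar>Y\<bar> + w / 2 * cot (w + b) * x\<^sup>2 \<le> (grushin_dist (0, 0) (x, Y))\<^sup>2 / 2"
  proof (rule eventually_mono[OF eventually_at_right_real[of 0 "pi - w"]])
    fix b assume "b \<in> {0<..<pi - w}"
    then show "w * \<bar>Y\<bar> + w / 2 * cot (w + b) * x\<^sup>2 \<le> (grushin_dist (0, 0) (x, Y))\<^sup>2 / 2"
      using grushin_dist_hamilton_jacobi[of w b Y 0 x 0] assms by simp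
  qed (use assms in simp)
  ultimately show ?thesis
    using tendsto_upperbound by fastforce
qed

text \<open>At a midpoint both Hamilton--Jacobi bounds are attained, so that their derivatives in the
  parameters vanish; this determines the midpoint.\<close>

lemma origin_midpoint:
  assumes x1: "0 < x1" and w: "0 < w" "w < pi" and x: "0 \<le> x"
    and q: "q = (x1, x1\<^sup>2 * disp_diag w)"
    and d1: "grushin_dist (0, 0) (x, Y) = grushin_dist (0, 0) q / 2"
    and d2: "grushin_dist (x, Y) q = grushin_dist (0, 0) q / 2"
  shows "x = x1 / (2 * cos (w / 2))" "Y = x\<^sup>2 * disp_diag (w / 2)"
proof -
  define v where "v = w / 2"
  have v: "0 < v" "v < pi / 2" "w = 2 * v"
    using w by (auto simp: v_def)
  have s: "0 < sin v" "0 < cos v" "0 < sin w"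
    using v w by (auto intro!: sin_gt_zero cos_gt_zero)
  have v2: "sin (v + v) = sin w"
    using v(3) by simp
  define Y1 where "Y1 = x1\<^sup>2 * disp_diag w"
  define D where "D = grushin_dist (0, 0) q"
  have D: "D = x1 * w / sin w"
    unfolding D_def q by (rule grushin_dist_origin[OF x1 w])
  have d2': "grushin_dist (x, Y) (x1, Y1) = D / 2"
    using d2 by (simp add: D_def q Y1_def)
  \<comment> \<open>The lower bound from the origin with frequency \<open>w\<close> is attained at
    \<open>q\<close>; this is half of that equality.\<close>
  have D2: "D\<^sup>2 / 4 = v * Y1 + v / 2 * cot w * x1\<^sup>2"
    using s unfolding D Y1_def disp_diag_def v_def cot_def
    by (simp add: field_simps power2_eq_square)
  \<comment> \<open>The bound for the first half, from the origin to the midpoint, as a function of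
    the frequency.\<close>
  define h where "h r = r * Y + r / 2 * cot r * x\<^sup>2" for r
  have h_le: "h r \<le> D\<^sup>2 / 8" if "0 < r" "r < pi" for r
  proof -
    have "h r \<le> r * \<bar>Y\<bar> + r / 2 * cot r * x\<^sup>2"
      unfolding h_def using that by simp
    also have "\<dots> \<le> (D / 2)\<^sup>2 / 2"
      using grushin_dist_origin_lower[OF that, of Y x] d1 by (simp add: D_def)
    finally show ?thesis by (simp add: power_divide)
  qed
  \<comment> \<open>The bound for the second half, from the midpoint to \<open>q\<close>, with
    frequency fixed at \<open>v\<close> and the phase varying.\<close>
  define k where "k b = v * (Y1 - Y) + v / 2 * cot (v + b) * x1\<^sup>2 - v / 2 * cot b * x\<^sup>2" for b
  have k_le: "k b \<le> D\<^sup>2 / 8" if "0 < b" "v + b < pi" for b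
  proof -
    have "v * (Y1 - Y) \<le> v * \<bar>Y1 - Y\<bar>"
      using v by (intro mult_left_mono) auto
    then have "k b \<le> v * \<bar>Y1 - Y\<bar> + v / 2 * cot (v + b) * x1\<^sup>2 - v / 2 * cot b * x\<^sup>2"
      unfolding k_def by simp
    also have "\<dots> \<le> (D / 2)\<^sup>2 / 2"
      using grushin_dist_hamilton_jacobi[OF v(1) that, of Y1 Y x1 x] unfolding d2' .
    finally show ?thesis by (simp add: power_divide)
  qed
  \<comment> \<open>At phase \<open>b = v\<close> the terms of the midpoint cancel. Each summand is
    at most \<open>D\<^sup>2 / 8\<close>, so both are maximal there.\<close>
  have sum: "h v + k v = D\<^sup>2 / 4"
    unfolding D2 h_def k_def by (simp add: v(3) algebra_simps)
  have hv: "h v = D\<^sup>2 / 8" and kv: "k v = D\<^sup>2 / 8"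
    using sum h_le[of v] k_le[of v] v by linarith+
  have hd: "(h has_real_derivative Y + (1 / 2 * cot v - v / 2 / (sin v)\<^sup>2) * x\<^sup>2) (at v)"
    unfolding h_def using s
    by (auto intro!: derivative_eq_intros DERIV_cot simp: field_simps power2_eq_square)
  have "Y + (1 / 2 * cot v - v / 2 / (sin v)\<^sup>2) * x\<^sup>2 = 0"
  proof (rule DERIV_local_max[OF hd])
    show "0 < min v (pi - v)"
      using v by auto
    show "\<forall>r. \<bar>v - r\<bar> < min v (pi - v) \<longrightarrow> h r \<le> h v"
      unfolding hv by (intro allI impI h_le) auto
  qed
  then have "Y = - ((1 / 2 * cot v - v / 2 / (sin v)\<^sup>2) * x\<^sup>2)"
    by (simp only: eq_neg_iff_add_eq_0)
  moreover have "disp_diag v = v / 2 / (sin v)\<^sup>2 - 1 / 2 * cot v"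
    using s by (simp add: disp_diag_def cot_def diff_divide_distrib power2_eq_square)
  then have "x\<^sup>2 * disp_diag v = - ((1 / 2 * cot v - v / 2 / (sin v)\<^sup>2) * x\<^sup>2)"
    by (metis minus_diff_eq minus_mult_left mult.commute)
  ultimately show "Y = x\<^sup>2 * disp_diag (w / 2)"
    unfolding v_def[symmetric] by (simp only:)
  have kd: "(k has_real_derivative v / 2 * (x\<^sup>2 / (sin v)\<^sup>2 - x1\<^sup>2 / (sin w)\<^sup>2)) (at v)"
  proof -
    have sv: "sin v \<noteq> 0" "sin (v + v) \<noteq> 0"
      using s v2 by simp_all
    have "((\<lambda>b. v + b) has_real_derivative 1) (at v)"
      by (auto intro!: derivative_eq_intros)
    from DERIV_chain2[OF DERIV_cot this] sv(2)
    have "((\<lambda>b. cot (v + b)) has_real_derivative - inverse ((sin (v + v))\<^sup>2)) (at v)"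
      by simp
    then have cw: "((\<lambda>b. cot (v + b)) has_real_derivative - inverse ((sin w)\<^sup>2)) (at v)"
      by (simp only: v2)
    have *: "0 + v / 2 * - inverse ((sin w)\<^sup>2) * x1\<^sup>2 - v / 2 * - inverse ((sin v)\<^sup>2) * x\<^sup>2
        = v / 2 * (x\<^sup>2 / (sin v)\<^sup>2 - x1\<^sup>2 / (sin w)\<^sup>2)"
    proof -
      have "0 + v / 2 * - i * x1\<^sup>2 - v / 2 * - j * x\<^sup>2 = v / 2 * (x\<^sup>2 * j - x1\<^sup>2 * i)" for i j :: real
        by (simp add: algebra_simps)
      then show ?thesis
        unfolding divide_inverse[of "x\<^sup>2"] divide_inverse[of "x1\<^sup>2"] .
    qed
    from DERIV_diff[OF DERIV_add[OF DERIV_const[of "v * (Y1 - Y)"] DERIV_cmult_right[OF DERIV_cmult[OF cw, of "v / 2"], of "x1\<^sup>2"]]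
        DERIV_cmult_right[OF DERIV_cmult[OF DERIV_cot[OF sv(1)], of "v / 2"], of "x\<^sup>2"]]
    show ?thesis
      unfolding k_def * .
  qed
  \<comment> \<open>Criticality in the phase says that both halves lie on arcs of the same
    amplitude, which fixes \<open>x\<close>; criticality of \<open>h\<close> in the frequency has
    fixed \<open>Y\<close>.\<close>
  have "v / 2 * (x\<^sup>2 / (sin v)\<^sup>2 - x1\<^sup>2 / (sin w)\<^sup>2) = 0"
  proof (rule DERIV_local_max[OF kd])
    show "0 < min v (pi - 2 * v)"
      using v by auto
    show "\<forall>r. \<bar>v - r\<bar> < min v (pi - 2 * v) \<longrightarrow> k r \<le> k v"
      unfolding kv by (intro allI impI k_le) auto
  qed
  then have "(x / sin v)\<^sup>2 = (x1 / sin w)\<^sup>2"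
    using v by (simp add: power_divide)
  moreover have "0 \<le> x / sin v" "0 \<le> x1 / sin w"
    using x x1 s by simp_all
  ultimately have "x / sin v = x1 / sin w"
    by (rule power2_eq_imp_eq)
  also have "\<dots> = x1 / (2 * sin v * cos v)"
    using sin_double[of v] by (simp add: v(3))
  finally show "x = x1 / (2 * cos (w / 2))"
    using s by (simp add: v_def[symmetric] field_simps)
qed

section \<open>Thin boxes along the axis and their midpoints\<close>

text \<open>The height bound uses the smallest abscissa \<open>a\<close>, so every point of the box
  is reached from the origin with frequency at most \<epsilon>. Height 0 is excluded so that the
  frequency is positive.\<close>

definition target_box :: "real \<Rightarrow> real \<Rightarrow> real \<Rightarrow> (real \<times> real) set"
  where "target_box a b \<epsilon> = {a..b} \<times> {0<..a\<^sup>2 * disp_diag \<epsilon>}"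

text \<open>Bounds for the midpoint formulas of \<open>origin_midpoint\<close> as the end abscissa
  runs over \<open>[a, b]\<close> and the frequency over \<open>(0, \<epsilon>]\<close>.\<close>

definition midpoint_box :: "real \<Rightarrow> real \<Rightarrow> real \<Rightarrow> (real \<times> real) set"
  where "midpoint_box a b \<epsilon> =
    {a / 2..b / (2 * cos (\<epsilon> / 2))} \<times> {0..(b / (2 * cos (\<epsilon> / 2)))\<^sup>2 * disp_diag (\<epsilon> / 2)}"

lemma disp_diag_pos: "0 < w \<Longrightarrow> w < pi \<Longrightarrow> 0 < disp_diag w"
  using displacement_pos[of w 0 1] by (simp add: displacement_def)

lemma disp_diag_less_iff:
  "0 < v \<Longrightarrow> v < pi \<Longrightarrow> 0 < w \<Longrightarrow> w < pi \<Longrightarrow> disp_diag v < disp_diag w \<longleftrightarrow> v < w"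
  using displacement_less_iff[of v w 0 1] by (simp add: displacement_def)

lemma emeasure_box:
  fixes X1 X2 :: "real set"
  assumes "X1 \<in> sets borel" "X2 \<in> sets borel"
  shows "emeasure lborel (X1 \<times> X2) = emeasure lborel X1 * emeasure lborel X2"
  using assms lborel.emeasure_pair_measure_Times[of X1 lborel X2] by (simp add: lborel_prod)

lemma emeasure_target_box:
  assumes "0 < a" "a < b" "0 < \<epsilon>" "\<epsilon> < pi"
  shows "emeasure lborel (target_box a b \<epsilon>) = ennreal ((b - a) * (a\<^sup>2 * disp_diag \<epsilon>))"
  unfolding target_box_def using assms disp_diag_pos[of \<epsilon>]
  by (subst emeasure_box) (auto simp: ennreal_mult'')

lemma emeasure_midpoint_box:
  assumes "0 < a" "a < b" "0 < \<epsilon>" "\<epsilon> < pi"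
  shows "emeasure lborel (midpoint_box a b \<epsilon>) =
    ennreal ((b / (2 * cos (\<epsilon> / 2)) - a / 2) * ((b / (2 * cos (\<epsilon> / 2)))\<^sup>2 * disp_diag (\<epsilon> / 2)))"
proof -
  have "0 < cos (\<epsilon> / 2)"
    using assms by (intro cos_gt_zero) auto
  then have "a / 2 \<le> b / (2 * cos (\<epsilon> / 2))"
    using assms mult_mono[of a b "cos (\<epsilon> / 2)" 1] by (simp add: field_simps)
  then show ?thesis
    unfolding midpoint_box_def using disp_diag_pos[of "\<epsilon> / 2"] assms
    by (subst emeasure_box) (auto simp: ennreal_mult'' less_imp_le)
qed

lemma target_box_param:
  assumes ab: "0 < a" "0 < \<epsilon>" "\<epsilon> < pi" and q: "q \<in> target_box a b \<epsilon>"
  obtains x1 w where "a \<le> x1" "x1 \<le> b" "0 < w" "w \<le> \<epsilon>" "q = (x1, x1\<^sup>2 * disp_diag w)"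
proof -
  obtain x1 Y1 where q': "q = (x1, Y1)"
    by fastforce
  have x1: "a \<le> x1" "x1 \<le> b" and Y1: "0 < Y1" "Y1 \<le> a\<^sup>2 * disp_diag \<epsilon>"
    using q by (auto simp: q' target_box_def)
  obtain w where w: "0 < w" "w < pi" "displacement w 0 x1 = Y1"
    using displacement_surj[of 0 x1 Y1] x1 Y1 ab by auto
  then have Y1': "Y1 = x1\<^sup>2 * disp_diag w"
    by (simp add: displacement_def)
  have "a\<^sup>2 * disp_diag \<epsilon> \<le> x1\<^sup>2 * disp_diag \<epsilon>"
    using x1 ab disp_diag_pos[OF ab(2,3)] by (intro mult_right_mono power_mono) auto
  with Y1(2) have "x1\<^sup>2 * disp_diag w \<le> x1\<^sup>2 * disp_diag \<epsilon>"
    unfolding Y1' by (rule order_trans)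
  then have "disp_diag w \<le> disp_diag \<epsilon>"
    using x1 ab by simp
  then have "w \<le> \<epsilon>"
    using disp_diag_less_iff[OF ab(2,3) w(1,2)] by simp
  then show thesis
    using that[OF x1 w(1)] q' Y1' by simp
qed

lemma midpoint_in_box:
  assumes ab: "0 < a" "0 < \<epsilon>" "\<epsilon> < pi" and q: "q \<in> target_box a b \<epsilon>" and z: "z \<in> half_plane 1"
    and d: "grushin_dist (0, 0) z = grushin_dist (0, 0) q / 2" "grushin_dist z q = grushin_dist (0, 0) q / 2"
  shows "z \<in> midpoint_box a b \<epsilon>"
proof -
  obtain x1 w where x1: "a \<le> x1" "x1 \<le> b" and w: "0 < w" "w \<le> \<epsilon>" and q': "q = (x1, x1\<^sup>2 * disp_diag w)"
    using target_box_param[OF ab q] by blast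
  obtain x Y where z': "z = (x, Y)"
    by fastforce
  have x: "0 \<le> x"
    using z by (simp add: half_plane_def z')
  have "x = x1 / (2 * cos (w / 2))" "Y = x\<^sup>2 * disp_diag (w / 2)"
    using origin_midpoint[of x1 w x q Y] x1 ab w x q' d by (auto simp: z')
  note xY = this
  have c: "0 < cos (\<epsilon> / 2)" "cos (\<epsilon> / 2) \<le> cos (w / 2)" "cos (w / 2) \<le> 1"
    using ab w by (auto intro!: cos_gt_zero cos_monotone_0_pi_le)
  have "a / 2 \<le> x1 / 2"
    using x1 by simp
  also have "\<dots> \<le> x"
    unfolding xY(1) using c x1 ab by (intro divide_left_mono) auto
  finally have 1: "a / 2 \<le> x" .
  have 2: "x \<le> b / (2 * cos (\<epsilon> / 2))"
    unfolding xY(1) using c x1 ab by (intro frac_le) auto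
  have f: "0 < disp_diag (w / 2)" "disp_diag (w / 2) \<le> disp_diag (\<epsilon> / 2)"
    using disp_diag_pos[of "w / 2"] disp_diag_less_iff[of "\<epsilon> / 2" "w / 2"] ab w by auto
  have "Y \<le> (b / (2 * cos (\<epsilon> / 2)))\<^sup>2 * disp_diag (\<epsilon> / 2)"
    unfolding xY(2) using x 2 f by (intro mult_mono power_mono) auto
  with 1 2 f xY(2) show ?thesis
    by (simp add: midpoint_box_def z')
qed

text \<open>The distance is \<open>x1 * (w / sin w)\<close>, and \<open>w / sin w\<close> increases
  with \<open>w\<close>. Both bounds pin the contraction factor, which depends on the distance: for
  small \<epsilon> the upper one is close to \<open>b\<close>.\<close>

lemma target_box_dist:
  assumes ab: "0 < a" "0 < \<epsilon>" "\<epsilon> < pi" and q: "q \<in> target_box a b \<epsilon>"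
  shows "a \<le> grushin_dist (0, 0) q" "grushin_dist (0, 0) q \<le> b * (\<epsilon> / sin \<epsilon>)"
proof -
  obtain x1 w where x1: "a \<le> x1" "x1 \<le> b" and w: "0 < w" "w \<le> \<epsilon>" and q': "q = (x1, x1\<^sup>2 * disp_diag w)"
    using target_box_param[OF ab q] by blast
  have "x1 \<le> grushin_dist (0, 0) q"
    using grushin_dist_ge_fst[of x1 0 0 "x1\<^sup>2 * disp_diag w"] by (simp add: q')
  then show "a \<le> grushin_dist (0, 0) q"
    using x1 by simp
  have s: "0 < sin w" "0 < sin \<epsilon>"
    using w ab by (auto intro!: sin_gt_zero)
  have mono: "w / sin w \<le> \<epsilon> / sin \<epsilon>"
  proof (rule DERIV_nonneg_imp_nondecreasing[OF w(2), where f = "\<lambda>w. w / sin w"])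
    fix r assume r: "w \<le> r" "r \<le> \<epsilon>"
    have sr: "0 < sin r"
      using r w ab by (intro sin_gt_zero) auto
    have "((\<lambda>w. w / sin w) has_real_derivative (sin r - r * cos r) / (sin r * sin r)) (at r)"
      using sr by (auto intro!: derivative_eq_intros)
    moreover have "0 \<le> (sin r - r * cos r) / (sin r * sin r)"
      using sin_minus_id_cos_pos[of r] r w ab sr by simp
    ultimately show "\<exists>y. ((\<lambda>w. w / sin w) has_real_derivative y) (at r) \<and> 0 \<le> y"
      by blast
  qed
  have "grushin_dist (0, 0) q = x1 * (w / sin w)"
    unfolding q' using grushin_dist_origin[of x1 w] x1 w ab by simp
  also have "\<dots> \<le> b * (\<epsilon> / sin \<epsilon>)"
    using x1 ab w s mono by (intro mult_mono) auto
  finally show "grushin_dist (0, 0) q \<le> b * (\<epsilon> / sin \<epsilon>)" .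
qed

text \<open>As \<epsilon> tends to 0 the width of the midpoint box is half that of the target box.
  The height ratio tends to \<open>(b / 2)\<^sup>2 / a\<^sup>2\<close> times 1/2, the last factor
  because \<open>disp_diag\<close> is linear to first order at 0.\<close>

lemma box_ratio_limit:
  assumes ab: "0 < a" "a < b"
    and le: "\<forall>\<^sub>F \<epsilon> in at_right 0. ennreal c * emeasure lborel (target_box a b \<epsilon>) \<le> emeasure lborel (midpoint_box a b \<epsilon>)"
    and c: "0 \<le> c"
  shows "c * a\<^sup>2 \<le> b\<^sup>2 / 16"
proof -
  have "((\<lambda>\<epsilon>::real. ((\<epsilon> / 2 - sin (\<epsilon> / 2) * cos (\<epsilon> / 2)) / (2 * (sin (\<epsilon> / 2))\<^sup>2)) / ((\<epsilon> - sin \<epsilon> * cos \<epsilon>) / (2 * (sin \<epsilon>)\<^sup>2)))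
      \<longlongrightarrow> 1 / 2) (at_right 0)"
    by real_asymp (simp add: power2_eq_square)
  then have f: "((\<lambda>\<epsilon>. disp_diag (\<epsilon> / 2) / disp_diag \<epsilon>) \<longlongrightarrow> 1 / 2) (at_right 0)"
    by (simp add: disp_diag_def)
  have X: "((\<lambda>\<epsilon>. b / (2 * cos (\<epsilon> / 2))) \<longlongrightarrow> b / (2 * cos (0 / 2))) (at_right 0)"
    by (intro tendsto_intros) auto
  have "((\<lambda>\<epsilon>. (b / (2 * cos (\<epsilon> / 2)) - a / 2) * ((b / (2 * cos (\<epsilon> / 2)))\<^sup>2 * (disp_diag (\<epsilon> / 2) / disp_diag \<epsilon>)))
      \<longlongrightarrow> (b / (2 * cos (0 / 2)) - a / 2) * ((b / (2 * cos (0 / 2)))\<^sup>2 * (1 / 2))) (at_right 0)"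
    by (intro tendsto_intros f X) auto
  moreover have "\<forall>\<^sub>F \<epsilon> in at_right 0. c * ((b - a) * a\<^sup>2) \<le>
      (b / (2 * cos (\<epsilon> / 2)) - a / 2) * ((b / (2 * cos (\<epsilon> / 2)))\<^sup>2 * (disp_diag (\<epsilon> / 2) / disp_diag \<epsilon>))"
    using le eventually_at_right_real[OF pi_gt_zero]
  proof eventually_elim
    case (elim \<epsilon>)
    then have \<epsilon>: "0 < \<epsilon>" "\<epsilon> < pi" by auto
    have f: "0 < disp_diag \<epsilon>" "0 < disp_diag (\<epsilon> / 2)"
      using disp_diag_pos[of \<epsilon>] disp_diag_pos[of "\<epsilon> / 2"] \<epsilon> by auto
    have "ennreal (c * ((b - a) * (a\<^sup>2 * disp_diag \<epsilon>))) \<le>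
        ennreal ((b / (2 * cos (\<epsilon> / 2)) - a / 2) * ((b / (2 * cos (\<epsilon> / 2)))\<^sup>2 * disp_diag (\<epsilon> / 2)))"
      using elim(1) c unfolding emeasure_target_box[OF ab \<epsilon>] emeasure_midpoint_box[OF ab \<epsilon>]
      by (simp add: ennreal_mult')
    moreover have "0 \<le> (b / (2 * cos (\<epsilon> / 2)) - a / 2) * ((b / (2 * cos (\<epsilon> / 2)))\<^sup>2 * disp_diag (\<epsilon> / 2))"
    proof -
      have "0 < cos (\<epsilon> / 2)"
        using \<epsilon> by (intro cos_gt_zero) auto
      then have "a / 2 \<le> b / (2 * cos (\<epsilon> / 2))"
        using ab mult_mono[of a b "cos (\<epsilon> / 2)" 1] by (simp add: field_simps)
      then show ?thesis
        using f by simp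
    qed
    ultimately have "c * ((b - a) * (a\<^sup>2 * disp_diag \<epsilon>)) \<le>
        (b / (2 * cos (\<epsilon> / 2)) - a / 2) * ((b / (2 * cos (\<epsilon> / 2)))\<^sup>2 * disp_diag (\<epsilon> / 2))"
      by (simp add: ennreal_le_iff)
    then have "c * ((b - a) * a\<^sup>2) \<le>
        (b / (2 * cos (\<epsilon> / 2)) - a / 2) * ((b / (2 * cos (\<epsilon> / 2)))\<^sup>2 * disp_diag (\<epsilon> / 2)) / disp_diag \<epsilon>"
      using f by (subst pos_le_divide_eq) (auto simp: mult_ac)
    then show ?case
      by simp
  qed
  ultimately have "c * ((b - a) * a\<^sup>2) \<le> (b / (2 * cos (0 / 2)) - a / 2) * ((b / (2 * cos (0 / 2)))\<^sup>2 * (1 / 2))"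
    by (rule tendsto_lowerbound) simp
  then have "(b - a) * (c * a\<^sup>2) \<le> (b - a) * (b\<^sup>2 / 16)"
    by (simp add: field_simps power2_eq_square)
  then show ?thesis
    using ab by simp
qed

text \<open>Letting \<open>b\<close> decrease to \<open>a\<close> removes the distortion
  \<open>b\<^sup>2 / a\<^sup>2\<close> caused by using rectangles.\<close>

lemma box_ratio_bound:
  assumes ab: "0 < a" "a < b'" and c: "0 \<le> c"
    and le: "\<And>b. a < b \<Longrightarrow> b < b' \<Longrightarrow>
      \<forall>\<^sub>F \<epsilon> in at_right 0. ennreal c * emeasure lborel (target_box a b \<epsilon>) \<le> emeasure lborel (midpoint_box a b \<epsilon>)"
  shows "c \<le> 1 / 16"
proof -
  have "((\<lambda>b. b\<^sup>2 / 16) \<longlongrightarrow> a\<^sup>2 / 16) (at_right a)"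
    by (intro tendsto_intros) auto
  moreover have "\<forall>\<^sub>F b in at_right a. c * a\<^sup>2 \<le> b\<^sup>2 / 16"
  proof (rule eventually_mono[OF eventually_at_right_real[OF ab(2)]])
    fix b assume "b \<in> {a<..<b'}"
    then have "a < b" "b < b'" by auto
    then show "c * a\<^sup>2 \<le> b\<^sup>2 / 16"
      using ab c by (intro box_ratio_limit le)
  qed
  ultimately have "c * a\<^sup>2 \<le> a\<^sup>2 / 16"
    by (rule tendsto_lowerbound) simp
  then show ?thesis
    using ab by (simp add: field_simps)
qed

section \<open>Necessity of the conditions\<close>

context
  fixes \<sigma> :: real
  assumes \<sigma>: "\<sigma> = 1 \<or> \<sigma> = - 1"
begin

lemma reflected_midpoint_in_box:
  assumes ab: "0 < a" "0 < \<epsilon>" "\<epsilon> < pi" and q: "reflect_fst \<sigma> q \<in> target_box a b \<epsilon>" and z: "z \<in> half_plane \<sigma>"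
    and d: "grushin_dist (0, 0) z = grushin_dist (0, 0) q / 2" "grushin_dist z q = grushin_dist (0, 0) q / 2"
  shows "reflect_fst \<sigma> z \<in> midpoint_box a b \<epsilon>"
proof (rule midpoint_in_box[OF ab q])
  have 0: "reflect_fst \<sigma> (0, 0) = (0, 0)"
    by (simp add: reflect_fst_def)
  show "reflect_fst \<sigma> z \<in> half_plane 1"
    using z by (simp add: reflect_fst_half_plane)
  show "grushin_dist (0, 0) (reflect_fst \<sigma> z) = grushin_dist (0, 0) (reflect_fst \<sigma> q) / 2"
    "grushin_dist (reflect_fst \<sigma> z) (reflect_fst \<sigma> q) = grushin_dist (0, 0) (reflect_fst \<sigma> q) / 2"
    using d grushin_dist_reflect_fst[OF \<sigma>, of "(0, 0)"] grushin_dist_reflect_fst[OF \<sigma>, of z q] by (simp_all add: 0)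
qed

lemma target_box_half_measure:
  assumes ab: "0 < a" "a < b" and \<epsilon>: "0 < \<epsilon>" "\<epsilon> < pi"
  shows "reflect_fst \<sigma> -` target_box a b \<epsilon> \<in> sets (half_measure \<sigma>)"
    "emeasure (half_measure \<sigma>) (reflect_fst \<sigma> -` target_box a b \<epsilon>) = emeasure lborel (target_box a b \<epsilon>)"
    "0 < emeasure (half_measure \<sigma>) (reflect_fst \<sigma> -` target_box a b \<epsilon>)"
    "emeasure (half_measure \<sigma>) (reflect_fst \<sigma> -` target_box a b \<epsilon>) < \<infinity>"
    and midpoint_box_half_measure: "reflect_fst \<sigma> -` midpoint_box a b \<epsilon> \<in> sets (half_measure \<sigma>)"
    "emeasure (half_measure \<sigma>) (reflect_fst \<sigma> -` midpoint_box a b \<epsilon>) = emeasure lborel (midpoint_box a b \<epsilon>)"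
proof -
  have H: "half_plane \<sigma> \<in> sets borel"
    by (rule borel_closed[OF closed_half_plane])
  have *: "reflect_fst \<sigma> -` S \<in> sets (half_measure \<sigma>) \<and>
      emeasure (half_measure \<sigma>) (reflect_fst \<sigma> -` S) = emeasure lborel S"
    if S: "S \<in> sets borel" "S \<subseteq> half_plane 1" for S
  proof -
    have "reflect_fst \<sigma> -` S \<in> sets borel"
      using measurable_sets[OF reflect_fst_measurable S(1)] by simp
    moreover have "reflect_fst \<sigma> -` S \<subseteq> half_plane \<sigma>"
      using S(2) reflect_fst_half_plane[of \<sigma>] by blast
    ultimately show ?thesis
      using H emeasure_lborel_reflect_fst[OF \<sigma> S(1)]
      by (simp add: sets_restrict_space_iff emeasure_restrict_space)
  qed
  have t: "target_box a b \<epsilon> \<in> sets borel" "target_box a b \<epsilon> \<subseteq> half_plane 1"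
    and m: "midpoint_box a b \<epsilon> \<in> sets borel" "midpoint_box a b \<epsilon> \<subseteq> half_plane 1"
    using ab by (auto simp: target_box_def midpoint_box_def half_plane_def borel_prod[symmetric])
  show "reflect_fst \<sigma> -` target_box a b \<epsilon> \<in> sets (half_measure \<sigma>)"
    "emeasure (half_measure \<sigma>) (reflect_fst \<sigma> -` target_box a b \<epsilon>) = emeasure lborel (target_box a b \<epsilon>)"
    using *[OF t] by auto
  show "reflect_fst \<sigma> -` midpoint_box a b \<epsilon> \<in> sets (half_measure \<sigma>)"
    "emeasure (half_measure \<sigma>) (reflect_fst \<sigma> -` midpoint_box a b \<epsilon>) = emeasure lborel (midpoint_box a b \<epsilon>)"
    using *[OF m] by auto
  show "0 < emeasure (half_measure \<sigma>) (reflect_fst \<sigma> -` target_box a b \<epsilon>)"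
    "emeasure (half_measure \<sigma>) (reflect_fst \<sigma> -` target_box a b \<epsilon>) < \<infinity>"
    using *[OF t] emeasure_target_box[OF ab \<epsilon>] ab disp_diag_pos[OF \<epsilon>] by auto
qed

text \<open>Because midpoints are unique, any admissible selection of geodesics sends the target box
  into the midpoint box at time \<open>1 / 2\<close>; the choice of \<phi> has no influence.\<close>

lemma MCP0_half_plane_imp:
  assumes "MCP0 (half_space \<sigma>) (half_measure \<sigma>) N"
  shows "4 \<le> N"
proof -
  have o: "(0, 0) \<in> mspace (half_space \<sigma>)"
    by (simp add: half_plane_def)
  have msp: "mspace (half_space \<sigma>) = half_plane \<sigma>"
    by simp
  obtain \<phi> where \<phi>1: "\<phi> \<in> half_measure \<sigma> \<rightarrow>\<^sub>M borel_of_metric (Geo (half_space \<sigma>))"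
    and \<phi>2: "\<forall>y\<in>half_plane \<sigma>. \<phi> y 0 = (0, 0) \<and> \<phi> y 1 = y"
    and \<phi>3: "\<forall>A\<in>sets (half_measure \<sigma>). 0 < emeasure (half_measure \<sigma>) A \<and> emeasure (half_measure \<sigma>) A < \<infinity> \<longrightarrow>
      (\<forall>t\<in>{0..1}. ennreal (t powr N) * emeasure (half_measure \<sigma>) A \<le> outer_measure_of (half_measure \<sigma>) ((\<lambda>y. \<phi> y t) ` A))"
    using bspec[OF assms[unfolded MCP0_def] o] unfolding msp by (elim bexE conjE) (rule that)
  note \<phi> = \<phi>1 \<phi>2[rule_format, THEN conjunct1] \<phi>2[rule_format, THEN conjunct2]
  have half: "1 / 2 \<in> {0..1::real}"
    by simp
  have geo: "\<phi> y \<in> mspace (Geo (half_space \<sigma>))" if "y \<in> half_plane \<sigma>" for y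
    using measurable_space[OF \<phi>(1), of y] that by (simp add: space_restrict_space)
  have "(1 / 2) powr N \<le> 1 / 16"
  \<comment> \<open>For \<open>K = 0\<close> the factor does not depend on the distance, so the
    position of the boxes on the axis is arbitrary.\<close>
  proof (rule box_ratio_bound[of 1 2])
    fix b :: real assume b: "1 < b" "b < 2"
    show "\<forall>\<^sub>F \<epsilon> in at_right 0. ennreal ((1 / 2) powr N) * emeasure lborel (target_box 1 b \<epsilon>) \<le> emeasure lborel (midpoint_box 1 b \<epsilon>)"
    proof (rule eventually_mono[OF eventually_at_right_real[OF pi_gt_zero]])
      fix \<epsilon> assume "\<epsilon> \<in> {0<..<pi}"
      then have \<epsilon>: "0 < \<epsilon>" "\<epsilon> < pi" by auto
      define A Z where "A = reflect_fst \<sigma> -` target_box 1 b \<epsilon>" and "Z = reflect_fst \<sigma> -` midpoint_box 1 b \<epsilon>"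
      note T = target_box_half_measure[OF zero_less_one b(1) \<epsilon>, folded A_def]
      note M = midpoint_box_half_measure[OF zero_less_one b(1) \<epsilon>, folded Z_def]
      have "(\<lambda>y. \<phi> y (1 / 2)) ` A \<subseteq> Z"
      proof
        fix z assume "z \<in> (\<lambda>y. \<phi> y (1 / 2)) ` A"
        then obtain q where q: "q \<in> A" "z = \<phi> q (1 / 2)" by blast
        have qH: "q \<in> half_plane \<sigma>"
          using sets.sets_into_space[OF T(1)] q(1) by (auto simp: space_restrict_space)
        note g = mem_mspace_GeoD[OF geo[OF qH]]
        have "z \<in> half_plane \<sigma>"
          using g(1)[of "1 / 2"] by (simp add: q)
        moreover have "grushin_dist (0, 0) z = grushin_dist (0, 0) q / 2" "grushin_dist z q = grushin_dist (0, 0) q / 2"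
          using g(2)[of "1 / 2" 0] g(2)[of 1 "1 / 2"] \<phi>(2,3)[OF qH] by (simp_all add: q)
        ultimately show "z \<in> Z"
          using reflected_midpoint_in_box[of 1 \<epsilon> q b z] \<epsilon> q(1) by (simp add: A_def Z_def)
      qed
      then have "outer_measure_of (half_measure \<sigma>) ((\<lambda>y. \<phi> y (1 / 2)) ` A) \<le> emeasure (half_measure \<sigma>) Z"
        unfolding outer_measure_of_def using M(1) by (intro INF_lower) auto
      with \<phi>3[rule_format, OF T(1) conjI[OF T(3,4)] half]
      have "ennreal ((1 / 2) powr N) * emeasure (half_measure \<sigma>) A \<le> emeasure (half_measure \<sigma>) Z"
        by (rule order_trans)
      then show "ennreal ((1 / 2) powr N) * emeasure lborel (target_box 1 b \<epsilon>) \<le> emeasure lborel (midpoint_box 1 b \<epsilon>)"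
        unfolding T(2) M(2) .
    qed
  qed auto
  also have "1 / 16 = (1 / 2 :: real) powr 4"
    by (simp add: powr_numeral power_divide)
  finally show ?thesis
    using powr_less_mono'[of "1 / 2" N 4] by (auto simp: not_less[symmetric])
qed

text \<open>Almost every geodesic runs from the origin to a point of the target box and has its
  midpoint in the midpoint box, so the latter carries at least \<open>c\<close> times the mass of
  the target. The interval \<open>[a, b')\<close> localises the distances; for positive
  \<open>K\<close> it also keeps the target inside the ball to which the condition refers.\<close>

lemma MCP_Ohta_half_plane_imp:
  assumes mcp: "MCP_Ohta (half_space \<sigma>) (half_measure \<sigma>) K N"
    and ab: "0 < a" "a < b'" and b': "0 < K \<Longrightarrow> b' \<le> pi * sqrt ((N - 1) / K)"
    and c: "0 \<le> c" "\<And>l. a \<le> l \<Longrightarrow> l < b' \<Longrightarrow> c \<le> mcp_factor K N (1 / 2) l"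
  shows "c \<le> 1 / 16"
proof (rule box_ratio_bound[OF ab c(1)])
  fix b assume b: "a < b" "b < b'"
  have "((\<lambda>\<epsilon>::real. \<epsilon> / sin \<epsilon>) \<longlongrightarrow> 1) (at_right 0)"
    by real_asymp
  then have "((\<lambda>\<epsilon>. b * (\<epsilon> / sin \<epsilon>)) \<longlongrightarrow> b * 1) (at_right 0)"
    by (intro tendsto_intros)
  \<comment> \<open>This brings the distances from the origin to all points of the target box below
    \<open>b'\<close>.\<close>
  then have "\<forall>\<^sub>F \<epsilon> in at_right 0. b * (\<epsilon> / sin \<epsilon>) < b'"
    by (rule order_tendstoD(2)) (use b in simp)
  then show "\<forall>\<^sub>F \<epsilon> in at_right 0. ennreal c * emeasure lborel (target_box a b \<epsilon>) \<le> emeasure lborel (midpoint_box a b \<epsilon>)"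
    using eventually_at_right_real[OF pi_gt_zero]
  proof eventually_elim
    case (elim \<epsilon>)
    then have \<epsilon>: "0 < \<epsilon>" "\<epsilon> < pi" by auto
    let ?X = "half_space \<sigma>" and ?m = "half_measure \<sigma>"
    define A Z where "A = reflect_fst \<sigma> -` target_box a b \<epsilon>" and "Z = reflect_fst \<sigma> -` midpoint_box a b \<epsilon>"
    note T = target_box_half_measure[OF ab(1) b(1) \<epsilon>, folded A_def]
    note M = midpoint_box_half_measure[OF ab(1) b(1) \<epsilon>, folded Z_def]
    have AH: "A \<subseteq> half_plane \<sigma>"
      using sets.sets_into_space[OF T(1)] by (auto simp: space_restrict_space)
    have dist: "a \<le> grushin_dist (0, 0) q" "grushin_dist (0, 0) q < b'" if "q \<in> A" for q
    proof -
      have "reflect_fst \<sigma> q \<in> target_box a b \<epsilon>"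
        using that by (simp add: A_def)
      note target_box_dist[OF ab(1) \<epsilon> this]
      moreover have "grushin_dist (0, 0) (reflect_fst \<sigma> q) = grushin_dist (0, 0) q"
        using grushin_dist_reflect_fst[OF \<sigma>, of "(0, 0)" q] by (simp add: reflect_fst_def)
      ultimately show "a \<le> grushin_dist (0, 0) q" "grushin_dist (0, 0) q < b'"
        using elim(1) by auto
    qed
    have o: "(0, 0) \<in> mspace ?X"
      by (simp add: half_plane_def)
    interpret X: Metric_space "mspace ?X" "mdist ?X"
      by (rule Metric_space_mspace_mdist)
    have "0 < K \<longrightarrow> A \<subseteq> mball_of ?X (0, 0) (pi * sqrt ((N - 1) / K))"
    proof (intro impI subsetI)
      fix q assume "0 < K" "q \<in> A"
      then show "q \<in> mball_of ?X (0, 0) (pi * sqrt ((N - 1) / K))"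
        using dist(2)[of q] b' AH o unfolding mball_of_def X.in_mball by auto
    qed
    then obtain P where P: "prob_space P" "sets P = sets (borel_of_metric (Geo ?X))"
      "distr P ?m (\<lambda>\<gamma>. \<gamma> 0) = return ?m (0, 0)"
      "distr P ?m (\<lambda>\<gamma>. \<gamma> 1) = uniform_measure ?m A"
      "\<And>t B. t \<in> {0..1} \<Longrightarrow> B \<in> sets ?m \<Longrightarrow>
        emeasure (distr (density P (\<lambda>\<gamma>. ennreal (mcp_factor K N t (mdist ?X (\<gamma> 0) (\<gamma> 1))) * emeasure ?m A)) ?m (\<lambda>\<gamma>. \<gamma> t)) B
        \<le> emeasure ?m B"
      using mcp[unfolded MCP_Ohta_def, rule_format, OF o T(1)] T(3,4) by blast
    have spP: "space P = mspace (Geo ?X)"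
      using sets_eq_imp_space_eq[OF P(2)] by simp
    have eval: "(\<lambda>\<gamma>. \<gamma> t) \<in> borel_of_metric (Geo ?X) \<rightarrow>\<^sub>M ?m" if "t \<in> {0..1}" for t
      using measurable_Geo_eval[OF that] measurable_cong_sets[OF refl sets_half_measure[OF \<sigma>]] by blast
    have evalP: "(\<lambda>\<gamma>. \<gamma> t) \<in> P \<rightarrow>\<^sub>M ?m" if "t \<in> {0..1}" for t
      using eval[OF that] measurable_cong_sets[OF P(2) refl] by blast
    define f where "f \<gamma> = ennreal (mcp_factor K N (1 / 2) (mdist ?X (\<gamma> 0) (\<gamma> 1))) * emeasure ?m A"
      for \<gamma> :: "real \<Rightarrow> real \<times> real"
    have f: "f \<in> borel_measurable P"
    proof -
      have "f \<in> borel_measurable (borel_of_metric (Geo ?X))"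
        unfolding f_def
        using measurable_compose[OF measurable_Geo_length measurable_mcp_factor] by measurable
      then show ?thesis
        using measurable_cong_sets[OF P(2) refl] by blast
    qed
    have "AE \<gamma> in P. \<gamma> 0 = (0, 0)"
    proof -
      have H: "half_plane \<sigma> \<in> sets borel"
        by (rule borel_closed[OF closed_half_plane])
      have "{(0, 0)} \<in> sets ?m"
        using o H by (simp add: sets_restrict_space_iff)
      moreover have "{x. x = (0, 0) \<and> x \<in> half_plane \<sigma>} = {(0, 0)}"
        using o by auto
      ultimately have "AE q in return ?m (0, 0). q = (0, 0)"
        using o by (subst AE_return) (auto simp: space_restrict_space pred_def)
      then have "AE q in distr P ?m (\<lambda>\<gamma>. \<gamma> 0). q = (0, 0)"
        by (simp only: P(3))
      then show ?thesis
        by (rule AE_distrD[OF evalP, rotated]) simp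
    qed
    moreover have "AE \<gamma> in P. \<gamma> 1 \<in> A"
    proof -
      have "AE q in uniform_measure ?m A. q \<in> A"
        using T(1) by (intro AE_uniform_measureI) auto
      then have "AE q in distr P ?m (\<lambda>\<gamma>. \<gamma> 1). q \<in> A"
        by (simp only: P(4))
      then show ?thesis
        by (rule AE_distrD[OF evalP, rotated]) simp
    qed
    moreover have "AE \<gamma> in P. \<gamma> \<in> mspace (Geo ?X)"
      using AE_space[of P] by (simp add: spP)
    ultimately have ae: "AE \<gamma> in P. ennreal c * emeasure ?m A \<le> f \<gamma> * indicator ((\<lambda>\<gamma>. \<gamma> (1 / 2)) -` Z \<inter> space P) \<gamma>"
    proof eventually_elim
      case (elim \<gamma>)
      note g = mem_mspace_GeoD[OF elim(3)]
      have "\<gamma> (1 / 2) \<in> half_plane \<sigma>"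
        using g(1)[of "1 / 2"] by simp
      moreover have "grushin_dist (0, 0) (\<gamma> (1 / 2)) = grushin_dist (0, 0) (\<gamma> 1) / 2"
        "grushin_dist (\<gamma> (1 / 2)) (\<gamma> 1) = grushin_dist (0, 0) (\<gamma> 1) / 2"
        using g(2)[of "1 / 2" 0] g(2)[of 1 "1 / 2"] elim(1) by simp_all
      ultimately have "\<gamma> (1 / 2) \<in> Z"
        using reflected_midpoint_in_box[of a \<epsilon> "\<gamma> 1" b "\<gamma> (1 / 2)"] \<epsilon> ab elim(2) by (simp add: A_def Z_def)
      moreover have "c \<le> mcp_factor K N (1 / 2) (mdist ?X (\<gamma> 0) (\<gamma> 1))"
        using c(2) dist[OF elim(2)] elim(1) by simp
      then have "ennreal c * emeasure ?m A \<le> f \<gamma>"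
        unfolding f_def by (intro mult_right_mono ennreal_leI) auto
      ultimately show ?case
        using elim(3) by (simp add: spP)
    qed
    have Zs: "(\<lambda>\<gamma>. \<gamma> (1 / 2)) -` Z \<inter> space P \<in> sets P"
      using measurable_sets[OF evalP M(1), of "1 / 2"] by simp
    have "ennreal c * emeasure ?m A = (\<integral>\<^sup>+\<gamma>. ennreal c * emeasure ?m A \<partial>P)"
      using prob_space.emeasure_space_1[OF P(1)] by simp
    also have "\<dots> \<le> (\<integral>\<^sup>+\<gamma>. f \<gamma> * indicator ((\<lambda>\<gamma>. \<gamma> (1 / 2)) -` Z \<inter> space P) \<gamma> \<partial>P)"
      by (rule nn_integral_mono_AE[OF ae])
    also have "\<dots> = emeasure (density P f) ((\<lambda>\<gamma>. \<gamma> (1 / 2)) -` Z \<inter> space P)"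
      using f Zs by (simp add: emeasure_density)
    also have "\<dots> = emeasure (distr (density P f) ?m (\<lambda>\<gamma>. \<gamma> (1 / 2))) Z"
    proof -
      have "(\<lambda>\<gamma>. \<gamma> (1 / 2)) \<in> density P f \<rightarrow>\<^sub>M ?m"
        using evalP[of "1 / 2"] measurable_cong_sets[of "density P f" P ?m ?m] by auto
      then show ?thesis
        using M(1) by (simp add: emeasure_distr)
    qed
    also have "\<dots> \<le> emeasure ?m Z"
      using P(5)[of "1 / 2" Z] M(1) unfolding f_def by simp
    finally show "ennreal c * emeasure lborel (target_box a b \<epsilon>) \<le> emeasure lborel (midpoint_box a b \<epsilon>)"
      unfolding T(2) M(2) .
  qed
qed

end

section \<open>Lower bounds for the contraction factor at time 1/2\<close>

text \<open>From two thirds of the maximal radius on, the rescaled length \<theta> satisfies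
  \<open>\<theta> / 2 \<ge> pi / 3\<close>, hence \<open>2 * cos (\<theta> / 2) \<le> 1\<close> and
  the quotient of sines is at least 1. What remains is the prefactor \<open>t = 1 / 2\<close>,
  whatever \<open>N\<close> is.\<close>

lemma mcp_factor_half_pos:
  assumes K: "0 < K" and N: "1 < N"
    and l: "2 / 3 * (pi * sqrt ((N - 1) / K)) \<le> l" "l < pi * sqrt ((N - 1) / K)"
  shows "1 / 2 \<le> mcp_factor K N (1 / 2) l"
proof -
  define k R where "k = sqrt K / sqrt (N - 1)" and "R = pi * sqrt ((N - 1) / K)"
  define \<theta> where "\<theta> = k * l"
  have kR: "k * R = pi" and k: "0 < k"
    using K N by (simp_all add: k_def R_def real_sqrt_divide)
  have "k * (2 / 3 * R) \<le> \<theta>" "\<theta> < k * R"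
    unfolding \<theta>_def using l k by (auto simp: R_def intro: mult_left_mono)
  moreover have "k * (2 / 3 * R) = 2 / 3 * (k * R)"
    by (rule mult.left_commute)
  ultimately have \<theta>: "2 / 3 * pi \<le> \<theta>" "\<theta> < pi"
    unfolding kR by linarith+
  have s: "0 < sin \<theta>" "0 < sin (\<theta> / 2)" "0 < cos (\<theta> / 2)"
    using \<theta> pi_gt_zero by (auto intro!: sin_gt_zero cos_gt_zero)
  have "cos (\<theta> / 2) \<le> cos (pi / 3)"
    using \<theta> by (intro cos_monotone_0_pi_le) auto
  then have "sin \<theta> \<le> sin (\<theta> / 2)"
    using s sin_double[of "\<theta> / 2"] by (simp add: cos_60)
  then have "1 \<le> (sin (\<theta> / 2) / sin \<theta>) powr (N - 1)"
    using s N by (intro ge_one_powr_ge_zero) auto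
  moreover have "mcp_factor K N (1 / 2) l = 1 / 2 * (sin (\<theta> / 2) / sin \<theta>) powr (N - 1)"
  proof -
    have e: "sqrt K * (1 / 2 * l / sqrt (N - 1)) = \<theta> / 2" "sqrt K * (l / sqrt (N - 1)) = \<theta>"
      by (simp_all add: \<theta>_def k_def)
    show ?thesis
      unfolding mcp_factor_def s_fun_def Let_def e using K N s by simp
  qed
  ultimately show ?thesis
    by simp
qed

text \<open>By the double-angle formula the quotient is \<open>1 / (2 * cosh (k * l / 2))\<close>,
  which tends to 1/2 at short distances: curvature is invisible there and the factor tends to
  \<open>(1 / 2) powr N\<close>.\<close>

lemma mcp_factor_half_neg:
  assumes K: "K < 0" and N: "1 \<le> N" and c: "c < (1 / 2) powr N"
  shows "\<exists>\<delta>>0. \<forall>l. 0 < l \<and> l < \<delta> \<longrightarrow> c \<le> mcp_factor K N (1 / 2) l"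
proof (cases "N = 1")
  case True
  then show ?thesis
    using c by (intro exI[of _ 1]) (auto simp: mcp_factor_def Let_def)
next
  case False
  define k where "k = sqrt (- K) / sqrt (N - 1)"
  have k: "0 < k"
    using K N False by (simp add: k_def)
  have eq: "mcp_factor K N (1 / 2) l = 1 / 2 * (1 / (2 * cosh (k * l / 2))) powr (N - 1)" if "0 < l" for l
  proof -
    have "sinh (k * l) = 2 * sinh (k * l / 2) * cosh (k * l / 2)"
      using sinh_double[of "k * l / 2"] by simp
    moreover have "0 < sinh (k * l / 2)"
      using k that by simp
    ultimately have s: "sinh (k * l / 2) / sinh (k * l) = 1 / (2 * cosh (k * l / 2))" "sinh (k * l) \<noteq> 0"
      by auto
    have e: "sqrt (- K) * (1 / 2 * l / sqrt (N - 1)) = k * l / 2" "sqrt (- K) * (l / sqrt (N - 1)) = k * l"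
      by (simp_all add: k_def)
    show ?thesis
      unfolding mcp_factor_def s_fun_def Let_def e s(1)[symmetric] using K N False s(2) by simp
  qed
  have "((\<lambda>l. 1 / 2 * (1 / (2 * cosh (k * l / 2))) powr (N - 1)) \<longlongrightarrow>
      1 / 2 * (1 / (2 * cosh (k * 0 / 2))) powr (N - 1)) (at_right 0)"
    by (intro tendsto_intros) auto
  moreover have "1 / 2 * (1 / (2 * cosh (k * 0 / 2))) powr (N - 1) = (1 / 2 :: real) powr N"
    by (simp add: powr_diff)
  ultimately have "\<forall>\<^sub>F l in at_right 0. c < 1 / 2 * (1 / (2 * cosh (k * l / 2))) powr (N - 1)"
    using c by (intro order_tendstoD(1)) auto
  then obtain \<delta> where \<delta>: "0 < \<delta>" "\<And>l. 0 < l \<Longrightarrow> l < \<delta> \<Longrightarrow> c < 1 / 2 * (1 / (2 * cosh (k * l / 2))) powr (N - 1)"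
    unfolding eventually_at_right_field by blast
  have "c \<le> mcp_factor K N (1 / 2) l" if "0 < l" "l < \<delta>" for l
    unfolding eq[OF that(1)] by (rule less_imp_le[OF \<delta>(2)[OF that]])
  with \<delta>(1) show ?thesis
    by blast
qed

lemma MCP_half_plane_iff:
  assumes \<sigma>: "\<sigma> = 1 \<or> \<sigma> = - 1" and N: "1 \<le> N" "1 < N \<or> (N = 1 \<and> K \<le> 0)"
  shows "MCP (submetric grushin_plane (half_plane \<sigma>)) (restrict_space lborel (half_plane \<sigma>)) K N \<longleftrightarrow> K \<le> 0 \<and> 4 \<le> N"
proof
  assume "K \<le> 0 \<and> 4 \<le> N"
  then show "MCP (submetric grushin_plane (half_plane \<sigma>)) (restrict_space lborel (half_plane \<sigma>)) K N"
    using contraction.MCP[OF contraction_half_plane[OF \<sigma>]] by blast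
next
  assume mcp: "MCP (submetric grushin_plane (half_plane \<sigma>)) (restrict_space lborel (half_plane \<sigma>)) K N"
  consider "K = 0" | "0 < K" | "K < 0"
    by linarith
  then show "K \<le> 0 \<and> 4 \<le> N"
  proof cases
    case 1
    then show ?thesis
      using mcp MCP0_half_plane_imp[OF \<sigma>, of N] by (simp add: MCP_def)
  next
    case 2
    define R where "R = pi * sqrt ((N - 1) / K)"
    have "0 < R"
      using 2 N by (auto simp: R_def)
    \<comment> \<open>A contradiction for every \<open>N\<close>: near the maximal radius the
      definition demands half of the volume, while midpoints leave only a sixteenth.\<close>
    have "1 / 2 \<le> (1 / 16 :: real)"
    proof (rule MCP_Ohta_half_plane_imp[OF \<sigma>, of K N "2 / 3 * R" R])
      show "MCP_Ohta (submetric grushin_plane (half_plane \<sigma>)) (restrict_space lborel (half_plane \<sigma>)) K N"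
        using mcp 2 by (simp add: MCP_def)
      show "1 / 2 \<le> mcp_factor K N (1 / 2) l" if "2 / 3 * R \<le> l" "l < R" for l
        using mcp_factor_half_pos[of K N l] that 2 N by (auto simp: R_def)
      show "R \<le> pi * sqrt ((N - 1) / K)"
        by (simp add: R_def)
    qed (use \<open>0 < R\<close> in auto)
    then show ?thesis by simp
  next
    case 3
    have "4 \<le> N"
    proof (rule ccontr)
      assume "\<not> 4 \<le> N"
      then have "(1 / 2 :: real) powr 4 < (1 / 2) powr N"
        by (intro powr_less_mono') auto
      then have "1 / 16 < (1 / 2 :: real) powr N"
        by (simp add: powr_numeral power_divide)
      \<comment> \<open>The factor only approaches \<open>(1 / 2) powr N\<close> in the limit, so a
        strictly smaller constant above 1/16 is used.\<close>
      then obtain c where c: "1 / 16 < c" "c < (1 / 2) powr N"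
        using dense by blast
      obtain \<delta> where \<delta>: "0 < \<delta>" "\<And>l. 0 < l \<Longrightarrow> l < \<delta> \<Longrightarrow> c \<le> mcp_factor K N (1 / 2) l"
        using mcp_factor_half_neg[OF 3 N(1) c(2)] by blast
      have "c \<le> 1 / 16"
      proof (rule MCP_Ohta_half_plane_imp[OF \<sigma>, of K N "\<delta> / 2" \<delta>])
        show "MCP_Ohta (submetric grushin_plane (half_plane \<sigma>)) (restrict_space lborel (half_plane \<sigma>)) K N"
          using mcp 3 by (simp add: MCP_def)
      qed (use 3 c \<delta> in auto)
      with c show False by simp
    qed
    with 3 show ?thesis by simp
  qed
qed

theorem theorem8:
  fixes K N :: real
  assumes "N \<ge> 1"
    and "N > 1 \<or> (N = 1 \<and> K \<le> 0)"
  shows "(MCP grushin_half_pos (restrict_space lborel half_plane_pos) K N \<longleftrightarrow> K \<le> 0 \<and> N \<ge> 4)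
    \<and> (MCP grushin_half_neg (restrict_space lborel half_plane_neg) K N \<longleftrightarrow> K \<le> 0 \<and> N \<ge> 4)"
  using MCP_half_plane_iff[of 1 N K] MCP_half_plane_iff[of "- 1" N K] assms
  by (simp add: grushin_half_pos_def grushin_half_neg_def half_plane_eq)

end
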